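(* For large $x$ put $\lambda'=\lambda'(x)=\exp\left(\frac{1}{\sqrt7}\sqrt{\log_2 x\,\log_3 x}\right)$. Assume that $\mathcal{A}\subset\mathbb{N}$ satisfies $\mathbf{HL}[\phi,\psi]$ with $\phi(x)=\lambda'(x)\log x$ and $\psi(x)=\exp\left(\sqrt{\log_2 x\,\log_3 x}\right)$. Then, for all sufficiently large $x$, $$M_{\mathcal{A}}(x;\lambda\log x)=\frac{x e^{-\lambda}}{\log x}\left(1+\mathcal{O}\left((\log_2 x)^{-10}\right)\right),$$ uniformly for $0<\lambda\le\lambda'$.
   Context: $\log_1 x=\max\{0,\log x\}$ and $\log_k x=\max\{0,\log(\log_{k-1}x)\}$ for $k\ge2$ (iterated logarithms). For $\mathcal{A}\subset\mathbb{N}$ (a set of positive integers), $M_{\mathcal{A}}(x;y)=|\{n\le x: n\in\mathcal{A}\text{ and }[n+1,n+y]\cap\mathcal{A}=\varnothing\}|$. For a finite set $\mathcal{H}\subset\mathbb{Z}$ the singular series is $\mathfrak{S}(\mathcal{H})=\prod_p\left(1-\frac{|\mathcal{H}\bmod p|}{p}\right)\left(1-\frac1p\right)^{-|\mathcal{H}|}$, the product over all primes $p$, where $|\mathcal H\bmod p|$ is the number of residue classes mod $p$ occupied by $\mathcal H$. Let $\phi,\psi$ be positive real-valued functions. $\mathcal{A}\subset\mathbb{N}$ satisfies $\mathbf{HL}[\phi,\psi]$ if there is a constant $x_0$ such that for all $x\ge x_0$ and all finite sets of integers $\mathcal{H}\subset[0,\phi(x)]$ with $|\mathcal{H}|\le\psi(x)$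 (with $x_0$ independent of $\mathcal{H}$), $$|\{n\le x: n+h\in\mathcal{A}\text{ for all }h\in\mathcal{H}\}|=\mathfrak{S}(\mathcal{H})\int_2^x\frac{dt}{\log^{|\mathcal{H}|}t}+E(x,\mathcal{H}),\qquad |E(x,\mathcal{H})|\le x e^{-\psi(x)\log_2 x}.$$ The implied constant in $\mathcal{O}$ is absolute; "sufficiently large" may depend on $\mathcal{A}$. *)

theory Defs
  imports "HOL-Analysis.Analysis" "HOL-Computational_Algebra.Primes"
begin

text \<open>
  Iterated logarithms \<open>log\<^sub>k x\<close> for \<open>k \<ge> 1\<close>; the value at \<open>k = 0\<close> is only the start of the
  recursion. Where the argument is \<open>0\<close> the library convention \<open>ln 0 = 0\<close> gives the intended
  value \<open>max {0, -\<infinity>} = 0\<close>.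
\<close>

primrec iter_log :: "nat \<Rightarrow> real \<Rightarrow> real" where
  "iter_log 0 x = x"
| "iter_log (Suc k) x = max 0 (ln (iter_log k x))"

text \<open>The interval \<open>[n + 1, n + y]\<close> is a real interval.\<close>

definition gap_count :: "nat set \<Rightarrow> real \<Rightarrow> real \<Rightarrow> nat" where
  "gap_count A x y =
     card {n. real n \<le> x \<and> n \<in> A \<and> {m \<in> A. real n + 1 \<le> real m \<and> real m \<le> real n + y} = {}}"

text \<open>
  The product over the primes is indexed by all natural numbers, with factor \<open>1\<close> at the
  non-primes. The library's infinite product takes the value \<open>0\<close> if finitely many factors
  vanish and the rest converges, which is what is needed for inadmissible \<open>H\<close>.
\<close>

definition singular_series :: "int set \<Rightarrow> real" where
  "singular_series H =
     (\<Prod>p::nat. if prime p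
        then (1 - real (card ((\<lambda>h. h mod int p) ` H)) / real p) / (1 - 1 / real p) ^ card H
        else 1)"

definition tuple_count :: "nat set \<Rightarrow> int set \<Rightarrow> real \<Rightarrow> nat" where
  "tuple_count A H x = card {n::nat. 1 \<le> n \<and> real n \<le> x \<and> (\<forall>h\<in>H. int n + h \<in> int ` A)}"

definition HL :: "(real \<Rightarrow> real) \<Rightarrow> (real \<Rightarrow> real) \<Rightarrow> nat set \<Rightarrow> bool" where
  "HL \<phi> \<psi> A \<longleftrightarrow>
     (\<exists>x0. \<forall>x\<ge>x0. \<forall>H::int set.
        finite H \<and> (\<forall>h\<in>H. 0 \<le> h \<and> real_of_int h \<le> \<phi> x) \<and> real (card H) \<le> \<psi> x \<longrightarrow>
        \<bar>real (tuple_count A H x)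
           - singular_series H * integral {2..x} (\<lambda>t. 1 / ln t ^ card H)\<bar>
          \<le> x * exp (- \<psi> x * iter_log 2 x))"

definition lambda_max :: "real \<Rightarrow> real" where
  "lambda_max x = exp (1 / sqrt 7 * sqrt (iter_log 2 x * iter_log 3 x))"

end

theory Submission
  imports Defs "HOL-Number_Theory.Cong" "HOL-Real_Asymp.Real_Asymp"
begin

text \<open>
  By inclusion-exclusion the gap count is an alternating sum, over sets \<open>H\<close> of at most \<open>K\<close> elements
  of \<open>[1, m]\<close> with \<open>m = \<lfloor>\<lambda> log x\<rfloor>\<close>, of tuple counts for \<open>{0} \<union> H\<close>, and the hypothesis replaces these by
  integrals of \<open>S({0} \<union> H) / (log t)^(|H| + 1)\<close>. For fixed \<open>t\<close> the resulting sum is, up to a negligible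
  error, a probability: remove one random residue class modulo each prime \<open>p \<le> w = exp (10 \<lambda>')\<close> and keep
  each surviving integer with probability \<open>\<theta>\<close>, where \<open>\<theta> \<Prod>(1 - 1/p) = 1 / log t\<close>; the sum is the
  probability that \<open>0\<close> is kept and nothing in \<open>[1, m]\<close> is. It equals \<open>g m - g (m + 1)\<close>, where \<open>g m\<close> is the
  mean of \<open>(1 - \<theta>)^N\<close> and \<open>N\<close> counts the survivors of the sieve in an interval of length \<open>m\<close>.

  Jensen's inequality bounds \<open>g m\<close> below by essentially \<open>exp (- m / log t)\<close>. For the upper bound, the
  primes up to \<open>w1 = \<lambda>' powr 3.1\<close> are treated by Brun's sieve, uniformly in the residue classes, and the
  larger ones by an exponential moment estimate applied prime by prime. As the differences
  \<open>g m - g (m + 1)\<close> decrease in \<open>m\<close>, averaging over short ranges of \<open>m\<close> gives their asymptotics.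
\<close>

section \<open>Elementary symmetric sums and Bonferroni inequalities\<close>

text \<open>The terms of the inclusion-exclusion sum can be far larger than its value, of order
  \<open>exp (- \<lambda>)\<close>, so estimating them one by one is hopeless. In the model the
  whole sum is a probability, to which positivity, convexity and monotonicity apply.

  To make the tail of the singular series negligible against \<open>exp (- 2 \<lambda>')\<close>,
  the sieve runs to \<open>exp (10 \<lambda>')\<close>. This makes \<open>\<theta> log x\<close> as
  large as about \<open>\<lambda>' powr 1.06\<close>, and \<open>\<theta> m\<close>, which governs
  the truncation error, as large as \<open>\<lambda>' powr 2.06\<close>. The truncation
  \<open>K\<close>, about \<open>\<lambda>' powr 2.5\<close>, exceeds this and still stays below
  \<open>\<psi>(x) = \<lambda>' powr \<surd>7\<close>.

  Neither treatment of the primes works alone. The moment estimate loses about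
  \<open>\<lambda>' powr 3.06 / w1\<close> in the exponent, so it is usable only for primes beyond
  \<open>\<lambda>' powr 3.1\<close>. Brun's sieve at level \<open>r\<close> needs
  \<open>w1 ^ r\<close> well below \<open>log x\<close>, which rules out going up to
  \<open>exp (10 \<lambda>')\<close>.\<close>

definition esym :: "('a \<Rightarrow> real) \<Rightarrow> 'a set \<Rightarrow> nat \<Rightarrow> real" where
  "esym q P k = (\<Sum>D | D \<subseteq> P \<and> card D = k. \<Prod>p\<in>D. q p)"

lemma finite_subsets_card: "finite P \<Longrightarrow> finite {D. D \<subseteq> P \<and> card D = k}"
  by (rule finite_subset[of _ "Pow P"]) auto

lemma esym_0: 
  assumes "finite P" shows "esym q P 0 = 1"
proof -
  have "{D. D \<subseteq> P \<and> card D = 0} = {{}}"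
    using assms by (auto simp: card_eq_0_iff dest: finite_subset)
  then show ?thesis by (simp add: esym_def)
qed

lemma esym_empty_Suc: "esym q {} (Suc k) = 0"
proof -
  have "{D. D \<subseteq> {} \<and> card D = Suc k} = ({} :: 'a set set)" by auto
  then show ?thesis unfolding esym_def by (metis sum.empty)
qed

lemma esym_insert:
  assumes "finite P" "p \<notin> P"
  shows "esym q (insert p P) (Suc k) = esym q P (Suc k) + q p * esym q P k"
proof -
  have fin: "D \<subseteq> P \<Longrightarrow> finite D" for D using assms(1) finite_subset by blast
  have *: "{D. D \<subseteq> insert p P \<and> card D = Suc k} =
     {D. D \<subseteq> P \<and> card D = Suc k} \<union> insert p ` {D. D \<subseteq> P \<and> card D = k}" (is "?A = ?B \<union> ?C")
  proof (intro equalityI subsetI)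
    fix D assume D: "D \<in> ?A"
    show "D \<in> ?B \<union> ?C"
    proof (cases "p \<in> D")
      case True
      then have "D = insert p (D - {p})" by auto
      moreover have "D - {p} \<subseteq> P" "card (D - {p}) = k" using D True by (auto simp: card_Diff_singleton)
      ultimately show ?thesis by blast
    qed (use D in auto)
  next
    fix D assume "D \<in> ?B \<union> ?C"
    then show "D \<in> ?A"
      using fin assms(2) by (fastforce simp: card_insert_if)
  qed
  have disj: "?B \<inter> ?C = {}" using assms(2) by auto
  have inj: "inj_on (insert p) {D. D \<subseteq> P \<and> card D = k}"
    using assms(2) by (auto simp: inj_on_def)
  have "(\<Sum>D\<in>?C. \<Prod>p\<in>D. q p) = (\<Sum>D | D \<subseteq> P \<and> card D = k. \<Prod>p\<in>insert p D. q p)"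
    by (simp add: sum.reindex[OF inj])
  also have "\<dots> = (\<Sum>D | D \<subseteq> P \<and> card D = k. q p * (\<Prod>p\<in>D. q p))"
    using assms(2) fin by (intro sum.cong refl prod.insert) auto
  finally show ?thesis
    unfolding esym_def * using assms(1) disj
    by (subst sum.union_disjoint) (auto simp: finite_subsets_card sum_distrib_left)
qed

text \<open>Expanding \<open>(\<Sum>p\<in>P. q p) ^ k\<close> yields each product over a
  \<open>k\<close>-set exactly \<open>fact k\<close> times, and otherwise only nonnegative
  terms.\<close>

lemma esym_le:
  assumes "finite P" "\<And>p. p \<in> P \<Longrightarrow> 0 \<le> q p"
  shows "esym q P k \<le> (\<Sum>p\<in>P. q p) ^ k / fact k"
  using assms
proof (induction P arbitrary: k rule: finite_induct)
  case empty
  then show ?case by (cases k) (auto simp: esym_0 esym_empty_Suc)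
next
  case (insert p P)
  show ?case
  proof (cases k)
    case 0
    with insert show ?thesis by (simp add: esym_0)
  next
    case (Suc j)
    define a where "a = (\<Sum>p\<in>P. q p)"
    have a: "a \<ge> 0" unfolding a_def using insert by (intro sum_nonneg) auto
    have q: "q p \<ge> 0" using insert by auto
    \<comment> \<open>The first two terms of the binomial expansion; divided by
      \<open>fact (Suc j)\<close> they are the two terms of the recursion
      \<open>esym_insert\<close>.\<close>
    have bern: "(a + q p) ^ Suc n \<ge> a ^ Suc n + real (Suc n) * q p * a ^ n" for n
    proof (induction n)
      case (Suc n)
      have "(a + q p) ^ Suc (Suc n) \<ge> (a + q p) * (a ^ Suc n + real (Suc n) * q p * a ^ n)"
        using Suc a q mult_left_mono[of _ _ "a + q p"] by simp
      moreover have "(a + q p) * (a ^ Suc n + real (Suc n) * q p * a ^ n) =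
         a ^ Suc (Suc n) + real (Suc (Suc n)) * q p * a ^ Suc n + real (Suc n) * (q p)^2 * a ^ n"
        by (simp add: algebra_simps power2_eq_square)
      moreover have "real (Suc n) * (q p)^2 * a ^ n \<ge> 0" using a by simp
      ultimately show ?case by linarith
    qed simp
    have "esym q (insert p P) k = esym q P (Suc j) + q p * esym q P j"
      using insert Suc by (simp add: esym_insert)
    also have "\<dots> \<le> a ^ Suc j / fact (Suc j) + q p * (a ^ j / fact j)"
      unfolding a_def using insert.prems q by (intro add_mono mult_left_mono insert.IH) auto
    also have "\<dots> = (a ^ Suc j + real (Suc j) * q p * a ^ j) / fact (Suc j)"
      by (simp add: add_divide_distrib fact_Suc del: of_nat_Suc)
    also have "\<dots> \<le> (a + q p) ^ Suc j / fact (Suc j)"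
      using bern by (intro divide_right_mono) auto
    finally show ?thesis using insert Suc by (simp add: a_def add.commute)
  qed
qed

text \<open>Real weights let one inequality serve indicators (counting), \<open>1 / p\<close>
  (densities) and the constant \<open>\<theta>\<close> (the model). Adding a point turns the
  remainder \<open>R P r\<close> into \<open>R P r - q p * R P j\<close> with
  \<open>r = Suc j\<close>; after multiplication by \<open>(-1) ^ Suc r\<close> both terms have the
  same sign, so induction on \<open>P\<close> works.\<close>

theorem bonferroni:
  assumes "finite P" "\<And>p. p \<in> P \<Longrightarrow> 0 \<le> q p \<and> q p \<le> 1"
  shows "0 \<le> (-1) ^ Suc r * ((\<Prod>p\<in>P. 1 - q p) - (\<Sum>k\<le>r. (-1) ^ k * esym q P k)) \<and>
         (-1) ^ Suc r * ((\<Prod>p\<in>P. 1 - q p) - (\<Sum>k\<le>r. (-1) ^ k * esym q P k)) \<le> esym q P (Suc r)"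
  using assms
proof (induction P arbitrary: r rule: finite_induct)
  case empty
  have "(\<Sum>k\<le>r. (-1) ^ k * esym q {} k) = 1"
    by (subst sum.atMost_shift) (simp add: esym_0 esym_empty_Suc)
  then show ?case by (simp add: esym_empty_Suc)
next
  case (insert p P)
  define R where "R P r = (\<Prod>p\<in>P. 1 - q p) - (\<Sum>k\<le>r. (-1) ^ k * esym q P k)" for P r
  have IH: "0 \<le> (-1) ^ Suc r * R P r" "(-1) ^ Suc r * R P r \<le> esym q P (Suc r)" for r
    using insert unfolding R_def by auto
  have q: "0 \<le> q p" "q p \<le> 1" using insert by auto
  have pr: "0 \<le> (\<Prod>p\<in>P. 1 - q p)" "(\<Prod>p\<in>P. 1 - q p) \<le> 1"
    using insert by (auto intro!: prod_nonneg prod_le_1)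
  show ?case
  proof (cases r)
    case 0
    have "(-1) ^ Suc r * R (insert p P) r = 1 - (1 - q p) * (\<Prod>p\<in>P. 1 - q p)"
      using insert 0 by (simp add: R_def esym_0)
    moreover have "esym q (insert p P) (Suc r) = esym q P (Suc 0) + q p"
      using insert 0 by (simp add: esym_insert esym_0)
    moreover have "1 - (\<Prod>p\<in>P. 1 - q p) \<le> esym q P (Suc 0)"
      using IH(2)[of 0] insert by (simp add: R_def esym_0)
    moreover have "q p * (\<Prod>p\<in>P. 1 - q p) \<le> q p"  "(1 - q p) * (\<Prod>p\<in>P. 1 - q p) \<le> 1"
      using q pr by (auto intro!: mult_left_le mult_le_one)
    ultimately show ?thesis unfolding R_def[symmetric] by (simp add: algebra_simps)
  next
    case (Suc j)
    have "(\<Sum>k\<le>r. (-1) ^ k * esym q (insert p P) k) =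
       1 + (\<Sum>k\<le>j. (-1) ^ Suc k * (esym q P (Suc k) + q p * esym q P k))"
      unfolding Suc using insert by (subst sum.atMost_Suc_shift) (simp add: esym_0 esym_insert)
    also have "\<dots> = (1 + (\<Sum>k\<le>j. (-1) ^ Suc k * esym q P (Suc k))) - q p * (\<Sum>k\<le>j. (-1) ^ k * esym q P k)"
      by (simp add: sum_distrib_left sum.distrib sum_subtractf algebra_simps sum_negf)
    also have "1 + (\<Sum>k\<le>j. (-1) ^ Suc k * esym q P (Suc k)) = (\<Sum>k\<le>r. (-1) ^ k * esym q P k)"
      unfolding Suc using insert by (subst sum.atMost_Suc_shift) (simp add: esym_0)
    finally have "R (insert p P) r = R P r - q p * R P j"
      unfolding R_def using insert by (simp add: algebra_simps)
    then have eq: "(-1) ^ Suc r * R (insert p P) r = (-1) ^ Suc r * R P r + q p * ((-1) ^ Suc j * R P j)"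
      using Suc by (simp only: power_Suc) (simp only: right_diff_distrib mult_minus_left, simp)
    have "0 \<le> q p * ((-1) ^ Suc j * R P j)" "q p * ((-1) ^ Suc j * R P j) \<le> q p * esym q P (Suc j)"
      using q IH[of j] by (auto simp del: power_Suc intro!: mult_nonneg_nonneg mult_left_mono)
    moreover have "esym q (insert p P) (Suc r) = esym q P (Suc r) + q p * esym q P (Suc j)"
      using insert Suc by (simp add: esym_insert)
    ultimately show ?thesis using IH[of r] unfolding R_def[symmetric] eq by simp
  qed
qed

corollary bonferroni_abs:
  assumes "finite P" "\<And>p. p \<in> P \<Longrightarrow> 0 \<le> q p \<and> q p \<le> 1"
  shows "\<bar>(\<Prod>p\<in>P. 1 - q p) - (\<Sum>k\<le>r. (-1) ^ k * esym q P k)\<bar> \<le> esym q P (Suc r)"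
proof -
  define X where "X = (\<Prod>p\<in>P. 1 - q p) - (\<Sum>k\<le>r. (-1) ^ k * esym q P k)"
  have "\<bar>X\<bar> = \<bar>(-1) ^ Suc r * X\<bar>" by (simp add: abs_mult)
  then show ?thesis using bonferroni[of P q r, OF assms] unfolding X_def[symmetric] by linarith
qed

section \<open>Brun's sieve in an interval\<close>

lemma residue_block_card:
  fixes d r c :: nat
  assumes "0 < d" "r < d"
  shows "card {h \<in> {c..<c+d}. h mod d = r} = 1"
proof -
  have inj: "inj_on (\<lambda>h. h mod d) {c..<c+d}"
  proof (rule inj_onI)
    fix x y assume xy: "x \<in> {c..<c+d}" "y \<in> {c..<c+d}" "x mod d = y mod d"
    have False if "u < v" "v < u + d" "u mod d = v mod d" for u v :: nat
    proof -
      have "d dvd v - u" using that by (metis mod_eq_dvd_iff_nat less_imp_le)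
      with that show False by (auto dest!: dvd_imp_le)
    qed
    from this[of x y] this[of y x] xy show "x = y"
      by (metis atLeastLessThan_iff add_less_cancel_right le_less_trans less_le_trans linorder_neqE_nat add_le_cancel_right)
  qed
  have "(\<lambda>h. h mod d) ` {c..<c+d} = {..<d}"
    using assms by (intro card_subset_eq) (auto simp: card_image[OF inj])
  then obtain h where h: "h \<in> {c..<c+d}" "h mod d = r" using assms by (metis imageE lessThan_iff)
  then have "{h \<in> {c..<c+d}. h mod d = r} = {h}"
    using inj by (auto simp: inj_on_def)
  then show ?thesis by simp
qed

text \<open>Complete blocks of \<open>d\<close> consecutive integers are counted exactly; only the
  incomplete last block produces an error.\<close>

lemma residue_card:
  fixes d r c m :: nat
  assumes "0 < d" "r < d"
  shows "\<bar>real (card {h \<in> {c..<c+m}. h mod d = r}) - real m / real d\<bar> \<le> 1"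
proof (induction m arbitrary: c rule: less_induct)
  case (less m)
  show ?case
  proof (cases "m < d")
    case True
    have "{h \<in> {c..<c+m}. h mod d = r} \<subseteq> {h \<in> {c..<c+d}. h mod d = r}" using True by auto
    then have "card {h \<in> {c..<c+m}. h mod d = r} \<le> card {h \<in> {c..<c+d}. h mod d = r}"
      by (intro card_mono) auto
    then have "card {h \<in> {c..<c+m}. h mod d = r} \<le> 1"
      using residue_block_card[OF assms] by simp
    moreover have "0 \<le> real m / real d" "real m / real d \<le> 1" using True by auto
    moreover have "real (card {h \<in> {c..<c+m}. h mod d = r}) \<ge> 0" by simp
    ultimately show ?thesis by linarith
  next
    case False
    have "{h \<in> {c..<c+m}. h mod d = r} =
       {h \<in> {c..<c+d}. h mod d = r} \<union> {h \<in> {c+d..<(c+d)+(m-d)}. h mod d = r}"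
      using False by auto
    then have "card {h \<in> {c..<c+m}. h mod d = r} =
       1 + card {h \<in> {c+d..<(c+d)+(m-d)}. h mod d = r}"
      using residue_block_card[OF assms] by (simp add: card_Un_disjoint disjoint_iff)
    moreover have "real (m - d) / real d = real m / real d - 1"
      using False assms by (simp add: of_nat_diff diff_divide_distrib)
    moreover have "\<bar>real (card {h \<in> {c+d..<(c+d)+(m-d)}. h mod d = r}) - real (m-d) / real d\<bar> \<le> 1"
      using False assms by (intro less) auto
    ultimately show ?thesis by simp
  qed
qed

text \<open>Chinese remaindering: prescribed residues modulo several primes form one class modulo
  the product, to which \<open>residue_card\<close> applies.\<close>

lemma residue_system_iff:
  fixes a :: "nat \<Rightarrow> nat"
  assumes "finite D" "\<And>p. p \<in> D \<Longrightarrow> prime p" "\<And>p. p \<in> D \<Longrightarrow> a p < p"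
  shows "\<exists>r < \<Prod>D. \<forall>h. (\<forall>p\<in>D. h mod p = a p) \<longleftrightarrow> h mod \<Prod>D = r"
proof -
  have "\<exists>!x. x < (\<Prod>i\<in>D. i) \<and> (\<forall>i\<in>D. [x = a i] (mod i))"
    using assms by (intro chinese_remainder_unique_nat) (auto intro: primes_coprime dest: prime_gt_0_nat)
  then obtain r where r: "r < \<Prod>D" "\<forall>i\<in>D. [r = a i] (mod i)"
    and uniq: "\<And>x. x < \<Prod>D \<Longrightarrow> \<forall>i\<in>D. [x = a i] (mod i) \<Longrightarrow> x = r" by auto
  have pos: "\<Prod>D > 0" using assms by (auto intro!: prod_pos dest: prime_gt_0_nat)
  have mm: "h mod \<Prod>D mod p = h mod p" if "p \<in> D" for h p
    using that assms(1) by (intro mod_mod_cancel dvd_prodI) auto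
  have "(\<forall>p\<in>D. h mod p = a p) \<longleftrightarrow> h mod \<Prod>D = r" for h
  proof
    assume "\<forall>p\<in>D. h mod p = a p"
    then show "h mod \<Prod>D = r" using pos mm assms by (intro uniq) (auto simp: cong_def)
  next
    assume "h mod \<Prod>D = r"
    then show "\<forall>p\<in>D. h mod p = a p"
      using r mm assms by (metis cong_def mod_less)
  qed
  with r show ?thesis by blast
qed

text \<open>Termwise comparison with the binomial expansion of \<open>(1 + N) ^ n\<close>.\<close>

lemma sum_binomial_le_power: "(\<Sum>k\<le>n. real (N choose k)) \<le> (1 + real N) ^ n"
proof -
  have "real (N choose k) \<le> real (n choose k) * real N ^ k" if "k \<le> n" for k
  proof -
    have "N choose k \<le> N ^ k" by (cases "k \<le> N") (auto simp: binomial_le_pow binomial_eq_0)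
    also have "\<dots> \<le> (n choose k) * N ^ k" using that zero_less_binomial[of k n]
      by (metis One_nat_def Suc_leI mult.commute mult.right_neutral mult_le_mono2)
    finally show ?thesis by (metis of_nat_le_iff of_nat_mult of_nat_power)
  qed
  then have "(\<Sum>k\<le>n. real (N choose k)) \<le> (\<Sum>k\<le>n. real (n choose k) * real N ^ k)"
    by (intro sum_mono) auto
  also have "\<dots> = (real N + 1) ^ n" by (simp add: binomial_ring)
  finally show ?thesis by (simp add: add.commute)
qed

text \<open>Bonferroni is used twice at the same level \<open>r\<close>: with indicator weights at
  every \<open>h\<close>, and with the weights \<open>1 / p\<close>. The two truncated sums differ
  by at most 1 for each set of at most \<open>r\<close> primes. Uniformity in \<open>a\<close> is
  essential, since the worst choice of residue classes is taken later.\<close>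

theorem brun_sieve:
  fixes a :: "nat \<Rightarrow> nat" and c m r :: nat
  assumes "finite P" "\<And>p. p \<in> P \<Longrightarrow> prime p" "\<And>p. p \<in> P \<Longrightarrow> a p < p"
  shows "\<bar>real (card {h \<in> {c..<c+m}. \<forall>p\<in>P. h mod p \<noteq> a p}) - m * (\<Prod>p\<in>P. 1 - 1 / real p)\<bar>
     \<le> 2 * m * ((\<Sum>p\<in>P. 1 / real p) ^ Suc r / fact (Suc r)) + (1 + card P) ^ Suc r"
proof -
  define I where "I = {c..<c+m}"
  define q :: "nat \<Rightarrow> nat \<Rightarrow> real" where "q h p = of_bool (h mod p = a p)" for h p
  define E where "E k = (\<Sum>h\<in>I. esym (q h) P k)" for k
  define e where "e k = esym (\<lambda>p. 1 / real p) P k" for k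
  define N where "N = real (card {h \<in> I. \<forall>p\<in>P. h mod p \<noteq> a p})"
  define V where "V = (\<Prod>p\<in>P. 1 - 1 / real p)"
  have finI: "finite I" by (simp add: I_def)
  have N: "N = (\<Sum>h\<in>I. \<Prod>p\<in>P. 1 - q h p)"
  proof -
    have "(\<Prod>p\<in>P. 1 - q h p) = of_bool (\<forall>p\<in>P. h mod p \<noteq> a p)" for h
      using assms(1) by (auto simp: q_def intro!: prod.neutral)
    then have "(\<Sum>h\<in>I. \<Prod>p\<in>P. 1 - q h p) = (\<Sum>h\<in>I. of_bool (\<forall>p\<in>P. h mod p \<noteq> a p))" by simp
    also have "\<dots> = N" using finI by (simp add: N_def Int_def sum_of_bool_eq)
    finally show ?thesis ..
  qed
  have "\<bar>N - (\<Sum>k\<le>r. (-1) ^ k * E k)\<bar> = \<bar>\<Sum>h\<in>I. (\<Prod>p\<in>P. 1 - q h p) - (\<Sum>k\<le>r. (-1) ^ k * esym (q h) P k)\<bar>"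
    unfolding N E_def sum_subtractf by (simp add: sum_distrib_left sum.swap[of _ I])
  also have "\<dots> \<le> (\<Sum>h\<in>I. esym (q h) P (Suc r))"
    using assms(1) by (intro sum_abs[THEN order_trans] sum_mono bonferroni_abs) (auto simp: q_def)
  finally have 1: "\<bar>N - (\<Sum>k\<le>r. (-1) ^ k * E k)\<bar> \<le> E (Suc r)" by (simp add: E_def)
  have 2: "\<bar>V - (\<Sum>k\<le>r. (-1) ^ k * e k)\<bar> \<le> e (Suc r)"
    unfolding V_def e_def using assms
    by (intro bonferroni_abs) (auto simp: divide_le_eq_1 dest: prime_ge_1_nat)
  have 3: "\<bar>E k - m * e k\<bar> \<le> real (card P choose k)" for k
  proof -
    have D: "\<bar>(\<Sum>h\<in>I. \<Prod>p\<in>D. q h p) - m * (\<Prod>p\<in>D. 1 / real p)\<bar> \<le> 1" if "D \<subseteq> P" for D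
    proof -
      have fD: "finite D" using that assms(1) finite_subset by blast
      have "\<exists>x < \<Prod>D. \<forall>h. (\<forall>p\<in>D. h mod p = a p) \<longleftrightarrow> h mod \<Prod>D = x"
        using that assms(2,3) by (intro residue_system_iff fD) auto
      then obtain x where x: "x < \<Prod>D" "\<And>h. (\<forall>p\<in>D. h mod p = a p) \<longleftrightarrow> h mod \<Prod>D = x" by blast
      have "(\<Prod>p\<in>D. q h p) = of_bool (\<forall>p\<in>D. h mod p = a p)" for h
        using fD by (auto simp: q_def intro!: prod.neutral)
      then have "(\<Sum>h\<in>I. \<Prod>p\<in>D. q h p) = (\<Sum>h\<in>I. of_bool (h mod \<Prod>D = x))" using x by simp
      also have "\<dots> = card {h \<in> I. h mod \<Prod>D = x}" using finI by (simp add: Int_def sum_of_bool_eq)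
      finally show ?thesis using residue_card[of "\<Prod>D" x c m] x
        by (simp add: I_def prod_dividef)
    qed
    have "E k - m * e k = (\<Sum>D | D \<subseteq> P \<and> card D = k. (\<Sum>h\<in>I. \<Prod>p\<in>D. q h p) - m * (\<Prod>p\<in>D. 1 / real p))"
      unfolding E_def e_def esym_def by (simp add: sum_subtractf sum_distrib_left sum.swap[of _ I])
    also have "\<bar>\<dots>\<bar> \<le> (\<Sum>D | D \<subseteq> P \<and> card D = k. 1)"
      using D by (intro sum_abs[THEN order_trans] sum_mono) auto
    also have "\<dots> = real (card P choose k)" using n_subsets[OF assms(1), of k] by simp
    finally show ?thesis .
  qed
  have "\<bar>(\<Sum>k\<le>r. (-1) ^ k * E k) - m * (\<Sum>k\<le>r. (-1) ^ k * e k)\<bar> =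
      \<bar>\<Sum>k\<le>r. (-1) ^ k * (E k - m * e k)\<bar>"
    by (simp add: sum_distrib_left sum_subtractf right_diff_distrib mult.left_commute)
  also have "\<dots> \<le> (\<Sum>k\<le>r. real (card P choose k))"
    using 3 by (intro sum_abs[THEN order_trans] sum_mono) (auto simp: abs_mult)
  finally have 4: "\<bar>(\<Sum>k\<le>r. (-1) ^ k * E k) - m * (\<Sum>k\<le>r. (-1) ^ k * e k)\<bar> \<le> (\<Sum>k\<le>r. real (card P choose k))" .
  have 5: "\<bar>m * V - m * (\<Sum>k\<le>r. (-1) ^ k * e k)\<bar> \<le> m * e (Suc r)"
    using mult_left_mono[OF 2, of m] by (simp add: abs_mult flip: right_diff_distrib)
  \<comment> \<open>The tail \<open>E (Suc r)\<close> is itself \<open>m * e (Suc r)\<close> up to a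
    binomial coefficient; hence the factor 2 and the extra summand \<open>k = Suc r\<close>.\<close>
  have "\<bar>N - m * V\<bar> \<le> 2 * m * e (Suc r) + (\<Sum>k\<le>Suc r. real (card P choose k))"
    using 1 3[of "Suc r"] 4 5 by simp
  also have "\<dots> \<le> 2 * m * ((\<Sum>p\<in>P. 1 / real p) ^ Suc r / fact (Suc r)) + (1 + card P) ^ Suc r"
    unfolding e_def using sum_binomial_le_power[of "card P" "Suc r"] assms(1)
    by (intro add_mono mult_left_mono esym_le) (auto simp: distrib_right)
  finally show ?thesis by (simp add: N_def V_def I_def)
qed

section \<open>Averages over random residue classes\<close>

text \<open>Expectation over independent uniform residue classes, encoded as nested finite averages:
  each modulus removes a class from \<open>S\<close>, and \<open>F\<close> is evaluated on what is
  left. The recursion on the list turns estimates prime by prime into plain inductions.\<close>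

fun sieve_avg :: "nat list \<Rightarrow> (nat set \<Rightarrow> real) \<Rightarrow> nat set \<Rightarrow> real" where
  "sieve_avg [] F S = F S"
| "sieve_avg (p # ps) F S = (\<Sum>a<p. sieve_avg ps F {h \<in> S. h mod p \<noteq> a}) / real p"

lemma sieve_avg_append: "sieve_avg (ps @ qs) F S = sieve_avg ps (sieve_avg qs F) S"
  by (induction ps arbitrary: S) simp_all

lemma sieve_avg_mono:
  assumes "\<And>T. T \<subseteq> S \<Longrightarrow> F T \<le> G T"
  shows "sieve_avg ps F S \<le> sieve_avg ps G S"
  using assms
proof (induction ps arbitrary: S)
  case (Cons p ps)
  have "sieve_avg ps F {h \<in> S. h mod p \<noteq> a} \<le> sieve_avg ps G {h \<in> S. h mod p \<noteq> a}" for a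
    by (rule Cons.IH, rule Cons.prems) auto
  then show ?case by (auto intro!: divide_right_mono sum_mono)
qed simp

lemma sieve_avg_cong:
  assumes "\<And>T. T \<subseteq> S \<Longrightarrow> F T = G T"
  shows "sieve_avg ps F S = sieve_avg ps G S"
  using assms by (intro antisym sieve_avg_mono) auto

lemma sieve_avg_const:
  assumes "\<And>p. p \<in> set ps \<Longrightarrow> 0 < p"
  shows "sieve_avg ps (\<lambda>_. c) S = c"
  using assms by (induction ps arbitrary: S) auto

lemma sieve_avg_cmult: "sieve_avg ps (\<lambda>T. c * F T) S = c * sieve_avg ps F S"
  by (induction ps arbitrary: S) (simp_all add: sum_distrib_left)

lemma sieve_avg_diff: "sieve_avg ps (\<lambda>T. F T - G T) S = sieve_avg ps F S - sieve_avg ps G S"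
  by (induction ps arbitrary: S) (simp_all add: sum_subtractf diff_divide_distrib)

lemma sieve_avg_sum: "sieve_avg ps (\<lambda>T. \<Sum>i\<in>I. F i T) S = (\<Sum>i\<in>I. sieve_avg ps (F i) S)"
proof (induction ps arbitrary: S)
  case (Cons p ps)
  then show ?case by (simp add: sum_divide_distrib sum.swap[of _ I])
qed simp

lemma sieve_avg_abs_le:
  assumes "\<And>T. T \<subseteq> S \<Longrightarrow> \<bar>F T - G T\<bar> \<le> H T"
  shows "\<bar>sieve_avg ps F S - sieve_avg ps G S\<bar> \<le> sieve_avg ps H S"
proof -
  have "sieve_avg ps (\<lambda>T. F T - G T) S \<le> sieve_avg ps H S"
    using assms by (intro sieve_avg_mono) (auto simp: abs_le_iff)
  moreover have "sieve_avg ps (\<lambda>T. G T - F T) S \<le> sieve_avg ps H S"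
    using assms by (intro sieve_avg_mono) (auto simp: abs_le_iff)
  ultimately show ?thesis by (simp add: sieve_avg_diff)
qed

lemma sieve_avg_Int: "sieve_avg ps (\<lambda>T. F (T \<inter> B)) S = sieve_avg ps F (S \<inter> B)"
proof (induction ps arbitrary: S)
  case (Cons p ps)
  have "{h \<in> S. h mod p \<noteq> a} \<inter> B = {h \<in> S \<inter> B. h mod p \<noteq> a}" for a by auto
  with Cons show ?case by simp
qed simp

text \<open>A translation permutes the residue classes modulo each \<open>p\<close>, so the
  distribution of the number of survivors is translation invariant.\<close>

lemma sieve_avg_shift:
  assumes "\<And>p. p \<in> set ps \<Longrightarrow> 0 < p"
  shows "sieve_avg ps (\<lambda>T. f (card T)) ((\<lambda>h. h + c) ` S) = sieve_avg ps (\<lambda>T. f (card T)) S"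
  using assms
proof (induction ps arbitrary: S)
  case Nil
  show ?case by (simp add: card_image)
next
  case (Cons p ps)
  then have p: "p > 0" by simp
  have inj: "inj_on (\<lambda>a. (a + c) mod p) {..<p}"
  proof (rule inj_onI)
    fix x y assume "x \<in> {..<p}" "y \<in> {..<p}" "(x + c) mod p = (y + c) mod p"
    then show "x = y" using cong_add_rcancel_nat[of x c y p] by (simp add: cong_def)
  qed
  have "(\<lambda>a. (a + c) mod p) ` {..<p} = {..<p}"
    using p by (intro card_subset_eq) (auto simp: card_image[OF inj])
  with inj have bij: "bij_betw (\<lambda>a. (a + c) mod p) {..<p} {..<p}" by (simp add: bij_betw_def)
  have set: "{h \<in> (\<lambda>h. h + c) ` S. h mod p \<noteq> (a + c) mod p} = (\<lambda>h. h + c) ` {h \<in> S. h mod p \<noteq> a}"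
    if "a < p" for a
  proof -
    have "(h + c) mod p = (a + c) mod p \<longleftrightarrow> h mod p = a" for h
      using cong_add_rcancel_nat[of h c a p] that by (simp add: cong_def)
    then show ?thesis by auto
  qed
  have "(\<Sum>a<p. sieve_avg ps (\<lambda>T. f (card T)) {h \<in> (\<lambda>h. h + c) ` S. h mod p \<noteq> a}) =
    (\<Sum>a<p. sieve_avg ps (\<lambda>T. f (card T)) {h \<in> (\<lambda>h. h + c) ` S. h mod p \<noteq> (a + c) mod p})"
    by (rule sum.reindex_bij_betw[OF bij, symmetric])
  also have "\<dots> = (\<Sum>a<p. sieve_avg ps (\<lambda>T. f (card T)) {h \<in> S. h mod p \<noteq> a})"
  proof (intro sum.cong refl)
    fix a assume "a \<in> {..<p}"
    then have "a < p" by simp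
    then show "sieve_avg ps (\<lambda>T. f (card T)) {h \<in> (\<lambda>h. h + c) ` S. h mod p \<noteq> (a + c) mod p} =
        sieve_avg ps (\<lambda>T. f (card T)) {h \<in> S. h mod p \<noteq> a}"
      unfolding set[OF \<open>a < p\<close>] using Cons by simp
  qed
  finally show ?case by simp
qed

text \<open>\<open>H\<close> survives the removal of the class \<open>a\<close> exactly when
  \<open>a\<close> is not among the residues of \<open>H\<close>. This is how the local factors of
  the singular series become probabilities.\<close>

lemma sieve_avg_indicator:
  assumes "\<And>p. p \<in> set ps \<Longrightarrow> 0 < p" "finite H"
  shows "sieve_avg ps (\<lambda>T. of_bool (H \<subseteq> T)) S =
     of_bool (H \<subseteq> S) * (\<Prod>p\<leftarrow>ps. 1 - real (card ((\<lambda>h. h mod p) ` H)) / real p)"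
  using assms
proof (induction ps arbitrary: S)
  case (Cons p ps)
  let ?R = "(\<lambda>h. h mod p) ` H"
  define V where "V = (\<Prod>p\<leftarrow>ps. 1 - real (card ((\<lambda>h. h mod p) ` H)) / real p)"
  have p: "p > 0" using Cons by simp
  have R: "?R \<subseteq> {..<p}" using p by auto
  have "(\<Sum>a<p. sieve_avg ps (\<lambda>T. of_bool (H \<subseteq> T)) {h \<in> S. h mod p \<noteq> a}) =
     (\<Sum>a<p. of_bool (H \<subseteq> S) * V * of_bool (a \<notin> ?R))"
  proof (intro sum.cong refl)
    fix a
    have "H \<subseteq> {h \<in> S. h mod p \<noteq> a} \<longleftrightarrow> H \<subseteq> S \<and> a \<notin> ?R" by auto
    then show "sieve_avg ps (\<lambda>T. of_bool (H \<subseteq> T)) {h \<in> S. h mod p \<noteq> a} = of_bool (H \<subseteq> S) * V * of_bool (a \<notin> ?R)"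
      using Cons by (simp add: V_def)
  qed
  also have "\<dots> = of_bool (H \<subseteq> S) * V * card ({..<p} - ?R)"
    by (simp add: sum_distrib_left[symmetric] sum_of_bool_eq set_diff_eq Int_def)
  also have "real (card ({..<p} - ?R)) = real p - real (card ?R)"
    using R card_mono[OF _ R] by (simp add: card_Diff_subset finite_subset of_nat_diff)
  finally show ?case using p by (simp add: V_def field_simps)
qed simp

lemma sum_card_residue_classes:
  assumes "0 < p" "finite S"
  shows "(\<Sum>a<p. card {h \<in> S. h mod p = a}) = card (S :: nat set)"
proof -
  have "(\<Sum>a\<in>{..<p}. \<Sum>h | h \<in> S \<and> h mod p = a. 1) = (\<Sum>h\<in>S. (1::nat))"
    using assms by (intro sum.group) auto
  then show ?thesis by simp
qed

lemma card_sieved: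
  assumes "finite S"
  shows "real (card {h \<in> S. h mod p \<noteq> a}) = real (card S) - real (card {h \<in> S. h mod p = (a::nat)})"
proof -
  have "{h \<in> S. h mod p \<noteq> a} = S - {h \<in> S. h mod p = a}" by auto
  then show ?thesis using assms by (simp add: card_Diff_subset card_mono of_nat_diff)
qed

text \<open>Jensen's inequality applied one prime at a time, for either sign of \<open>s\<close>:
  removing a random class modulo \<open>p\<close> leaves \<open>(1 - 1 / p) * card S\<close>
  elements on average.\<close>

lemma sieve_avg_exp_ge:
  assumes "\<And>p. p \<in> set ps \<Longrightarrow> 0 < p" "finite S"
  shows "exp (- s * (\<Prod>p\<leftarrow>ps. 1 - 1 / real p) * real (card S)) \<le> sieve_avg ps (\<lambda>T. exp (- s * real (card T))) S"
  using assms
proof (induction ps arbitrary: S)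
  case (Cons p ps)
  have p: "p > 0" using Cons by simp
  define b where "b = s * (\<Prod>p\<leftarrow>ps. 1 - 1 / real p)"
  define X where "X a = real (card {h \<in> S. h mod p = a})" for a
  have X: "(\<Sum>a<p. X a) = card S"
    using arg_cong[OF sum_card_residue_classes[of p S], of real] p Cons.prems(2) by (simp add: X_def)
  \<comment> \<open>The deviations \<open>X a - card S / p\<close> sum to 0, so inserting them
    changes nothing; then \<open>1 + z \<le> exp z\<close> does the work of convexity.\<close>
  have "exp (- b * (1 - 1 / real p) * card S) =
     exp (- b * card S * (1 - 1 / real p)) * ((\<Sum>a<p. 1 + b * (X a - card S / p)) / p)"
    using p by (simp add: sum.distrib sum_subtractf flip: sum_distrib_left) (simp add: X mult_ac)
  also have "\<dots> \<le> exp (- b * card S * (1 - 1 / real p)) * ((\<Sum>a<p. exp (b * (X a - card S / p))) / p)"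
    by (intro mult_left_mono divide_right_mono sum_mono) (auto simp: exp_ge_add_one_self)
  also have "\<dots> = (\<Sum>a<p. exp (- b * (card S - X a))) / p"
    by (simp add: sum_distrib_left algebra_simps flip: exp_add)
  also have "\<dots> = (\<Sum>a<p. exp (- b * real (card {h \<in> S. h mod p \<noteq> a}))) / p"
    unfolding X_def using Cons by (simp add: card_sieved)
  also have "\<dots> \<le> sieve_avg (p # ps) (\<lambda>T. exp (- s * real (card T))) S"
  proof -
    have "exp (- b * real (card {h \<in> S. h mod p \<noteq> a}))
        \<le> sieve_avg ps (\<lambda>T. exp (- s * real (card T))) {h \<in> S. h mod p \<noteq> a}" for a
      unfolding b_def minus_mult_left by (rule Cons.IH) (use Cons.prems in auto)
    then show ?thesis
      unfolding sieve_avg.simps by (intro divide_right_mono sum_mono) auto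
  qed
  finally have le: "exp (- b * (1 - 1 / real p) * card S) \<le> sieve_avg (p # ps) (\<lambda>T. exp (- s * real (card T))) S" .
  have "- s * (\<Prod>p\<leftarrow>p # ps. 1 - 1 / real p) = - b * (1 - 1 / real p)"
    by (simp only: b_def list.map prod_list.Cons mult_minus_left mult_minus_right mult_ac)
  with le show ?case by (simp only:)
qed simp

lemma exp_le_quadratic:
  assumes "\<bar>z\<bar> \<le> (1::real)"
  shows "exp z \<le> 1 + z + z\<^sup>2"
proof (cases "z \<ge> 0")
  case True
  then show ?thesis using assms exp_bound by auto
next
  case False
  define t where "t = - z"
  have t: "t > 0" using False by (simp add: t_def)
  have "(1 - t + t\<^sup>2) * (1 + t) = 1 + t ^ 3" by (simp add: algebra_simps power2_eq_square power3_eq_cube)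
  then have "1 \<le> (1 - t + t\<^sup>2) * (1 + t)" using t by simp
  moreover have "1 - t + t\<^sup>2 \<ge> 0"
  proof -
    have "1 - t + t\<^sup>2 = (t - 1/2)\<^sup>2 + 3/4" by (simp add: power2_eq_square algebra_simps)
    then show ?thesis by simp
  qed
  ultimately have "1 \<le> (1 - t + t\<^sup>2) * exp t"
    using exp_ge_add_one_self[of t] by (meson mult_left_mono order_trans)
  then have "exp (- t) \<le> 1 - t + t\<^sup>2" by (simp add: exp_minus field_simps)
  then show ?thesis by (simp add: t_def)
qed

lemma prod_list_bounds:
  assumes "\<And>p. p \<in> set ps \<Longrightarrow> 0 < p"
  shows "0 \<le> (\<Prod>p\<leftarrow>ps. 1 - 1 / real p) \<and> (\<Prod>p\<leftarrow>ps. 1 - 1 / real p) \<le> 1"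
  using assms
proof (induction ps)
  case (Cons p ps)
  from Cons.prems[of p] have "0 \<le> 1 - 1 / real p" "1 - 1 / real p \<le> 1" by auto
  moreover have "0 \<le> (\<Prod>p\<leftarrow>ps. 1 - 1 / real p)" "(\<Prod>p\<leftarrow>ps. 1 - 1 / real p) \<le> 1"
    using Cons by simp_all
  ultimately show ?case
    unfolding list.map prod_list.Cons by (intro conjI mult_nonneg_nonneg mult_le_one)
qed simp

text \<open>Only a second-order term is lost at each prime, because a residue class of \<open>S\<close> mod \<open>p\<close>
  has at most \<open>M p\<close> elements and is hit with probability \<open>1 / p\<close>.\<close>

theorem sieve_avg_exp_le:
  assumes "\<And>p. p \<in> set ps \<Longrightarrow> 2 \<le> p" "finite S"
    and "\<And>p a. p \<in> set ps \<Longrightarrow> a < p \<Longrightarrow> real (card {h \<in> S. h mod p = a}) \<le> M p"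
    and "\<And>p. p \<in> set ps \<Longrightarrow> 2 * \<bar>s\<bar> * M p \<le> 1"
    and "\<And>p. p \<in> set ps \<Longrightarrow> 0 \<le> M p"
    and "(\<Sum>p\<leftarrow>ps. 8 * \<bar>s\<bar> * M p / real p) \<le> 1"
  shows "sieve_avg ps (\<lambda>T. exp (- s * real (card T))) S
     \<le> exp (- (s - \<bar>s\<bar> * (\<Sum>p\<leftarrow>ps. 8 * \<bar>s\<bar> * M p / real p)) * (\<Prod>p\<leftarrow>ps. 1 - 1 / real p) * real (card S))"
  using assms
proof (induction ps arbitrary: S)
  case (Cons p ps)
  have p: "p \<ge> 2" using Cons by simp
  define V where "V = (\<Prod>p\<leftarrow>ps. 1 - 1 / real p)"
  define \<kappa> where "\<kappa> = (\<Sum>p\<leftarrow>ps. 8 * \<bar>s\<bar> * M p / real p)"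
  define b where "b = (s - \<bar>s\<bar> * \<kappa>) * V"
  define X where "X a = real (card {h \<in> S. h mod p = a})" for a
  have ps2: "q \<in> set ps \<Longrightarrow> 2 \<le> q" for q using Cons.prems(1) by simp
  have V: "0 \<le> V" "V \<le> 1" using prod_list_bounds[of ps] ps2 by (force simp: V_def)+
  have M: "0 \<le> M p" "2 * \<bar>s\<bar> * M p \<le> 1" using Cons.prems by auto
  have \<kappa>: "0 \<le> \<kappa>" unfolding \<kappa>_def using Cons.prems(5) by (intro sum_list_nonneg) auto
  have "8 * \<bar>s\<bar> * M p / real p \<ge> 0" using M by simp
  then have \<kappa>1: "\<kappa> \<le> 1" using Cons.prems(6) by (simp add: \<kappa>_def)
  have X: "(\<Sum>a<p. X a) = card S"
    using arg_cong[OF sum_card_residue_classes[of p S], of real] p Cons.prems(2) by (simp add: X_def)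
  have XM: "0 \<le> X a" "a < p \<Longrightarrow> X a \<le> M p" for a
    unfolding X_def using Cons.prems(3) by auto
  have "\<bar>s - \<bar>s\<bar> * \<kappa>\<bar> \<le> \<bar>s\<bar> + \<bar>s\<bar> * \<kappa>" using \<kappa> abs_triangle_ineq4[of s "\<bar>s\<bar> * \<kappa>"] by (simp add: abs_mult)
  also have "\<dots> \<le> 2 * \<bar>s\<bar>" using \<kappa>1 mult_left_mono[OF \<kappa>1, of "\<bar>s\<bar>"] by simp
  finally have sb: "\<bar>s - \<bar>s\<bar> * \<kappa>\<bar> \<le> 2 * \<bar>s\<bar>" .
  have b: "\<bar>b\<bar> \<le> 2 * \<bar>s\<bar> * V" using sb V by (simp add: b_def abs_mult mult_right_mono)
  then have b2: "\<bar>b\<bar> \<le> 2 * \<bar>s\<bar>" using V mult_left_mono[of V 1 "2 * \<bar>s\<bar>"] by simp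
  have bX: "\<bar>b * X a\<bar> \<le> 1" if "a < p" for a
  proof -
    have "\<bar>b * X a\<bar> \<le> 2 * \<bar>s\<bar> * M p"
      unfolding abs_mult using b2 XM[of a] that by (intro mult_mono) auto
    then show ?thesis using M by simp
  qed
  \<comment> \<open>One factor of the square is bounded by \<open>M p\<close>. The bound stays
    linear in \<open>X a\<close>, and its sum over \<open>a\<close> is again a multiple of
    \<open>card S\<close>.\<close>
  have step: "exp (b * X a) \<le> 1 + (b + b\<^sup>2 * M p) * X a" if "a < p" for a
  proof -
    have "exp (b * X a) \<le> 1 + b * X a + (b * X a)\<^sup>2" using bX[OF that] by (rule exp_le_quadratic)
    also have "(b * X a)\<^sup>2 = b\<^sup>2 * X a * X a" by (simp add: power2_eq_square)
    also have "\<dots> \<le> b\<^sup>2 * X a * M p" using XM that by (intro mult_left_mono) auto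
    finally show ?thesis by (simp add: algebra_simps)
  qed
  have "sieve_avg (p # ps) (\<lambda>T. exp (- s * real (card T))) S
     \<le> (\<Sum>a<p. exp (- b * real (card {h \<in> S. h mod p \<noteq> a}))) / p"
  proof -
    have "sieve_avg ps (\<lambda>T. exp (- s * real (card T))) {h \<in> S. h mod p \<noteq> a}
       \<le> exp (- (s - \<bar>s\<bar> * \<kappa>) * V * real (card {h \<in> S. h mod p \<noteq> a}))" for a
      unfolding V_def \<kappa>_def
    proof (rule Cons.IH)
      fix q c assume q: "q \<in> set ps" "c < q"
      have "card {h \<in> {h \<in> S. h mod p \<noteq> a}. h mod q = c} \<le> card {h \<in> S. h mod q = c}"
        using Cons.prems(2) by (intro card_mono) auto
      then show "real (card {h \<in> {h \<in> S. h mod p \<noteq> a}. h mod q = c}) \<le> M q"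
        using Cons.prems(3)[of q c] q by simp
    qed (use Cons.prems \<kappa>1 in \<open>auto simp: \<kappa>_def\<close>)
    then have "sieve_avg ps (\<lambda>T. exp (- s * real (card T))) {h \<in> S. h mod p \<noteq> a}
       \<le> exp (- b * real (card {h \<in> S. h mod p \<noteq> a}))" for a
      unfolding b_def minus_mult_left .
    then show ?thesis
      unfolding sieve_avg.simps by (intro divide_right_mono sum_mono) auto
  qed
  also have "\<dots> = exp (- b * card S) * ((\<Sum>a<p. exp (b * X a)) / p)"
    using Cons.prems(2) by (simp add: card_sieved X_def sum_distrib_left algebra_simps flip: exp_add)
  also have "\<dots> \<le> exp (- b * card S) * ((\<Sum>a<p. 1 + (b + b\<^sup>2 * M p) * X a) / p)"
    using step by (intro mult_left_mono divide_right_mono sum_mono) auto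
  also have "(\<Sum>a<p. 1 + (b + b\<^sup>2 * M p) * X a) = p + (b + b\<^sup>2 * M p) * card S"
    using X by (simp add: sum.distrib flip: sum_distrib_left)
  also have "exp (- b * card S) * ((p + (b + b\<^sup>2 * M p) * card S) / p)
     = exp (- b * card S) * (1 + (b + b\<^sup>2 * M p) * card S / p)"
    using p by (simp add: add_divide_distrib)
  also have "\<dots> \<le> exp (- b * card S) * exp ((b + b\<^sup>2 * M p) * card S / p)"
    by (intro mult_left_mono exp_ge_add_one_self) auto
  also have "\<dots> = exp (- (b * (1 - 1 / p) - b\<^sup>2 * M p / p) * card S)"
    by (simp add: algebra_simps add_divide_distrib flip: exp_add)
  also have "\<dots> \<le> exp (- ((s - \<bar>s\<bar> * (8 * \<bar>s\<bar> * M p / p + \<kappa>)) * ((1 - 1 / p) * V)) * card S)"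
  proof -
    \<comment> \<open>Of the two factors \<open>V\<close>, one is bounded by 1 and the other by
      \<open>2 * ((1 - 1 / p) * V)\<close>, using \<open>p \<ge> 2\<close>. With the square of
      \<open>2 * \<bar>s\<bar>\<close> this produces the constant 8.\<close>
    have "b\<^sup>2 \<le> (2 * \<bar>s\<bar> * V)\<^sup>2" using b V by (subst power2_le_iff_abs_le) auto
    also have "\<dots> = 4 * s\<^sup>2 * (V * V)" by (simp add: power2_eq_square)
    also have "\<dots> \<le> 4 * s\<^sup>2 * (1 * (2 * ((1 - 1 / p) * V)))"
    proof -
      have "V \<le> 2 * ((1 - 1 / p) * V)" using p V mult_right_mono[of "1/2" "1 - 1 / real p" V] by (simp add: field_simps)
      then show ?thesis using V by (intro mult_left_mono mult_mono) auto
    qed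
    finally have "b\<^sup>2 * (M p / p) \<le> 8 * s\<^sup>2 * ((1 - 1 / p) * V) * (M p / p)"
      using M by (intro mult_right_mono) auto
    also have "8 * s\<^sup>2 = \<bar>s\<bar> * (8 * \<bar>s\<bar>)" by (simp add: power2_eq_square)
    finally have "b\<^sup>2 * M p / p \<le> \<bar>s\<bar> * (8 * \<bar>s\<bar> * M p / p) * ((1 - 1 / p) * V)" by (simp add: mult_ac)
    moreover have "b * (1 - 1 / p) = (s - \<bar>s\<bar> * \<kappa>) * ((1 - 1 / p) * V)" by (simp add: b_def)
    moreover have "(s - \<bar>s\<bar> * (8 * \<bar>s\<bar> * M p / p + \<kappa>)) * ((1 - 1 / p) * V) =
      (s - \<bar>s\<bar> * \<kappa>) * ((1 - 1 / p) * V) - \<bar>s\<bar> * (8 * \<bar>s\<bar> * M p / p) * ((1 - 1 / p) * V)"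
      by (simp only: left_diff_distrib distrib_left distrib_right)
    ultimately have "(s - \<bar>s\<bar> * (8 * \<bar>s\<bar> * M p / p + \<kappa>)) * ((1 - 1 / p) * V) \<le> b * (1 - 1 / p) - b\<^sup>2 * M p / p"
      by linarith
    then show ?thesis unfolding exp_le_cancel_iff by (intro mult_right_mono) auto
  qed
  finally show ?case
    by (simp only: V_def \<kappa>_def list.map prod_list.Cons sum_list.Cons mult_minus_left mult.assoc)
qed simp

text \<open>An average is at most its worst case. Distinctness lets the successive choices be
  collected into one function \<open>a\<close>, the form that \<open>brun_sieve\<close>
  expects.\<close>

lemma sieve_avg_le_worst:
  assumes "distinct ps" "\<And>p. p \<in> set ps \<Longrightarrow> 0 < p"
    and "\<And>a. (\<And>p. p \<in> set ps \<Longrightarrow> a p < p) \<Longrightarrow> F {h \<in> S. \<forall>p\<in>set ps. h mod p \<noteq> a p} \<le> B"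
  shows "sieve_avg ps F S \<le> B"
  using assms
proof (induction ps arbitrary: S)
  case Nil
  from Nil(3)[of "\<lambda>_. 0"] show ?case by simp
next
  case (Cons p ps)
  have p: "p > 0" using Cons by simp
  have "sieve_avg ps F {h \<in> S. h mod p \<noteq> b} \<le> B" if "b < p" for b
  proof (rule Cons.IH)
    fix a :: "nat \<Rightarrow> nat" assume a: "\<And>q. q \<in> set ps \<Longrightarrow> a q < q"
    have "F {h \<in> S. \<forall>q\<in>set (p # ps). h mod q \<noteq> (a(p := b)) q} \<le> B"
      using a that by (intro Cons.prems(3)) auto
    moreover have "{h \<in> S. \<forall>q\<in>set (p # ps). h mod q \<noteq> (a(p := b)) q} =
      {h \<in> {h \<in> S. h mod p \<noteq> b}. \<forall>q\<in>set ps. h mod q \<noteq> a q}"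
      using Cons.prems(1) by auto
    ultimately show "F {h \<in> {h \<in> S. h mod p \<noteq> b}. \<forall>q\<in>set ps. h mod q \<noteq> a q} \<le> B" by simp
  qed (use Cons.prems in auto)
  then have "(\<Sum>b<p. sieve_avg ps F {h \<in> S. h mod p \<noteq> b}) \<le> (\<Sum>b<p. B)" by (intro sum_mono) auto
  then show ?case using p by (simp add: field_simps)
qed

section \<open>An upper bound of Mertens type\<close>

abbreviation primes_upto :: "nat \<Rightarrow> nat set" where
  "primes_upto n \<equiv> {p. prime p \<and> p \<le> n}"

lemma finite_primes_upto [simp]: "finite (primes_upto n)"
  by (rule finite_subset[of _ "{..n}"]) auto

lemma primes_upto_Suc:
  "primes_upto (Suc n) = (if prime (Suc n) then insert (Suc n) (primes_upto n) else primes_upto n)"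
  by (auto simp: le_Suc_eq)

lemma sum_primes_upto_Suc:
  "(\<Sum>p\<in>primes_upto (Suc n). f p) = (\<Sum>p\<in>primes_upto n. f p) + (if prime (Suc n) then f (Suc n) else (0::real))"
  by (simp add: primes_upto_Suc)

text \<open>Chebyshev's device: the logarithm of the factorization of \<open>j\<close> counts each
  prime divisor at least once.\<close>

lemma sum_ln_prime_divisors_le:
  assumes "j > 0" "finite P" "\<And>p. p \<in> P \<Longrightarrow> prime p"
  shows "(\<Sum>p | p \<in> P \<and> p dvd j. ln (real p)) \<le> ln (real j)"
proof -
  have "real j = real (\<Prod>p\<in>prime_factors j. p ^ multiplicity p j)"
    using assms(1) by (subst prime_factorization_nat) auto
  then have "ln (real j) = (\<Sum>p\<in>prime_factors j. ln (real p ^ multiplicity p j))"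
    by (simp; subst ln_prod; auto simp: in_prime_factors_iff prime_gt_0_nat)
  also have "\<dots> = (\<Sum>p\<in>prime_factors j. real (multiplicity p j) * ln (real p))"
    by (intro sum.cong refl ln_realpow)
  also have "\<dots> \<ge> (\<Sum>p\<in>prime_factors j. 1 * ln (real p))"
  proof (intro sum_mono mult_right_mono)
    fix p assume "p \<in> prime_factors j"
    then show "1 \<le> real (multiplicity p j)" "0 \<le> ln (real p)"
      using prime_ge_1_nat by (auto simp: prime_factors_multiplicity in_prime_factors_iff Suc_le_eq)
  qed
  also have "(\<Sum>p\<in>prime_factors j. 1 * ln (real p)) \<ge> (\<Sum>p | p \<in> P \<and> p dvd j. ln (real p))"
    using assms by (simp, intro sum_mono2) (auto simp: in_prime_factors_iff dest: prime_ge_1_nat)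
  finally show ?thesis by simp
qed

text \<open>Only primes up to \<open>k\<close> are counted in \<open>(20k)!\<close>, so that replacing \<open>\<lfloor>20k / p\<rfloor>\<close> by \<open>20k / p\<close>
  costs at most a factor \<open>20 / 19\<close>.\<close>

lemma sum_ln_over_prime_le:
  assumes "k \<ge> 1"
  shows "(\<Sum>p\<in>primes_upto k. ln (real p) / real p) \<le> 20 / 19 * ln (20 * real k)"
proof -
  define n where "n = 20 * k"
  have n: "n \<ge> 1" using assms by (simp add: n_def)
  have "(\<Sum>p\<in>primes_upto k. ln (real p) * (19 * real k / real p)) \<le>
     (\<Sum>p\<in>primes_upto k. ln (real p) * real (card {j \<in> {1..<1+n}. p dvd j}))"
  proof (intro sum_mono mult_left_mono)
    fix p assume "p \<in> primes_upto k"
    then have p: "prime p" "p \<le> k" by auto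
    then have p0: "p > 0" using prime_gt_0_nat by blast
    have "real n / real p - 1 \<le> real (card {j \<in> {1..<1+n}. p dvd j})"
      using residue_card[of p 0 1 n] p0 by (simp add: dvd_eq_mod_eq_0)
    moreover have "1 \<le> real k / real p" using p p0 by simp
    ultimately show "19 * real k / real p \<le> real (card {j \<in> {1..<1+n}. p dvd j})" by (simp add: n_def)
    show "0 \<le> ln (real p)" using p0 by simp
  qed
  also have "\<dots> = (\<Sum>p\<in>primes_upto k. \<Sum>j\<in>{1..<1+n}. of_bool (p dvd j) * ln (real p))"
  proof (intro sum.cong refl)
    fix p
    have "(\<Sum>j\<in>{1..<1+n}. of_bool (p dvd j)) = real (card {j \<in> {1..<1+n}. p dvd j})"
      by (subst sum_of_bool_eq) (auto simp del: atLeastLessThan_iff intro!: arg_cong[of _ _ card])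
    moreover have "(\<Sum>j\<in>{1..<1+n}. of_bool (p dvd j) * ln (real p)) = (\<Sum>j\<in>{1..<1+n}. of_bool (p dvd j)) * ln (real p)"
      by (rule sum_distrib_right[symmetric])
    ultimately show "ln (real p) * real (card {j \<in> {1..<1+n}. p dvd j}) =
        (\<Sum>j\<in>{1..<1+n}. of_bool (p dvd j) * ln (real p))"
      by (simp only: mult.commute)
  qed
  also have "\<dots> = (\<Sum>j\<in>{1..<1+n}. \<Sum>p\<in>primes_upto k. of_bool (p dvd j) * ln (real p))"
    by (rule sum.swap)
  also have "\<dots> \<le> (\<Sum>j\<in>{1..<1+n}. ln (real j))"
  proof (intro sum_mono)
    fix j assume "j \<in> {1..<1+n}"
    then have "(\<Sum>p | p \<in> primes_upto k \<and> p dvd j. ln (real p)) \<le> ln (real j)"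
      by (intro sum_ln_prime_divisors_le) auto
    moreover have "(\<Sum>p\<in>primes_upto k. of_bool (p dvd j) * ln (real p)) =
        (\<Sum>p | p \<in> primes_upto k \<and> p dvd j. ln (real p))"
      by (rule sum.mono_neutral_cong_right) auto
    ultimately show "(\<Sum>p\<in>primes_upto k. of_bool (p dvd j) * ln (real p)) \<le> ln (real j)" by simp
  qed
  also have "\<dots> \<le> (\<Sum>j\<in>{1..<1+n}. ln (real n))" by (intro sum_mono) auto
  also have "\<dots> = n * ln n" by simp
  finally have "19 * real k * (\<Sum>p\<in>primes_upto k. ln (real p) / real p) \<le> 20 * real k * ln (20 * real k)"
    by (simp add: n_def sum_distrib_left mult_ac)
  then show ?thesis using assms by (simp add: field_simps)
qed

lemma sum_inverse_primes_le:
  "\<exists>C. \<forall>N\<ge>2. (\<Sum>p\<in>primes_upto N. 1 / real p) \<le> C + 20 / 19 * ln (ln (real N))"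
proof -
  define A where "A N = (\<Sum>p\<in>primes_upto N. ln (real p) / real p)" for N
  define S where "S N = (\<Sum>p\<in>primes_upto N. 1 / real p)" for N
  define T where "T N = 20 / 19 * ln (20 * real N)" for N
  \<comment> \<open>A potential replacing partial summation: a new prime changes \<open>S N\<close>
    and \<open>A N / ln N\<close> by the same amount, and the growth of \<open>T\<close> is
    outweighed by that of \<open>ln (ln N)\<close>. Hence \<open>D\<close> never increases, and
    \<open>D 2\<close> is the constant sought.\<close>
  define D where "D N = S N + (T N - A N) / ln (real N) - 20 / 19 * ln (ln (real N))" for N
  have AT: "A N \<le> T N" if "N \<ge> 1" for N
    unfolding A_def T_def using that by (rule sum_ln_over_prime_le)
  have D: "D N \<le> D 2" if "N \<ge> 2" for N
    using that
  proof (induction N rule: dec_induct)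
    case (step N)
    define a where "a = ln (real N)"
    define b where "b = ln (real (Suc N))"
    have ab: "0 < a" "a \<le> b" "0 < b" using step by (auto simp: a_def b_def)
    have "D (Suc N) = S N + (T (Suc N) - A N) / b - 20 / 19 * ln b"
    proof (cases "prime (Suc N)")
      case True
      have "S (Suc N) = S N + 1 / real (Suc N)" "A (Suc N) = A N + b / real (Suc N)"
        unfolding S_def A_def b_def sum_primes_upto_Suc using True by auto
      then show ?thesis unfolding D_def b_def[symmetric] using ab by (simp add: diff_divide_distrib add_divide_distrib)
    next
      case False
      have "S (Suc N) = S N" "A (Suc N) = A N"
        unfolding S_def A_def sum_primes_upto_Suc using False by auto
      then show ?thesis unfolding D_def b_def[symmetric] by simp
    qed
    moreover have TS: "T (Suc N) = T N + 20 / 19 * (b - a)"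
    proof -
      have "ln (20 * real j) = ln 20 + ln (real j)" if "j > 0" for j using that by (simp add: ln_mult)
      from this[of N] this[of "Suc N"] show ?thesis
        unfolding T_def a_def b_def using step by (simp add: field_simps)
    qed
    moreover have "(T N - A N) / b \<le> (T N - A N) / a"
      using ab AT[of N] step by (intro divide_left_mono) auto
    moreover have "(b - a) / b \<le> ln b - ln a"
    proof -
      have "ln (a / b) \<le> a / b - 1" using ab by (intro ln_le_minus_one) auto
      then show ?thesis using ab by (simp add: ln_div diff_divide_distrib)
    qed
    moreover have "(T (Suc N) - A N) / b = (T N - A N) / b + 20 / 19 * ((b - a) / b)"
      unfolding TS using ab by (simp add: field_simps)
    moreover have "D N = S N + (T N - A N) / a - 20 / 19 * ln a" by (simp add: D_def a_def)
    ultimately have "D (Suc N) \<le> D N" by argo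
    then show ?case using step by simp
  qed simp
  have "S N \<le> D 2 + 20 / 19 * ln (ln (real N))" if "N \<ge> 2" for N
  proof -
    have "(T N - A N) / ln (real N) \<ge> 0" using AT[of N] that by simp
    then show ?thesis using D[OF that] by (simp add: D_def)
  qed
  then show ?thesis unfolding S_def by blast
qed

definition mertens_prod :: "nat \<Rightarrow> real" where
  "mertens_prod n = (\<Prod>p\<in>primes_upto n. 1 - 1 / real p)"

lemma prime_factor_pos: "prime p \<Longrightarrow> 1 - 1 / real p > 0"
  using prime_gt_1_nat[of p] by simp

lemma mertens_prod_pos: "mertens_prod n > 0"
  unfolding mertens_prod_def by (intro prod_pos prime_factor_pos) auto

lemma mertens_prod_le_1: "mertens_prod n \<le> 1"
  unfolding mertens_prod_def by (intro prod_le_1) (auto simp: prime_ge_1_nat divide_le_eq_1)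

text \<open>Over all integers \<open>n > m\<close> the sum of \<open>1 / (n * (n - 1))\<close>
  telescopes, and the primes are some of them.\<close>

lemma sum_prime_telescope:
  assumes "1 \<le> m" "m \<le> n"
  shows "(\<Sum>p | prime p \<and> m < p \<and> p \<le> n. 1 / (real p * (real p - 1))) \<le> 1 / real m - 1 / real n"
  using assms(2)
proof (induction n rule: dec_induct)
  case base
  have empty: "{p. prime p \<and> m < p \<and> p \<le> m} = {}" by auto
  show ?case unfolding empty by simp
next
  case (step n)
  have n: "real n > 0" using step assms by simp
  have "{p. prime p \<and> m < p \<and> p \<le> Suc n} \<subseteq> insert (Suc n) {p. prime p \<and> m < p \<and> p \<le> n}"
    by (auto simp: le_Suc_eq)
  then have "(\<Sum>p | prime p \<and> m < p \<and> p \<le> Suc n. 1 / (real p * (real p - 1))) \<le>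
      (\<Sum>p\<in>insert (Suc n) {p. prime p \<and> m < p \<and> p \<le> n}. 1 / (real p * (real p - 1)))"
  proof (intro sum_mono2)
    fix p assume "p \<in> insert (Suc n) {p. prime p \<and> m < p \<and> p \<le> n} - {p. prime p \<and> m < p \<and> p \<le> Suc n}"
    then have "p \<ge> 1" using assms by auto
    then show "0 \<le> 1 / (real p * (real p - 1))" by simp
  qed auto
  also have "\<dots> = 1 / (real (Suc n) * (real (Suc n) - 1)) + (\<Sum>p | prime p \<and> m < p \<and> p \<le> n. 1 / (real p * (real p - 1)))"
    by (subst sum.insert) auto
  also have "\<dots> \<le> 1 / (real (Suc n) * (real (Suc n) - 1)) + (1 / real m - 1 / real n)" using step by simp
  also have "1 / (real (Suc n) * (real (Suc n) - 1)) = 1 / real n - 1 / real (Suc n)"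
    using n by (simp add: divide_simps)
  finally show ?case by simp
qed

text \<open>Mertens' theorem has exponent 1. Here 20/19 is good enough, being below 1.06, the power
  of \<open>\<lambda>'\<close> allowed for \<open>1 / mertens_prod w\<close> when \<open>w\<close>
  is about \<open>exp (10 * \<lambda>')\<close>. Beyond the sum of \<open>1 / p\<close>, taking
  logarithms leaves only a convergent sum of \<open>1 / (p * (p - 1))\<close>.\<close>

lemma inverse_mertens_prod_le:
  "\<exists>C>0. \<forall>N\<ge>2. 1 / mertens_prod N \<le> C * ln (real N) powr (20 / 19)"
proof -
  obtain C where C: "\<And>N. N \<ge> 2 \<Longrightarrow> (\<Sum>p\<in>primes_upto N. 1 / real p) \<le> C + 20 / 19 * ln (ln (real N))"
    using sum_inverse_primes_le by blast
  have "1 / mertens_prod N \<le> exp (C + 1) * ln (real N) powr (20 / 19)" if "N \<ge> 2" for N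
  proof -
    have "1 / mertens_prod N = (\<Prod>p\<in>primes_upto N. 1 / (1 - 1 / real p))"
      by (simp add: mertens_prod_def prod_dividef)
    also have "\<dots> \<le> (\<Prod>p\<in>primes_upto N. exp (1 / real p + 1 / (real p * (real p - 1))))"
    proof (intro prod_mono conjI)
      fix p assume "p \<in> primes_upto N"
      then have p: "real p > 1" using prime_gt_1_nat[of p] by simp
      then show "0 \<le> 1 / (1 - 1 / real p)" by simp
      have "1 / (1 - 1 / real p) = 1 + (1 / real p + 1 / (real p * (real p - 1)))"
        using p by (simp add: divide_simps)
      then show "1 / (1 - 1 / real p) \<le> exp (1 / real p + 1 / (real p * (real p - 1)))"
        by (metis exp_ge_add_one_self)
    qed
    also have "\<dots> = exp (\<Sum>p\<in>primes_upto N. 1 / real p + 1 / (real p * (real p - 1)))"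
      by (simp add: exp_sum)
    also have "\<dots> \<le> exp (C + 20 / 19 * ln (ln (real N)) + 1)"
    proof -
      have "primes_upto N = {p. prime p \<and> 1 < p \<and> p \<le> N}" using prime_gt_1_nat by auto
      then have "(\<Sum>p\<in>primes_upto N. 1 / (real p * (real p - 1))) \<le> 1 - 1 / real N"
        using sum_prime_telescope[of 1 N] that by simp
      moreover have "1 / real N \<ge> 0" by simp
      ultimately have "(\<Sum>p\<in>primes_upto N. 1 / (real p * (real p - 1))) \<le> 1" by linarith
      then show ?thesis using C[OF that] by (simp add: sum.distrib)
    qed
    also have "\<dots> = exp (C + 1) * ln (real N) powr (20 / 19)"
      using that by (simp add: powr_def exp_add)
    finally show ?thesis .
  qed
  then show ?thesis by (intro exI[of _ "exp (C + 1)"]) auto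
qed

section \<open>The singular series\<close>

text \<open>The probability that all of \<open>H\<close> survives when one random class is removed
  modulo each prime up to \<open>w\<close>.\<close>

definition sieve_density :: "nat \<Rightarrow> nat set \<Rightarrow> real" where
  "sieve_density w H = (\<Prod>p\<in>primes_upto w. 1 - real (card ((\<lambda>h. h mod p) ` H)) / real p)"

lemma card_residues_le:
  assumes "prime p" shows "card ((\<lambda>h. h mod p) ` H) \<le> p"
proof -
  have "(\<lambda>h. h mod p) ` H \<subseteq> {..<p}" using prime_gt_0_nat[OF assms] by auto
  from card_mono[OF finite_lessThan this] show ?thesis by simp
qed

lemma sieve_density_bounds: "0 \<le> sieve_density w H" "sieve_density w H \<le> 1"
proof -
  have "0 \<le> 1 - real (card ((\<lambda>h. h mod p) ` H)) / real p" if "prime p" for p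
    using card_residues_le[OF that] prime_gt_0_nat[OF that] by simp
  then show "0 \<le> sieve_density w H" "sieve_density w H \<le> 1"
    unfolding sieve_density_def by (auto intro!: prod_nonneg prod_le_1)
qed

text \<open>Bernoulli's inequality twice: for \<open>(1 - 1 / p) ^ k\<close>, and for
  \<open>(1 + 1 / p) ^ k\<close>, which is at most \<open>1 / (1 - 1 / p) ^ k\<close>.\<close>

lemma local_factor_bounds:
  assumes "k \<le> p" "1 < p"
  shows "1 - real k ^ 2 / real p ^ 2 \<le> (1 - real k / real p) / (1 - 1 / real p) ^ k"
    "(1 - real k / real p) / (1 - 1 / real p) ^ k \<le> 1"
proof -
  have p: "0 < 1 - 1 / real p" using assms by simp
  have x: "0 \<le> 1 - real k / real p" using assms by simp
  have "1 - real k / real p \<le> (1 - 1 / real p) ^ k"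
    using Bernoulli_inequality[of "- 1 / real p" k] assms by simp
  then show "(1 - real k / real p) / (1 - 1 / real p) ^ k \<le> 1"
    using p by (simp add: divide_le_eq_1)
  have "1 + real k / real p \<le> (1 + 1 / real p) ^ k"
    using Bernoulli_inequality[of "1 / real p" k] order_trans[of "-1" 0 "1 / real p"] by simp
  also have "\<dots> \<le> (1 / (1 - 1 / real p)) ^ k"
    using p assms by (intro power_mono) (auto simp: field_simps)
  finally have "(1 - real k / real p) * (1 + real k / real p) \<le> (1 - real k / real p) * (1 / (1 - 1 / real p)) ^ k"
    using x by (intro mult_left_mono) auto
  moreover have "(1 - real k / real p) * (1 + real k / real p) = 1 - real k ^ 2 / real p ^ 2"
    by (simp add: algebra_simps power2_eq_square)
  moreover have "(1 - real k / real p) * (1 / (1 - 1 / real p)) ^ k = (1 - real k / real p) / (1 - 1 / real p) ^ k"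
    by (simp add: power_one_over)
  ultimately show "1 - real k ^ 2 / real p ^ 2 \<le> (1 - real k / real p) / (1 - 1 / real p) ^ k"
    by (simp only:)
qed

text \<open>The primes up to \<open>w\<close> contribute exactly the quotient of densities. For
  \<open>p > w > m\<close> the elements of \<open>H\<close> are distinct modulo \<open>p\<close>, so
  the local factor lies between \<open>1 - k ^ 2 / p ^ 2\<close> and 1, and the product of these
  over \<open>p > w\<close> loses at most \<open>k ^ 2 / w\<close>.\<close>

theorem singular_series_bounds:
  assumes "H \<subseteq> {0..m}" "m < w" "card H \<le> w"
  shows "sieve_density w H / mertens_prod w ^ card H * (1 - real (card H) ^ 2 / real w) \<le> singular_series (int ` H)"
    and "singular_series (int ` H) \<le> sieve_density w H / mertens_prod w ^ card H"
proof -
  define k where "k = card H"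
  define c where "c p = card ((\<lambda>h. h mod p) ` H)" for p
  define f where "f p = (if prime p then (1 - real (c p) / real p) / (1 - 1 / real p) ^ k else 1)" for p :: nat
  define B where "B = sieve_density w H / mertens_prod w ^ k"
  have w: "w > 0" using assms by simp
  have finH: "finite H" using assms finite_subset by blast
  have "card ((\<lambda>h. h mod int p) ` int ` H) = c p" for p
  proof -
    have "(\<lambda>h. h mod int p) ` int ` H = int ` (\<lambda>h. h mod p) ` H" by (simp add: image_image zmod_int)
    then show ?thesis by (simp add: c_def card_image)
  qed
  moreover have "card (int ` H) = k" by (simp add: k_def card_image)
  ultimately have S: "singular_series (int ` H) = prodinf f"
    unfolding singular_series_def f_def by (intro arg_cong[of _ _ prodinf]) auto
  have ck: "c p = k" if "p > w" for p
  proof -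
    have "inj_on (\<lambda>h. h mod p) H"
    proof (rule inj_onI)
      fix x y assume xy: "x \<in> H" "y \<in> H" "x mod p = y mod p"
      have "x \<le> m" "y \<le> m" using xy(1,2) assms(1) by auto
      then show "x = y" using xy(3) assms(2) that by simp
    qed
    then show ?thesis by (simp add: c_def k_def card_image)
  qed
  have f: "1 - real k ^ 2 / real p ^ 2 \<le> f p" "f p \<le> 1" if "p > w" for p
    using local_factor_bounds[of k p] that ck[OF that] w assms by (auto simp: f_def k_def)
  have "summable (\<lambda>p. norm (f p - 1))"
  proof (rule summable_comparison_test_ev)
    show "\<forall>\<^sub>F p in sequentially. norm (norm (f p - 1)) \<le> real k ^ 2 * (1 / real p ^ 2)"
      using eventually_gt_at_top[of w]
    proof eventually_elim
      case (elim p)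
      then show ?case using f[of p] by simp
    qed
    show "summable (\<lambda>p. real k ^ 2 * (1 / real p ^ 2))"
      by (intro summable_mult) (use inverse_power_summable[of 2, where 'a = real] in \<open>simp add: divide_inverse\<close>)
  qed
  \<comment> \<open>Convergence of the product makes \<open>prodinf\<close> the limit of the partial
    products, even when some local factors vanish.\<close>
  then have lim: "(\<lambda>n. \<Prod>i\<le>n. f i) \<longlonglongrightarrow> prodinf f"
    by (intro convergent_prod_LIMSEQ abs_convergent_prod_imp_convergent_prod summable_imp_abs_convergent_prod)
  have "(\<Prod>i\<le>w. f i) = (\<Prod>p\<in>primes_upto w. f p)"
    by (rule prod.mono_neutral_right) (auto simp: f_def)
  also have "\<dots> = (\<Prod>p\<in>primes_upto w. (1 - real (c p) / real p) / (1 - 1 / real p) ^ k)"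
    by (rule prod.cong) (auto simp: f_def)
  also have "\<dots> = B" by (simp add: B_def sieve_density_def mertens_prod_def c_def prod_dividef prod_power_distrib)
  finally have base: "(\<Prod>i\<le>w. f i) = B" .
  have B0: "B \<ge> 0" unfolding B_def using sieve_density_bounds mertens_prod_pos[of w] by simp
  \<comment> \<open>The loss is carried as \<open>1 / w - 1 / n\<close>, so that the induction step
    telescopes.\<close>
  have bnd: "1 - real k ^ 2 * (1 / real w - 1 / real n) \<le> (\<Prod>i\<in>{w<..n}. f i) \<and> (\<Prod>i\<in>{w<..n}. f i) \<le> 1 \<and> 0 \<le> (\<Prod>i\<in>{w<..n}. f i)" if "n \<ge> w" for n
    using that
  proof (induction n rule: dec_induct)
    case (step n)
    define t where "t = (\<Prod>i\<in>{w<..n}. f i)"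
    define b where "b = real k ^ 2 / real (Suc n) ^ 2"
    have "{w<..Suc n} = insert (Suc n) {w<..n}" using step by auto
    then have eq: "(\<Prod>i\<in>{w<..Suc n}. f i) = f (Suc n) * t" by (simp add: t_def)
    have t: "1 - real k ^ 2 * (1 / real w - 1 / real n) \<le> t" "t \<le> 1" "0 \<le> t" using step by (auto simp: t_def)
    have fn: "1 - b \<le> f (Suc n)" "f (Suc n) \<le> 1" using f[of "Suc n"] step by (auto simp: b_def)
    have "k \<le> Suc n" using step assms by (simp add: k_def)
    then have "real k ^ 2 \<le> real (Suc n) ^ 2" by (intro power_mono) auto
    then have b: "b \<le> 1" "b \<ge> 0" by (auto simp: b_def)
    have "(1 - f (Suc n)) * t \<le> b * 1" using fn t b by (intro mult_mono) auto
    then have "f (Suc n) * t \<ge> t - b" by (simp add: algebra_simps)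
    moreover have "b \<le> real k ^ 2 * (1 / real n - 1 / real (Suc n))"
    proof -
      have "1 / real (Suc n) ^ 2 \<le> 1 / real n - 1 / real (Suc n)"
      proof -
        have n0: "real n > 0" using step w by simp
        have "1 / real (Suc n) ^ 2 \<le> 1 / (real n * real (Suc n))"
          using n0 by (intro frac_le) (auto simp: power2_eq_square)
        also have "\<dots> = 1 / real n - 1 / real (Suc n)" using n0 by (simp add: field_simps)
        finally show ?thesis .
      qed
      then have "real k ^ 2 * (1 / real (Suc n) ^ 2) \<le> real k ^ 2 * (1 / real n - 1 / real (Suc n))"
        by (rule mult_left_mono) simp
      then show ?thesis by (simp add: b_def)
    qed
    ultimately have "1 - real k ^ 2 * (1 / real w - 1 / real (Suc n)) \<le> f (Suc n) * t"
      using t by (simp only: right_diff_distrib)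
    moreover have "f (Suc n) * t \<le> 1" using fn t b by (intro mult_le_one) auto
    moreover have "0 \<le> f (Suc n) * t" using fn t b by (intro mult_nonneg_nonneg) auto
    ultimately show ?case unfolding eq by blast
  qed simp
  have P: "B * (1 - real k ^ 2 / real w) \<le> (\<Prod>i\<le>n. f i) \<and> (\<Prod>i\<le>n. f i) \<le> B" if "n \<ge> w" for n
  proof -
    have "{..n} = {..w} \<union> {w<..n}" using that by auto
    then have "(\<Prod>i\<le>n. f i) = B * (\<Prod>i\<in>{w<..n}. f i)"
      using base by (simp add: prod.union_disjoint disjoint_iff)
    moreover have "1 - real k ^ 2 / real w \<le> 1 - real k ^ 2 * (1 / real w - 1 / real n)"
      by (simp add: right_diff_distrib)
    ultimately show ?thesis
      using bnd[OF that] B0 by (auto intro!: mult_left_mono mult_left_le)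
  qed
  show "sieve_density w H / mertens_prod w ^ card H * (1 - real (card H) ^ 2 / real w) \<le> singular_series (int ` H)"
    unfolding S k_def[symmetric] B_def[symmetric] by (rule LIMSEQ_le_const[OF lim]) (use P in blast)
  show "singular_series (int ` H) \<le> sieve_density w H / mertens_prod w ^ card H"
    unfolding S k_def[symmetric] B_def[symmetric] by (rule LIMSEQ_le_const2[OF lim]) (use P in blast)
qed

section \<open>The random sieve model\<close>

text \<open>Multiplying out the product of \<open>1 + 1 / p\<close> leaves at least
  \<open>1 + \<Sum> 1 / p\<close>. The bound is crude, but it is used only with the tiny factor
  \<open>\<theta>\<close>.\<close>

lemma sum_le_one_div_mertens: "(\<Sum>p\<in>primes_upto w. 1 / real p) \<le> 1 / mertens_prod w"
proof -
  have "(\<Sum>p\<in>A. 1 / real p) \<le> (\<Prod>p\<in>A. 1 / (1 - 1 / real p))" if "finite A" "A \<subseteq> {p. prime p}" for A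
  proof -
    have "1 + (\<Sum>p\<in>A. 1 / real p) \<le> (\<Prod>p\<in>A. 1 / (1 - 1 / real p))"
      using that
    proof (induction A rule: finite_induct)
      case (insert p A)
      then have p: "real p > 1" using prime_gt_1_nat[of p] by simp
      have s: "0 \<le> (\<Sum>p\<in>A. 1 / real p)" by (intro sum_nonneg) auto
      have "1 + 1 / real p \<le> 1 / (1 - 1 / real p)" using p by (simp add: field_simps)
      then have "(1 + 1 / real p) * (1 + (\<Sum>p\<in>A. 1 / real p)) \<le> 1 / (1 - 1 / real p) * (\<Prod>p\<in>A. 1 / (1 - 1 / real p))"
        using insert s p by (intro mult_mono) auto
      moreover have "1 + (1 / real p + (\<Sum>p\<in>A. 1 / real p)) \<le> (1 + 1 / real p) * (1 + (\<Sum>p\<in>A. 1 / real p))"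
        using s p by (simp add: algebra_simps)
      ultimately show ?case using insert by simp
    qed simp
    then show ?thesis by simp
  qed
  from this[of "primes_upto w"] show ?thesis by (auto simp: mertens_prod_def prod_dividef)
qed

lemma prod_list_sorted_list_of_set:
  "finite A \<Longrightarrow> (\<Prod>p\<leftarrow>sorted_list_of_set A. f p) = (\<Prod>p\<in>A. f p :: real)"
  using prod.distinct_set_conv_list[of "sorted_list_of_set A" f] by simp

lemma sum_list_sorted_list_of_set:
  "finite A \<Longrightarrow> (\<Sum>p\<leftarrow>sorted_list_of_set A. f p) = (\<Sum>p\<in>A. f p :: real)"
  using sum.distinct_set_conv_list[of "sorted_list_of_set A" f] by simp

lemma prod_list_le_sorted_append:
  assumes "w1 \<le> w"
  shows "(\<Prod>p\<leftarrow>sorted_list_of_set (primes_upto w1) @ sorted_list_of_set {p. prime p \<and> w1 < p \<and> p \<le> w}. f p)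
     = (\<Prod>p\<in>primes_upto w. f p :: real)"
proof -
  have eq: "primes_upto w = primes_upto w1 \<union> {p. prime p \<and> w1 < p \<and> p \<le> w}" using assms by auto
  have fin: "finite {p. prime p \<and> w1 < p \<and> p \<le> w}" by (rule finite_subset[of _ "{..w}"]) auto
  show ?thesis unfolding eq using fin
    by (subst prod.union_disjoint) (auto simp: prod_list_sorted_list_of_set)
qed

lemma sum_power_card_Pow: "finite T \<Longrightarrow> (\<Sum>H\<in>Pow T. \<theta> ^ card H) = (1 + \<theta> :: real) ^ card T"
proof (induction T rule: finite_induct)
  case (insert x T)
  have fin: "H \<subseteq> T \<Longrightarrow> finite H" for H using insert finite_subset by blast
  have "(\<Sum>H\<in>Pow (insert x T). \<theta> ^ card H) = (\<Sum>H\<in>Pow T. \<theta> ^ card H) + (\<Sum>H\<in>insert x ` Pow T. \<theta> ^ card H)"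
    unfolding Pow_insert using insert by (intro sum.union_disjoint) auto
  also have "(\<Sum>H\<in>insert x ` Pow T. \<theta> ^ card H) = (\<Sum>H\<in>Pow T. \<theta> ^ card (insert x H))"
    using insert by (intro sum.reindex_cong[of "insert x"]) (auto simp: inj_on_def)
  also have "\<dots> = (\<Sum>H\<in>Pow T. \<theta> * \<theta> ^ card H)"
    using insert fin by (intro sum.cong refl) (subst card_insert_disjoint, auto)
  finally show ?case using insert by (simp add: sum_distrib_left[symmetric] distrib_right)
qed simp

definition tuples :: "nat \<Rightarrow> nat \<Rightarrow> nat set set" where
  "tuples m K = {H. H \<subseteq> {1..m} \<and> card H \<le> K}"

lemma finite_tuples [simp]: "finite (tuples m K)"
  unfolding tuples_def by (rule finite_subset[of _ "Pow {1..m}"]) auto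

lemma finite_in_tuples: "H \<in> tuples m K \<Longrightarrow> finite H"
  unfolding tuples_def using finite_subset by auto

lemma sum_tuples: "(\<Sum>H\<in>tuples m K. F H :: real) = (\<Sum>k\<le>K. \<Sum>H | H \<subseteq> {1..m} \<and> card H = k. F H)"
proof -
  have "(\<Sum>k\<le>K. \<Sum>H | H \<in> tuples m K \<and> card H = k. F H) = (\<Sum>H\<in>tuples m K. F H)"
    by (rule sum.group) (auto simp: tuples_def)
  moreover have "{H \<in> tuples m K. card H = k} = {H. H \<subseteq> {1..m} \<and> card H = k}" if "k \<le> K" for k
    using that by (auto simp: tuples_def)
  ultimately show ?thesis by (metis (no_types, lifting) atMost_iff sum.cong)
qed

text \<open>\<open>u\<close> stands for \<open>ln t\<close> at a fixed \<open>t\<close>. The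
  assumption \<open>half\<close> makes the keeping probability \<open>\<theta>\<close> at most 1/2,
  so that powers of \<open>1 - \<theta>\<close> are comparable with exponentials.\<close>

locale sieve_model =
  fixes w1 w :: nat and u :: real
  assumes w1: "1 \<le> w1" "w1 \<le> w" and u: "0 < u"
    and half: "1 / (mertens_prod w * u) \<le> 1 / 2"
begin

definition \<theta> :: real where "\<theta> = 1 / (mertens_prod w * u)"

text \<open>The order of the primes matters: those up to \<open>w1\<close> come first, so the
  average over the larger ones is the inner one and can be bounded for every outcome of the small
  ones.\<close>

definition avg :: "(nat set \<Rightarrow> real) \<Rightarrow> nat set \<Rightarrow> real" where
  "avg = sieve_avg (sorted_list_of_set (primes_upto w1) @ sorted_list_of_set {p. prime p \<and> w1 < p \<and> p \<le> w})"

definition gap_avg :: "nat \<Rightarrow> real" where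
  "gap_avg m = avg (\<lambda>T. (1 - \<theta>) ^ card T) {0..<m}"

definition next_gap_avg :: "nat \<Rightarrow> real" where
  "next_gap_avg m = gap_avg m - gap_avg (Suc m)"

lemma \<theta>: "0 < \<theta>" "\<theta> \<le> 1 / 2" "\<theta> * mertens_prod w = 1 / u"
  using u half mertens_prod_pos[of w] by (simp_all add: \<theta>_def)

lemma finite_ps2 [simp]: "finite {p. prime p \<and> w1 < p \<and> p \<le> w}"
  by (rule finite_subset[of _ "{..w}"]) auto

lemma set_ps: "p \<in> set (sorted_list_of_set (primes_upto w1) @ sorted_list_of_set {p. prime p \<and> w1 < p \<and> p \<le> w}) \<Longrightarrow> prime p"
  by auto

lemma avg_exp_ge:
  "exp (- s * mertens_prod w * real m) \<le> avg (\<lambda>T. exp (- s * real (card T))) {0..<m}"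
proof -
  define ps where "ps = sorted_list_of_set (primes_upto w1) @ sorted_list_of_set {p. prime p \<and> w1 < p \<and> p \<le> w}"
  have "p \<in> set ps \<Longrightarrow> 0 < p" for p unfolding ps_def by (drule set_ps, rule prime_gt_0_nat)
  then have "exp (- s * (\<Prod>p\<leftarrow>ps. 1 - 1 / real p) * real (card {0..<m})) \<le>
      sieve_avg ps (\<lambda>T. exp (- s * real (card T))) {0..<m}"
    by (rule sieve_avg_exp_ge) auto
  then show ?thesis
    unfolding ps_def avg_def mertens_prod_def prod_list_le_sorted_append[OF w1(2)] by simp
qed

text \<open>The error of \<open>brun_sieve\<close> divided by the density
  \<open>mertens_prod w1\<close>: the number of survivors is \<open>mertens_prod w1\<close> times
  \<open>m\<close> up to \<open>brun_error r m\<close>.\<close>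

definition brun_error :: "nat \<Rightarrow> nat \<Rightarrow> real" where
  "brun_error r m = (2 * real m * ((\<Sum>p\<in>primes_upto w1. 1 / real p) ^ Suc r / fact (Suc r)) + (1 + real w1) ^ Suc r)
     / mertens_prod w1"

text \<open>The primes up to \<open>w1\<close> are controlled for each choice of residue classes by Brun's sieve,
  and those beyond \<open>w1\<close> by the exponential moment bound.\<close>

lemma avg_exp_le:
  fixes s :: real and m r :: nat
  defines "\<kappa> \<equiv> 8 * \<bar>s\<bar> * (real m / real w1 + 1 / mertens_prod w)"
  assumes "\<kappa> \<le> 1"
  shows "avg (\<lambda>T. exp (- s * real (card T))) {0..<m} \<le>
    exp (- (s - \<bar>s\<bar> * \<kappa>) * mertens_prod w * real m + 2 * \<bar>s\<bar> * mertens_prod w * brun_error r m)"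
proof -
  define ps1 where "ps1 = sorted_list_of_set (primes_upto w1)"
  define P2 where "P2 = {p. prime p \<and> w1 < p \<and> p \<le> w}"
  define ps2 where "ps2 = sorted_list_of_set P2"
  define V2 where "V2 = (\<Prod>p\<in>P2. 1 - 1 / real p)"
  define M where "M p = real m / real p + 1" for p
  define K where "K = (\<Sum>p\<in>P2. 8 * \<bar>s\<bar> * M p / real p)"
  have fin2: "finite P2" by (simp add: P2_def)
  have set2: "set ps2 = P2" using fin2 by (simp add: ps2_def)
  have V2: "0 \<le> V2" "V2 \<le> 1"
    unfolding V2_def P2_def by (auto intro!: prod_nonneg prod_le_1 simp: prime_ge_1_nat divide_le_eq_1)
  have VV: "mertens_prod w1 * V2 = mertens_prod w"
    unfolding mertens_prod_def V2_def P2_def prod_list_le_sorted_append[OF w1(2), symmetric]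
    by (simp add: prod_list_sorted_list_of_set)
  have V1: "1 \<le> 1 / mertens_prod w" using mertens_prod_pos[of w] mertens_prod_le_1[of w] by simp
  \<comment> \<open>The two parts of \<open>M p\<close> are summed separately: \<open>m / p\<close>
    gives a sum of \<open>1 / p ^ 2\<close>, bounded by the telescoping \<open>1 / w1\<close>; the
    rounding term 1 gives a sum of \<open>1 / p\<close>.\<close>
  have K: "K \<le> \<kappa>"
  proof -
    have "K = 8 * \<bar>s\<bar> * (real m * (\<Sum>p\<in>P2. 1 / (real p * real p)) + (\<Sum>p\<in>P2. 1 / real p))"
      unfolding K_def M_def by (simp add: sum_distrib_left sum.distrib add_divide_distrib distrib_left)
    also have "\<dots> \<le> 8 * \<bar>s\<bar> * (real m * (1 / real w1) + 1 / mertens_prod w)"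
    proof (intro mult_left_mono add_mono)
      have "(\<Sum>p\<in>P2. 1 / (real p * real p)) \<le> (\<Sum>p\<in>P2. 1 / (real p * (real p - 1)))"
      proof (intro sum_mono divide_left_mono mult_left_mono)
        fix p assume "p \<in> P2"
        then have "real p > 1" using prime_gt_1_nat[of p] by (simp add: P2_def)
        then show "0 < real p * real p * (real p * (real p - 1))" by simp
      qed auto
      also have "\<dots> \<le> 1 / real w1 - 1 / real w"
        unfolding P2_def by (rule sum_prime_telescope[OF w1])
      also have "\<dots> \<le> 1 / real w1" by simp
      finally show "(\<Sum>p\<in>P2. 1 / (real p * real p)) \<le> 1 / real w1" .
      have "(\<Sum>p\<in>P2. 1 / real p) \<le> (\<Sum>p\<in>primes_upto w. 1 / real p)"
        unfolding P2_def by (intro sum_mono2) auto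
      then show "(\<Sum>p\<in>P2. 1 / real p) \<le> 1 / mertens_prod w"
        using sum_le_one_div_mertens[of w] by simp
    qed auto
    finally show ?thesis by (simp add: \<kappa>_def)
  qed
  have inner: "sieve_avg ps2 (\<lambda>T. exp (- s * real (card T))) S
      \<le> exp (- ((s - \<bar>s\<bar> * K) * V2) * real (card S))" if "S \<subseteq> {0..<m}" for S
  proof -
    have "sieve_avg ps2 (\<lambda>T. exp (- s * real (card T))) S
      \<le> exp (- (s - \<bar>s\<bar> * (\<Sum>p\<leftarrow>ps2. 8 * \<bar>s\<bar> * M p / real p)) * (\<Prod>p\<leftarrow>ps2. 1 - 1 / real p) * real (card S))"
    proof (rule sieve_avg_exp_le)
      show "finite S" using that finite_subset by blast
      show "2 \<le> p" if "p \<in> set ps2" for p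
        using that prime_ge_2_nat by (auto simp: set2 P2_def)
      show "0 \<le> M p" for p by (simp add: M_def)
      show "2 * \<bar>s\<bar> * M p \<le> 1" if "p \<in> set ps2" for p
      proof -
        have "w1 < p" using that by (simp add: set2 P2_def)
        then have "real m / real p \<le> real m / real w1" using w1 by (intro divide_left_mono) auto
        then have "M p \<le> real m / real w1 + 1 / mertens_prod w" using V1 by (simp add: M_def)
        then have "8 * \<bar>s\<bar> * M p \<le> \<kappa>" unfolding \<kappa>_def by (intro mult_left_mono) auto
        moreover have "0 \<le> \<bar>s\<bar> * M p" by (simp add: M_def)
        ultimately show ?thesis using assms(2) by linarith
      qed
      show "real (card {h \<in> S. h mod p = a}) \<le> M p" if "p \<in> set ps2" "a < p" for p a
      proof -
        have "card {h \<in> S. h mod p = a} \<le> card {h \<in> {0..<0+m}. h mod p = a}"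
          using \<open>S \<subseteq> {0..<m}\<close> by (intro card_mono) auto
        moreover have "real (card {h \<in> {0..<0+m}. h mod p = a}) \<le> M p"
          using residue_card[of p a 0 m] that by (simp add: M_def)
        ultimately show ?thesis by linarith
      qed
      show "(\<Sum>p\<leftarrow>ps2. 8 * \<bar>s\<bar> * M p / real p) \<le> 1"
        using K assms(2) unfolding ps2_def K_def by (simp add: sum_list_sorted_list_of_set[OF fin2])
    qed
    then show ?thesis
      unfolding ps2_def K_def V2_def sum_list_sorted_list_of_set[OF fin2] prod_list_sorted_list_of_set[OF fin2]
      by (simp only: mult_minus_left mult.assoc)
  qed
  define b where "b = (s - \<bar>s\<bar> * K) * V2"
  have K0: "0 \<le> K" unfolding K_def M_def by (intro sum_nonneg) auto
  have "\<bar>s - \<bar>s\<bar> * K\<bar> \<le> \<bar>s\<bar> + \<bar>s\<bar> * K"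
    using K0 abs_triangle_ineq4[of s "\<bar>s\<bar> * K"] by (simp add: abs_mult)
  also have "\<dots> \<le> 2 * \<bar>s\<bar>" using K assms(2) mult_left_mono[of K 1 "\<bar>s\<bar>"] by simp
  finally have "\<bar>s - \<bar>s\<bar> * K\<bar> * V2 \<le> 2 * \<bar>s\<bar> * V2" using V2 by (intro mult_right_mono) auto
  then have b: "\<bar>b\<bar> \<le> 2 * \<bar>s\<bar> * V2" using V2 by (simp add: b_def abs_mult)
  have "avg (\<lambda>T. exp (- s * real (card T))) {0..<m} =
     sieve_avg ps1 (sieve_avg ps2 (\<lambda>T. exp (- s * real (card T)))) {0..<m}"
    by (simp add: avg_def sieve_avg_append ps1_def ps2_def P2_def)
  also have "\<dots> \<le> sieve_avg ps1 (\<lambda>S. exp (- b * real (card S))) {0..<m}"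
    unfolding b_def by (intro sieve_avg_mono inner)
  also have "\<dots> \<le> exp (- b * mertens_prod w1 * real m + 2 * \<bar>s\<bar> * mertens_prod w * brun_error r m)"
  proof (rule sieve_avg_le_worst)
    show "distinct ps1" by (simp add: ps1_def)
    show "p \<in> set ps1 \<Longrightarrow> 0 < p" for p by (auto simp: ps1_def prime_gt_0_nat)
    fix a assume a: "\<And>p. p \<in> set ps1 \<Longrightarrow> a p < p"
    define N where "N = real (card {h \<in> {0..<0+m}. \<forall>p\<in>primes_upto w1. h mod p \<noteq> a p})"
    have "card (primes_upto w1) \<le> card {1..w1}"
      by (intro card_mono) (auto simp: Suc_le_eq prime_gt_0_nat)
    then have c: "(1 + real (card (primes_upto w1))) ^ Suc r \<le> (1 + real w1) ^ Suc r"
      by (intro power_mono) auto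
    have "\<bar>N - m * mertens_prod w1\<bar> \<le> 2 * m * ((\<Sum>p\<in>primes_upto w1. 1 / real p) ^ Suc r / fact (Suc r))
        + (1 + card (primes_upto w1)) ^ Suc r"
      unfolding N_def mertens_prod_def by (rule brun_sieve) (use a in \<open>auto simp: ps1_def\<close>)
    also have "\<dots> \<le> 2 * m * ((\<Sum>p\<in>primes_upto w1. 1 / real p) ^ Suc r / fact (Suc r)) + (1 + real w1) ^ Suc r"
      using c by (simp only: of_nat_power of_nat_add of_nat_1 add_left_mono)
    also have "\<dots> = brun_error r m * mertens_prod w1"
      unfolding brun_error_def using mertens_prod_pos[of w1] by (simp del: power_Suc fact_Suc)
    finally have "\<bar>N - m * mertens_prod w1\<bar> \<le> brun_error r m * mertens_prod w1" .
    then have "\<bar>b\<bar> * \<bar>N - m * mertens_prod w1\<bar> \<le> (2 * \<bar>s\<bar> * V2) * (brun_error r m * mertens_prod w1)"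
      using b V2 by (intro mult_mono) auto
    also have "\<dots> = 2 * \<bar>s\<bar> * mertens_prod w * brun_error r m" by (simp add: mult_ac flip: VV)
    finally have "\<bar>b\<bar> * \<bar>N - m * mertens_prod w1\<bar> \<le> 2 * \<bar>s\<bar> * mertens_prod w * brun_error r m" .
    then have "\<bar>- b * (N - m * mertens_prod w1)\<bar> \<le> 2 * \<bar>s\<bar> * mertens_prod w * brun_error r m"
      by (simp add: abs_mult)
    then have "- b * (N - m * mertens_prod w1) \<le> 2 * \<bar>s\<bar> * mertens_prod w * brun_error r m" by (rule abs_le_D1)
    moreover have "- b * (N - m * mertens_prod w1) = - b * N - (- b * mertens_prod w1 * real m)"
      by (simp add: right_diff_distrib mult_ac)
    ultimately have "- b * N \<le> - b * mertens_prod w1 * real m + 2 * \<bar>s\<bar> * mertens_prod w * brun_error r m"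
      by linarith
    moreover have "set ps1 = primes_upto w1" "{0..<0+m} = {0..<m}" by (simp_all add: ps1_def)
    ultimately show "exp (- b * real (card {h \<in> {0..<m}. \<forall>p\<in>set ps1. h mod p \<noteq> a p})) \<le>
      exp (- b * mertens_prod w1 * real m + 2 * \<bar>s\<bar> * mertens_prod w * brun_error r m)"
      unfolding N_def by (simp only: exp_le_cancel_iff)
  qed
  also have "\<dots> \<le> exp (- (s - \<bar>s\<bar> * \<kappa>) * mertens_prod w * real m + 2 * \<bar>s\<bar> * mertens_prod w * brun_error r m)"
  proof -
    have "b * mertens_prod w1 = (s - \<bar>s\<bar> * K) * mertens_prod w"
      unfolding b_def VV[symmetric] by (simp add: mult_ac)
    moreover have "(s - \<bar>s\<bar> * \<kappa>) * mertens_prod w * real m \<le> (s - \<bar>s\<bar> * K) * mertens_prod w * real m"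
      using K mertens_prod_pos[of w] by (intro mult_right_mono diff_left_mono mult_left_mono) auto
    ultimately show ?thesis by (simp only: exp_le_cancel_iff mult_minus_left add_le_cancel_right neg_le_iff_le)
  qed
  finally show ?thesis .
qed

end

lemma one_minus_power_exp:
  assumes "0 \<le> x" "x \<le> (1 / 2 :: real)"
  shows "exp (- (x + 2 * x\<^sup>2) * real n) \<le> (1 - x) ^ n" "(1 - x) ^ n \<le> exp (- x * real n)"
proof -
  have "- x - 2 * x\<^sup>2 \<le> ln (1 - x)" using assms by (intro ln_one_minus_pos_lower_bound)
  then have "exp (- x - 2 * x\<^sup>2) \<le> 1 - x" using assms by (metis exp_ln exp_le_cancel_iff diff_gt_0_iff_gt less_le_trans half_gt_zero_iff not_less order_le_less_trans pos2 zero_less_one field_sum_of_halves less_add_same_cancel1)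
  then have "exp (- x - 2 * x\<^sup>2) ^ n \<le> (1 - x) ^ n" by (intro power_mono) auto
  then show "exp (- (x + 2 * x\<^sup>2) * real n) \<le> (1 - x) ^ n"
    by (simp add: mult.commute flip: exp_of_nat_mult)
  have "1 - x \<le> exp (- x)" using exp_ge_add_one_self[of "- x"] by simp
  then have "(1 - x) ^ n \<le> exp (- x) ^ n" using assms by (intro power_mono) auto
  then show "(1 - x) ^ n \<le> exp (- x * real n)"
    by (simp add: mult.commute flip: exp_of_nat_mult)
qed

context sieve_model
begin

lemma two_theta_mertens: "2 * \<bar>\<theta>\<bar> * mertens_prod w * e = 2 * e / u"
  unfolding abs_of_pos[OF \<theta>(1)] using \<theta>(3) by (simp add: mult.assoc)

text \<open>Jensen with \<open>s = \<theta> + 2 * \<theta> ^ 2\<close>, the price of replacing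
  powers of \<open>1 - \<theta>\<close> by exponentials;
  \<open>\<theta> * mertens_prod w = 1 / u\<close> turns the exponent into
  \<open>m / u\<close>.\<close>

lemma gap_avg_ge: "exp (- (real m / u) * (1 + 2 * \<theta>)) \<le> gap_avg m"
proof -
  have "exp (- (\<theta> + 2 * \<theta>\<^sup>2) * mertens_prod w * real m)
      \<le> avg (\<lambda>T. exp (- (\<theta> + 2 * \<theta>\<^sup>2) * real (card T))) {0..<m}"
    by (rule avg_exp_ge)
  also have "\<dots> \<le> gap_avg m"
    unfolding gap_avg_def avg_def using \<theta> by (intro sieve_avg_mono one_minus_power_exp) auto
  also have "- (\<theta> + 2 * \<theta>\<^sup>2) * mertens_prod w * real m = - (\<theta> * mertens_prod w) * real m * (1 + 2 * \<theta>)"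
    by (simp add: algebra_simps power2_eq_square)
  also have "\<dots> = - (real m / u) * (1 + 2 * \<theta>)" unfolding \<theta>(3) by simp
  finally show ?thesis .
qed

lemma gap_avg_le:
  fixes m r :: nat
  defines "\<kappa> \<equiv> 8 * \<theta> * (real m / real w1 + 1 / mertens_prod w)"
  assumes "\<kappa> \<le> 1"
  shows "gap_avg m \<le> exp (- (real m / u) + (real m / u) * \<kappa> + 2 * brun_error r m / u)"
proof -
  have "gap_avg m \<le> avg (\<lambda>T. exp (- \<theta> * real (card T))) {0..<m}"
    unfolding gap_avg_def avg_def using \<theta> by (intro sieve_avg_mono one_minus_power_exp) auto
  also have "\<dots> \<le> exp (- (\<theta> - \<bar>\<theta>\<bar> * \<kappa>) * mertens_prod w * real m + 2 * \<bar>\<theta>\<bar> * mertens_prod w * brun_error r m)"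
    using avg_exp_le[where s = \<theta> and m = m and r = r] assms \<theta> by (simp add: \<kappa>_def)
  also have "- (\<theta> - \<bar>\<theta>\<bar> * \<kappa>) * mertens_prod w * real m = - (\<theta> * mertens_prod w) * (1 - \<kappa>) * real m"
    unfolding abs_of_pos[OF \<theta>(1)] by (simp add: algebra_simps)
  also have "\<dots> = - (real m / u) + (real m / u) * \<kappa>" unfolding \<theta>(3) by (simp add: algebra_simps diff_divide_distrib)
  finally show ?thesis using two_theta_mertens by simp
qed

text \<open>The moment bound at \<open>s = - \<theta>\<close>. It controls the inclusion-exclusion
  sum taken without signs, by way of \<open>sum_density_le\<close>.\<close>

lemma avg_power_le:
  fixes m r :: nat
  defines "\<kappa> \<equiv> 8 * \<theta> * (real m / real w1 + 1 / mertens_prod w)"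
  assumes "\<kappa> \<le> 1"
  shows "avg (\<lambda>T. (1 + \<theta>) ^ card T) {0..<m} \<le> exp (2 * (real m / u) + 2 * brun_error r m / u)"
proof -
  have "(1 + \<theta>) ^ n \<le> exp (- (- \<theta>) * real n)" for n
  proof -
    have "(1 + \<theta>) ^ n \<le> exp \<theta> ^ n" using \<theta> by (intro power_mono) (auto simp: exp_ge_add_one_self)
    then show ?thesis by (simp add: mult.commute flip: exp_of_nat_mult)
  qed
  then have "avg (\<lambda>T. (1 + \<theta>) ^ card T) {0..<m} \<le> avg (\<lambda>T. exp (- (- \<theta>) * real (card T))) {0..<m}"
    unfolding avg_def by (intro sieve_avg_mono)
  also have "\<dots> \<le> exp (- (- \<theta> - \<bar>- \<theta>\<bar> * \<kappa>) * mertens_prod w * real m + 2 * \<bar>- \<theta>\<bar> * mertens_prod w * brun_error r m)"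
    using avg_exp_le[where s = "- \<theta>" and m = m and r = r] assms \<theta> by (simp add: \<kappa>_def)
  also have "- (- \<theta> - \<bar>- \<theta>\<bar> * \<kappa>) * mertens_prod w * real m = (\<theta> * mertens_prod w) * (1 + \<kappa>) * real m"
    unfolding abs_minus_cancel abs_of_pos[OF \<theta>(1)] by (simp add: algebra_simps)
  also have "\<dots> = (real m / u) * (1 + \<kappa>)" unfolding \<theta>(3) by (simp add: algebra_simps add_divide_distrib)
  also have "\<dots> \<le> (real m / u) * 2" using u assms by (intro mult_left_mono) auto
  finally show ?thesis using two_theta_mertens by (simp add: mult.commute)
qed

text \<open>Given that \<open>T\<close> is the outcome of the sieve, the probability that 0 is kept
  and every other element of \<open>T\<close> is discarded.\<close>

definition first_survives :: "nat set \<Rightarrow> real" where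
  "first_survives T = (if 0 \<in> T then \<theta> * (1 - \<theta>) ^ card (T - {0}) else 0)"

text \<open>For \<open>k\<close> survivors besides 0, write
  \<open>\<theta> * (1 - \<theta>) ^ k\<close> as
  \<open>(1 - \<theta>) ^ k - (1 - \<theta>) ^ Suc k\<close>; translation invariance moves
  \<open>{1..m}\<close> to \<open>{0..<m}\<close>.\<close>

lemma avg_first_survives: "avg first_survives {0..m} = next_gap_avg m"
proof -
  let ?F = "\<lambda>T. (1 - \<theta>) ^ card T"
  have "first_survives T = ?F (T \<inter> {1..m}) - ?F T" if "T \<subseteq> {0..m}" for T
  proof -
    have eq: "T \<inter> {1..m} = T - {0}" using that by auto
    have fin: "finite T" using that finite_subset by blast
    show ?thesis
    proof (cases "0 \<in> T")
      case True
      then have "card T = Suc (card (T - {0}))" using fin by (metis card_Suc_Diff1)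
      then have "?F T = (1 - \<theta>) * ?F (T - {0})" by simp
      then show ?thesis using True unfolding first_survives_def eq by (simp add: left_diff_distrib)
    next
      case False
      then have "T - {0} = T" by auto
      then show ?thesis using False unfolding first_survives_def eq by simp
    qed
  qed
  then have "avg first_survives {0..m} = avg (\<lambda>T. ?F (T \<inter> {1..m}) - ?F T) {0..m}"
    unfolding avg_def by (intro sieve_avg_cong)
  also have "\<dots> = avg ?F ({0..m} \<inter> {1..m}) - avg ?F {0..m}"
    unfolding avg_def sieve_avg_diff sieve_avg_Int[where F = ?F] ..
  also have "{0..m} \<inter> {1..m} = (\<lambda>h. h + 1) ` {0..<m}"
    by (auto simp: image_iff)
  also have "avg ?F ((\<lambda>h. h + 1) ` {0..<m}) = gap_avg m"
    unfolding gap_avg_def avg_def using set_ps prime_gt_0_nat by (intro sieve_avg_shift) blast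
  finally show ?thesis by (simp add: next_gap_avg_def gap_avg_def atLeastLessThanSuc_atLeastAtMost)
qed

text \<open>A longer interval makes the event of an empty gap after 0 rarer.\<close>

lemma next_gap_avg_Suc_le: "next_gap_avg (Suc m) \<le> next_gap_avg m"
proof -
  have "first_survives T \<le> first_survives (T \<inter> {0..m})" if "T \<subseteq> {0..Suc m}" for T
  proof -
    have "finite T" using that finite_subset by blast
    then have "card (T \<inter> {0..m} - {0}) \<le> card (T - {0})" by (intro card_mono) auto
    then show ?thesis using \<theta> by (auto simp: first_survives_def intro!: power_decreasing)
  qed
  then have "avg first_survives {0..Suc m} \<le> avg (\<lambda>T. first_survives (T \<inter> {0..m})) {0..Suc m}"
    unfolding avg_def by (intro sieve_avg_mono)
  also have "\<dots> = avg first_survives ({0..Suc m} \<inter> {0..m})" unfolding avg_def by (rule sieve_avg_Int)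
  also have "{0..Suc m} \<inter> {0..m} = {0..m}" by auto
  finally show ?thesis by (simp add: avg_first_survives)
qed

lemma avg_indicator:
  "finite H \<Longrightarrow> avg (\<lambda>T. of_bool (H \<subseteq> T)) S = of_bool (H \<subseteq> S) * sieve_density w H"
  unfolding avg_def sieve_density_def prod_list_le_sorted_append[OF w1(2), symmetric]
  by (rule sieve_avg_indicator) (auto simp: prime_gt_0_nat)

text \<open>This exact value replaces the averaging argument when \<open>m\<close> is shorter than
  the averaging range.\<close>

lemma next_gap_avg_0: "next_gap_avg 0 = 1 / u"
proof -
  have "next_gap_avg 0 = avg first_survives {0}" using avg_first_survives[of 0] by simp
  also have "\<dots> = avg (\<lambda>T. \<theta> * of_bool ({0} \<subseteq> T)) {0}"
    unfolding avg_def
  proof (rule sieve_avg_cong)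
    fix T :: "nat set" assume "T \<subseteq> {0}"
    then have "T = {} \<or> T = {0}" by auto
    then show "first_survives T = \<theta> * of_bool ({0} \<subseteq> T)" by (auto simp: first_survives_def)
  qed
  also have "\<dots> = \<theta> * sieve_density w {0}"
    using avg_indicator[of "{0}" "{0}"] by (simp add: avg_def sieve_avg_cmult)
  also have "sieve_density w {0} = mertens_prod w" by (simp add: sieve_density_def mertens_prod_def)
  finally show ?thesis by (simp add: \<theta>)
qed

definition truncated_model :: "nat \<Rightarrow> nat \<Rightarrow> real" where
  "truncated_model m K = (\<Sum>H\<in>tuples m K. (-1) ^ card H * \<theta> ^ Suc (card H) * sieve_density w (insert 0 H))"

text \<open>Bonferroni for each outcome \<open>T\<close> separately. The number of survivors is
  bounded only by \<open>m\<close>, which is why the truncation must exceed a multiple of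
  \<open>\<theta> * m\<close>, not merely of \<open>m / u\<close>.\<close>

lemma truncated_model_error:
  "\<bar>next_gap_avg m - truncated_model m K\<bar> \<le> \<theta> * ((\<theta> * real m) ^ Suc K / fact (Suc K))"
proof -
  define G where "G T = (\<Sum>H\<in>tuples m K. ((-1) ^ card H * \<theta> ^ Suc (card H)) * of_bool (insert 0 H \<subseteq> T))" for T :: "nat set"
  have "\<bar>first_survives T - G T\<bar> \<le> \<theta> * ((\<theta> * real m) ^ Suc K / fact (Suc K))" if "T \<subseteq> {0..m}" for T
  proof (cases "0 \<in> T")
    case False
    then show ?thesis using \<theta> by (simp add: first_survives_def G_def)
  next
    case True
    define P where "P = T - {0}"
    have fin: "finite P" using that finite_subset unfolding P_def by blast
    have P: "P \<subseteq> {1..m}" using that by (auto simp: P_def)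
    have cP: "card P \<le> m" using card_mono[OF _ P] by simp
    have ih: "insert 0 H \<subseteq> T \<longleftrightarrow> H \<subseteq> P" if "H \<subseteq> {1..m}" for H
      using that True by (auto simp: P_def)
    have "(\<Sum>H | H \<subseteq> {1..m} \<and> card H = k. ((-1) ^ card H * \<theta> ^ Suc (card H)) * of_bool (insert 0 H \<subseteq> T))
       = \<theta> * ((-1) ^ k * esym (\<lambda>_. \<theta>) P k)" for k
    proof -
      have "(\<Sum>H | H \<subseteq> {1..m} \<and> card H = k. ((-1) ^ card H * \<theta> ^ Suc (card H)) * of_bool (insert 0 H \<subseteq> T))
        = (\<Sum>H | H \<subseteq> {1..m} \<and> card H = k. ((-1) ^ k * \<theta> ^ Suc k) * of_bool (H \<subseteq> P))"
        by (intro sum.cong refl) (simp add: ih del: insert_subset)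
      also have "\<dots> = (\<Sum>H | H \<subseteq> P \<and> card H = k. (-1) ^ k * \<theta> ^ Suc k)"
        using P by (intro sum.mono_neutral_cong_right finite_subsets_card) auto
      finally have "(\<Sum>H | H \<subseteq> {1..m} \<and> card H = k. ((-1) ^ card H * \<theta> ^ Suc (card H)) * of_bool (insert 0 H \<subseteq> T))
        = (\<Sum>H | H \<subseteq> P \<and> card H = k. (-1) ^ k * \<theta> ^ Suc k)" .
      then show ?thesis by (simp add: esym_def)
    qed
    then have G: "G T = \<theta> * (\<Sum>k\<le>K. (-1) ^ k * esym (\<lambda>_. \<theta>) P k)"
      unfolding G_def sum_tuples by (simp only: sum_distrib_left)
    have "\<bar>(\<Prod>p\<in>P. 1 - \<theta>) - (\<Sum>k\<le>K. (-1) ^ k * esym (\<lambda>_. \<theta>) P k)\<bar> \<le> esym (\<lambda>_. \<theta>) P (Suc K)"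
      using \<theta> fin by (intro bonferroni_abs) auto
    also have "\<dots> \<le> (\<Sum>p\<in>P. \<theta>) ^ Suc K / fact (Suc K)" using \<theta> fin by (intro esym_le) auto
    also have "\<dots> \<le> (\<theta> * real m) ^ Suc K / fact (Suc K)"
    proof (intro divide_right_mono power_mono)
      show "(\<Sum>p\<in>P. \<theta>) \<le> \<theta> * real m" using cP \<theta> by (simp add: mult.commute mult_left_mono)
      show "0 \<le> (\<Sum>p\<in>P. \<theta>)" using \<theta> by (intro sum_nonneg) auto
    qed auto
    finally have "\<theta> * \<bar>(\<Prod>p\<in>P. 1 - \<theta>) - (\<Sum>k\<le>K. (-1) ^ k * esym (\<lambda>_. \<theta>) P k)\<bar> \<le> \<theta> * ((\<theta> * real m) ^ Suc K / fact (Suc K))"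
      using \<theta> by (intro mult_left_mono) auto
    moreover have "first_survives T = \<theta> * (\<Prod>p\<in>P. 1 - \<theta>)" using True by (simp add: first_survives_def P_def)
    ultimately show ?thesis using \<theta> unfolding G by (simp add: abs_mult flip: right_diff_distrib)
  qed
  then have "\<bar>avg first_survives {0..m} - avg G {0..m}\<bar> \<le> avg (\<lambda>_. \<theta> * ((\<theta> * real m) ^ Suc K / fact (Suc K))) {0..m}"
    unfolding avg_def by (intro sieve_avg_abs_le)
  also have "\<dots> = \<theta> * ((\<theta> * real m) ^ Suc K / fact (Suc K))"
    unfolding avg_def using set_ps prime_gt_0_nat by (intro sieve_avg_const) blast
  finally show ?thesis
  proof -
    have "avg G {0..m} = (\<Sum>H\<in>tuples m K. (-1) ^ card H * \<theta> ^ Suc (card H) * avg (\<lambda>T. of_bool (insert 0 H \<subseteq> T)) {0..m})"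
      unfolding G_def avg_def by (simp only: sieve_avg_sum sieve_avg_cmult)
    also have "\<dots> = truncated_model m K"
      unfolding truncated_model_def
    proof (intro sum.cong refl)
      fix H assume H: "H \<in> tuples m K"
      then have "insert 0 H \<subseteq> {0..m}" by (auto simp: tuples_def)
      then show "(-1) ^ card H * \<theta> ^ Suc (card H) * avg (\<lambda>T. of_bool (insert 0 H \<subseteq> T)) {0..m} =
         (-1) ^ card H * \<theta> ^ Suc (card H) * sieve_density w (insert 0 H)"
        using finite_in_tuples[OF H] avg_indicator[of "insert 0 H" "{0..m}"] by simp
    qed
    finally show "\<bar>avg first_survives {0..m} - avg G {0..m}\<bar> \<le> \<theta> * ((\<theta> * real m) ^ Suc K / fact (Suc K))
        \<Longrightarrow> ?thesis" by (simp add: avg_first_survives)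
  qed
qed

text \<open>For each outcome \<open>T\<close> the left side counts, with weight
  \<open>\<theta> ^ card\<close>, some of the subsets of \<open>T\<close> that contain 0; all
  subsets together give \<open>(1 + \<theta>) ^ card T\<close>.\<close>

lemma sum_density_le:
  "(\<Sum>H\<in>tuples m K. \<theta> ^ Suc (card H) * sieve_density w (insert 0 H)) \<le> avg (\<lambda>T. (1 + \<theta>) ^ card T) {0..<Suc m}"
proof -
  have "(\<Sum>H\<in>tuples m K. \<theta> ^ Suc (card H) * sieve_density w (insert 0 H)) =
     (\<Sum>H\<in>tuples m K. \<theta> ^ Suc (card H) * avg (\<lambda>T. of_bool (insert 0 H \<subseteq> T)) {0..<Suc m})"
  proof (intro sum.cong refl)
    fix H assume H: "H \<in> tuples m K"
    then have "insert 0 H \<subseteq> {0..<Suc m}" by (auto simp: tuples_def)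
    then show "\<theta> ^ Suc (card H) * sieve_density w (insert 0 H) =
         \<theta> ^ Suc (card H) * avg (\<lambda>T. of_bool (insert 0 H \<subseteq> T)) {0..<Suc m}"
      using finite_in_tuples[OF H] avg_indicator[of "insert 0 H" "{0..<Suc m}"] by simp
  qed
  also have "\<dots> = avg (\<lambda>T. \<Sum>H\<in>tuples m K. \<theta> ^ Suc (card H) * of_bool (insert 0 H \<subseteq> T)) {0..<Suc m}"
    unfolding avg_def by (simp only: sieve_avg_sum sieve_avg_cmult)
  also have "\<dots> \<le> avg (\<lambda>T. (1 + \<theta>) ^ card T) {0..<Suc m}"
    unfolding avg_def
  proof (rule sieve_avg_mono)
    fix T assume "T \<subseteq> {0..<Suc m}"
    then have fin: "finite T" using finite_subset by blast
    have zero: "0 \<notin> H" if "H \<in> tuples m K" for H using that by (auto simp: tuples_def)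
    have "(\<Sum>H\<in>tuples m K. \<theta> ^ Suc (card H) * of_bool (insert 0 H \<subseteq> T)) =
       (\<Sum>H | H \<in> tuples m K \<and> insert 0 H \<subseteq> T. \<theta> ^ card (insert 0 H))"
      by (intro sum.mono_neutral_cong_right)
         (auto simp: card_insert_disjoint finite_in_tuples zero)
    also have "\<dots> = (\<Sum>H\<in>insert 0 ` {H. H \<in> tuples m K \<and> insert 0 H \<subseteq> T}. \<theta> ^ card H)"
      by (rule sum.reindex_cong[symmetric, of "insert 0"]) (auto simp: inj_on_def zero insert_ident)
    also have "\<dots> \<le> (\<Sum>H\<in>Pow T. \<theta> ^ card H)"
      using fin \<theta> by (intro sum_mono2) auto
    also have "\<dots> = (1 + \<theta>) ^ card T" using fin by (rule sum_power_card_Pow)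
    finally show "(\<Sum>H\<in>tuples m K. \<theta> ^ Suc (card H) * of_bool (insert 0 H \<subseteq> T)) \<le> (1 + \<theta>) ^ card T" .
  qed
  finally show ?thesis .
qed

end

definition main_term :: "nat \<Rightarrow> nat \<Rightarrow> real \<Rightarrow> real" where
  "main_term m K u = (\<Sum>H\<in>tuples m K. (-1) ^ card H * singular_series (int ` insert 0 H) / u ^ Suc (card H))"

context sieve_model
begin

text \<open>Since \<open>\<theta> ^ k\<close> is \<open>1 / (mertens_prod w * u) ^ k\<close>, the
  two terms differ only by the factors of the singular series at primes beyond
  \<open>w\<close>.\<close>

lemma singular_series_tuple:
  assumes "H \<in> tuples m K" "m < w" "Suc K \<le> w"
  shows "\<bar>singular_series (int ` insert 0 H) / u ^ Suc (card H) - \<theta> ^ Suc (card H) * sieve_density w (insert 0 H)\<bar>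
     \<le> real (Suc K) ^ 2 / real w * (\<theta> ^ Suc (card H) * sieve_density w (insert 0 H))"
proof -
  define k where "k = Suc (card H)"
  define d where "d = sieve_density w (insert 0 H)"
  define S where "S = singular_series (int ` insert 0 H)"
  define B where "B = d / mertens_prod w ^ k"
  have H: "H \<subseteq> {1..m}" "card H \<le> K" using assms by (auto simp: tuples_def)
  have "0 \<notin> H" using H by auto
  then have k: "card (insert 0 H) = k" using finite_in_tuples[OF assms(1)] by (simp add: k_def)
  have sub: "insert 0 H \<subseteq> {0..m}" using H by auto
  have "k \<le> w" using H assms by (simp add: k_def)
  then have S: "B * (1 - real k ^ 2 / real w) \<le> S" "S \<le> B"
    using singular_series_bounds[OF sub assms(2)] by (simp_all add: k B_def d_def S_def)
  have d: "0 \<le> d" by (simp add: d_def sieve_density_bounds)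
  have B: "0 \<le> B" using d mertens_prod_pos[of w] by (simp add: B_def)
  have Bu: "B / u ^ k = \<theta> ^ k * d"
    by (simp add: B_def \<theta>_def power_divide power_mult_distrib)
  have "real k ^ 2 \<le> real (Suc K) ^ 2" using H by (intro power_mono) (auto simp: k_def)
  then have "B * (real k ^ 2 / real w) \<le> B * (real (Suc K) ^ 2 / real w)"
    using B by (intro mult_left_mono divide_right_mono) auto
  then have "\<bar>S - B\<bar> \<le> B * (real (Suc K) ^ 2 / real w)"
    using S by (simp add: right_diff_distrib)
  then have "\<bar>S - B\<bar> / u ^ k \<le> B * (real (Suc K) ^ 2 / real w) / u ^ k"
    using u by (intro divide_right_mono) auto
  then have "\<bar>S / u ^ k - B / u ^ k\<bar> \<le> real (Suc K) ^ 2 / real w * (B / u ^ k)"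
    using u by (simp add: diff_divide_distrib[symmetric] abs_divide mult.commute)
  then show ?thesis unfolding Bu unfolding S_def d_def k_def .
qed

lemma main_term_truncated_model:
  assumes "m < w" "Suc K \<le> w"
  shows "\<bar>main_term m K u - truncated_model m K\<bar> \<le> real (Suc K) ^ 2 / real w * avg (\<lambda>T. (1 + \<theta>) ^ card T) {0..<Suc m}"
proof -
  have "main_term m K u - truncated_model m K =
    (\<Sum>H\<in>tuples m K. (-1) ^ card H * (singular_series (int ` insert 0 H) / u ^ Suc (card H) - \<theta> ^ Suc (card H) * sieve_density w (insert 0 H)))"
    unfolding main_term_def truncated_model_def sum_subtractf[symmetric]
    by (intro sum.cong refl) (simp add: right_diff_distrib)
  also have "\<bar>\<dots>\<bar> \<le> (\<Sum>H\<in>tuples m K. real (Suc K) ^ 2 / real w * (\<theta> ^ Suc (card H) * sieve_density w (insert 0 H)))"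
    using singular_series_tuple[OF _ assms] by (intro sum_abs[THEN order_trans] sum_mono) (simp add: abs_mult)
  also have "\<dots> \<le> real (Suc K) ^ 2 / real w * avg (\<lambda>T. (1 + \<theta>) ^ card T) {0..<Suc m}"
    unfolding sum_distrib_left[symmetric] by (intro mult_left_mono sum_density_le) auto
  finally show ?thesis .
qed

end

text \<open>A decreasing sequence of differences is squeezed between averages over \<open>D\<close> consecutive terms.
  This turns the asymptotics of \<open>g\<close> into asymptotics of its differences, at the price of a square root
  in the error term.\<close>

lemma difference_asymptotics:
  fixes g :: "nat \<Rightarrow> real" and u \<delta> d :: real and m D :: nat
  assumes dec: "\<And>n. g (Suc n) - g (Suc (Suc n)) \<le> g n - g (Suc n)"
    and zero: "g 0 - g 1 \<le> 1 / u"
    and bounds: "\<And>n. n \<le> m + D \<Longrightarrow> exp (- (real n / u) - \<delta>) \<le> g n \<and> g n \<le> exp (- (real n / u) + \<delta>)"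
    and "0 < u" "0 \<le> \<delta>" "\<delta> \<le> 1" "1 \<le> D" "d = real D / u" "d \<le> 1"
  shows "\<bar>(g m - g (Suc m)) - exp (- (real m / u)) / u\<bar> \<le> exp (- (real m / u)) / u * (2 * d + 7 * \<delta> / d)"
proof -
  define f where "f n = g n - g (Suc n)" for n
  define h where "h = exp (- (real m / u))"
  have d0: "0 < d" using assms by simp
  have Dd: "real D = d * u" using assms by simp
  have anti: "antimono f" unfolding f_def by (rule decseq_SucI) (use dec in auto)
  have tele: "(\<Sum>i<k. f (n + i)) = g n - g (n + k)" for n k
    by (induction k) (auto simp: f_def)
  have h: "h > 0" by (simp add: h_def)
  have e1: "exp \<delta> \<le> 1 + 2 * \<delta>"
  proof -
    have "exp \<delta> \<le> 1 + \<delta> + \<delta>\<^sup>2" using assms by (intro exp_le_quadratic) auto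
    moreover have "\<delta>\<^sup>2 \<le> \<delta>" using assms by (simp add: power2_eq_square mult_left_le)
    ultimately show ?thesis by linarith
  qed
  have e2: "1 - \<delta> \<le> exp (- \<delta>)" using exp_ge_add_one_self[of "- \<delta>"] by simp
  have d1: "d \<le> 1" by fact
  have e3: "exp (- d) \<le> 1 - d + d\<^sup>2" using exp_le_quadratic[of "- d"] d0 d1 by simp
  have e4: "exp d \<le> 1 + d + d\<^sup>2" using exp_le_quadratic[of d] d0 d1 by simp
  have d2: "d\<^sup>2 \<le> d" using mult_left_le[of d d] d0 d1 by (simp add: power2_eq_square)
  have lower: "h * (1 - (2 * d + 7 * \<delta> / d)) \<le> u * f m"
  proof -
    have "h * (d - d\<^sup>2 - 3 * \<delta>) \<le> h * (exp (- \<delta>) - exp (- d) * exp \<delta>)"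
    proof -
      have "exp (- d) * exp \<delta> \<le> (1 - d + d\<^sup>2) * (1 + 2 * \<delta>)" using e1 e3 by (intro mult_mono) (auto intro: order_trans[OF _ e3])
      also have "\<dots> \<le> 1 - d + d\<^sup>2 + 1 * (2 * \<delta>)"
      proof -
        have "(1 - d + d\<^sup>2) * (2 * \<delta>) \<le> 1 * (2 * \<delta>)"
          using d1 d2 assms(5) by (intro mult_right_mono) auto
        then show ?thesis unfolding distrib_left[of "1 - d + d\<^sup>2" 1 "2 * \<delta>"] by simp
      qed
      finally show ?thesis using e2 h by (intro mult_left_mono) auto
    qed
    also have "\<dots> = exp (- (real m / u) - \<delta>) - exp (- (real (m + D) / u) + \<delta>)"
      using assms by (simp add: h_def Dd algebra_simps add_divide_distrib flip: exp_add)
    also have "\<dots> \<le> g m - g (m + D)" using bounds[of m] bounds[of "m + D"] by auto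
    also have "\<dots> = (\<Sum>i<D. f (m + i))" by (simp add: tele)
    also have "\<dots> \<le> (\<Sum>i<D. f m)" by (intro sum_mono antimonoD[OF anti]) auto
    also have "\<dots> = d * (u * f m)" by (simp add: Dd)
    finally have "h * (d - d\<^sup>2 - 3 * \<delta>) / d \<le> u * f m" using d0 by (simp add: field_simps)
    moreover have "h * (d - d\<^sup>2 - 3 * \<delta>) / d = h * (1 - (d + 3 * \<delta> / d))"
      using d0 by (simp add: field_simps power2_eq_square)
    moreover have "h * (1 - (2 * d + 7 * \<delta> / d)) \<le> h * (1 - (d + 3 * \<delta> / d))"
      using h d0 assms(5) by (intro mult_left_mono diff_left_mono add_mono divide_right_mono) auto
    ultimately show ?thesis by linarith
  qed
  have upper: "u * f m \<le> h * (1 + (2 * d + 7 * \<delta> / d))"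
  proof (cases "D \<le> m")
    case True
    have "d * (u * f m) = (\<Sum>i<D. f m)" by (simp add: Dd)
    also have "\<dots> \<le> (\<Sum>i<D. f (m - D + i))" using True by (intro sum_mono antimonoD[OF anti]) auto
    also have "\<dots> = g (m - D) - g m" using True tele[of "m - D" D] by simp
    also have "\<dots> \<le> exp (- (real (m - D) / u) + \<delta>) - exp (- (real m / u) - \<delta>)"
      using conjunct2[OF bounds[of "m - D"]] conjunct1[OF bounds[of m]] by linarith
    also have "\<dots> = h * (exp d * exp \<delta> - exp (- \<delta>))"
      using assms True by (simp add: h_def Dd of_nat_diff algebra_simps diff_divide_distrib flip: exp_add)
    also have "\<dots> \<le> h * (d + d\<^sup>2 + 7 * \<delta>)"
    proof -
      have "exp d * exp \<delta> \<le> (1 + d + d\<^sup>2) * (1 + 2 * \<delta>)" using e1 e4 by (intro mult_mono) (auto intro: order_trans[OF _ e4])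
      also have "\<dots> \<le> 1 + d + d\<^sup>2 + 3 * (2 * \<delta>)"
      proof -
        have "(1 + d + d\<^sup>2) * (2 * \<delta>) \<le> 3 * (2 * \<delta>)"
          using d1 d2 assms(5) by (intro mult_right_mono) auto
        then show ?thesis unfolding distrib_left[of "1 + d + d\<^sup>2" 1 "2 * \<delta>"] by simp
      qed
      finally show ?thesis using e2 h by (intro mult_left_mono) auto
    qed
    finally have "u * f m \<le> h * (d + d\<^sup>2 + 7 * \<delta>) / d" using d0 by (simp add: field_simps)
    also have "\<dots> = h * (1 + (d + 7 * \<delta> / d))" using d0 by (simp add: field_simps power2_eq_square)
    also have "\<dots> \<le> h * (1 + (2 * d + 7 * \<delta> / d))" using h d0 by (intro mult_left_mono add_mono) auto
    finally show ?thesis .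
  next
    \<comment> \<open>There are not \<open>D\<close> terms to the left of \<open>m\<close>. But then
      \<open>m / u\<close> is at most \<open>d\<close>, and the bound
      \<open>f m \<le> f 0 \<le> 1 / u\<close> loses no more than a factor
      \<open>exp d\<close>.\<close>
    case False
    have "f m \<le> f 0" by (rule antimonoD[OF anti]) simp
    then have "u * f m \<le> u * (1 / u)" using zero assms by (intro mult_left_mono) (auto simp: f_def)
    also have "\<dots> = 1" using assms by simp
    also have "\<dots> \<le> h * exp d"
    proof -
      have "real m / u \<le> d" using False assms by (simp add: divide_right_mono)
      then show ?thesis by (simp add: h_def flip: exp_add)
    qed
    also have "\<dots> \<le> h * (1 + (2 * d + 7 * \<delta> / d))"
    proof (intro mult_left_mono)
      have "0 \<le> 7 * \<delta> / d" using assms d0 by simp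
      then show "exp d \<le> 1 + (2 * d + 7 * \<delta> / d)" using e4 d2 by linarith
    qed (use h in auto)
    finally show ?thesis .
  qed
  have "\<bar>u * f m - h\<bar> \<le> h * (2 * d + 7 * \<delta> / d)"
    using lower upper by (simp add: abs_le_iff algebra_simps)
  then have "\<bar>u * f m - h\<bar> / u \<le> h * (2 * d + 7 * \<delta> / d) / u" using assms by (intro divide_right_mono) auto
  moreover have "f m - h / u = (u * f m - h) / u" using assms(4) by (simp add: diff_divide_distrib)
  ultimately have "\<bar>f m - h / u\<bar> \<le> h / u * (2 * d + 7 * \<delta> / d)"
    using assms(4) by (simp add: abs_divide)
  then show ?thesis by (simp add: f_def h_def)
qed

section \<open>Choice of parameters\<close>

text \<open>The \<open>n\<close>-th term of the series of \<open>exp n\<close> is at most its sum,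
  that is, \<open>fact n\<close> is at least \<open>(n / exp 1) ^ n\<close>.\<close>

lemma power_div_fact_le:
  fixes a :: real
  assumes "0 \<le> a" "0 < n"
  shows "a ^ n / fact n \<le> (exp 1 * a / real n) ^ n"
proof -
  have s: "(\<lambda>k. real n ^ k /\<^sub>R fact k) sums exp (real n)" by (rule exp_converges)
  have "(\<Sum>k\<in>{n}. real n ^ k /\<^sub>R fact k) \<le> (\<Sum>k. real n ^ k /\<^sub>R fact k)"
    using s by (intro sum_le_suminf) (auto simp: sums_iff)
  then have "real n ^ n / fact n \<le> exp (real n)" using s by (simp add: sums_iff divide_inverse_commute)
  then have "(a / real n) ^ n * (real n ^ n / fact n) \<le> (a / real n) ^ n * exp (real n)"
    using assms by (intro mult_left_mono) auto
  moreover have "(a / real n) ^ n * (real n ^ n / fact n) = a ^ n / fact n"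
    using assms by (simp add: power_divide)
  moreover have "(a / real n) ^ n * exp (real n) = (exp 1 * a / real n) ^ n"
    by (simp add: power_divide power_mult_distrib exp_of_nat_mult[symmetric] mult.commute)
  ultimately show ?thesis by simp
qed

context sieve_model
begin

lemma brun_error_mono: "n \<le> M \<Longrightarrow> brun_error r n \<le> brun_error r M"
  unfolding brun_error_def using mertens_prod_pos[of w1]
  by (intro divide_right_mono add_mono mult_right_mono mult_left_mono) (auto intro!: divide_nonneg_nonneg zero_le_power sum_nonneg simp del: power_Suc)

text \<open>\<open>M\<close> bounds every interval length that occurs, so \<open>\<kappa>\<close>
  and the Brun error are computed once, at \<open>M\<close>. The three errors come from the
  differences of \<open>gap_avg\<close>, from the truncation at \<open>K\<close>, and from the
  primes beyond \<open>w\<close>.\<close>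

lemma main_term_close:
  fixes m D K r M :: nat and \<delta> :: real
  defines "\<kappa> \<equiv> 8 * \<theta> * (real M / real w1 + 1 / mertens_prod w)"
  assumes "\<kappa> \<le> 1" and d1: "real M / u * \<kappa> + 2 * brun_error r M / u \<le> \<delta>" and d2: "real M / u * (2 * \<theta>) \<le> \<delta>"
    and "\<delta> \<le> 1" "1 \<le> D" "m + D \<le> M" "real D / u \<le> 1" "M < w" "Suc K \<le> w"
  shows "\<bar>main_term m K u - exp (- (real m / u)) / u\<bar> \<le>
     exp (- (real m / u)) / u * (2 * (real D / u) + 7 * \<delta> / (real D / u))
     + \<theta> * ((\<theta> * real m) ^ Suc K / fact (Suc K))
     + real (Suc K) ^ 2 / real w * exp (2 * (real M / u) + 1)"
proof -
  have \<kappa>n: "8 * \<theta> * (real n / real w1 + 1 / mertens_prod w) \<le> \<kappa>" if "n \<le> M" for n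
    unfolding \<kappa>_def using that \<theta> mertens_prod_pos[of w]
    by (intro mult_left_mono add_mono divide_right_mono) auto
  have \<kappa>0: "0 \<le> \<kappa>" using \<theta> mertens_prod_pos[of w] by (simp add: \<kappa>_def)
  have \<delta>0: "0 \<le> \<delta>" using d2 \<theta> u by (meson divide_nonneg_pos mult_nonneg_nonneg of_nat_0_le_iff order_trans zero_le_numeral less_imp_le)
  have bnd: "exp (- (real n / u) - \<delta>) \<le> gap_avg n \<and> gap_avg n \<le> exp (- (real n / u) + \<delta>)" if n: "n \<le> M" for n
  proof
    have nM: "real n / u \<le> real M / u" using n u by (intro divide_right_mono) auto
    have "real n / u * (2 * \<theta>) \<le> real M / u * (2 * \<theta>)" using nM \<theta> by (intro mult_right_mono) auto
    with d2 have "- (real n / u) - \<delta> \<le> - (real n / u) * (1 + 2 * \<theta>)" by (simp only: distrib_left)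
    then show "exp (- (real n / u) - \<delta>) \<le> gap_avg n" using gap_avg_ge[of n] by (meson exp_le_cancel_iff order_trans)
    have "real n / u * (8 * \<theta> * (real n / real w1 + 1 / mertens_prod w)) \<le> real M / u * \<kappa>"
      using nM \<kappa>n[OF n] \<theta> u mertens_prod_pos[of w] by (intro mult_mono) auto
    moreover have "2 * brun_error r n / u \<le> 2 * brun_error r M / u"
      using brun_error_mono[OF n, of r] u by (intro divide_right_mono) auto
    ultimately have "- (real n / u) + real n / u * (8 * \<theta> * (real n / real w1 + 1 / mertens_prod w)) + 2 * brun_error r n / u
        \<le> - (real n / u) + \<delta>" using d1 by linarith
    moreover have "gap_avg n \<le> exp (- (real n / u) + real n / u * (8 * \<theta> * (real n / real w1 + 1 / mertens_prod w)) + 2 * brun_error r n / u)"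
      using \<kappa>n[OF n] assms(2) by (intro gap_avg_le) auto
    ultimately show "gap_avg n \<le> exp (- (real n / u) + \<delta>)" by (meson exp_le_cancel_iff order_trans)
  qed
  have 1: "\<bar>next_gap_avg m - exp (- (real m / u)) / u\<bar> \<le>
     exp (- (real m / u)) / u * (2 * (real D / u) + 7 * \<delta> / (real D / u))"
    unfolding next_gap_avg_def
  proof (rule difference_asymptotics)
    show "gap_avg (Suc n) - gap_avg (Suc (Suc n)) \<le> gap_avg n - gap_avg (Suc n)" for n
      using next_gap_avg_Suc_le[of n] by (simp add: next_gap_avg_def)
    show "gap_avg 0 - gap_avg 1 \<le> 1 / u" using next_gap_avg_0 by (simp add: next_gap_avg_def)
    show "exp (- (real n / u) - \<delta>) \<le> gap_avg n \<and> gap_avg n \<le> exp (- (real n / u) + \<delta>)" if "n \<le> m + D" for n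
      using that assms(7) by (intro bnd) auto
  qed (use u \<delta>0 assms in auto)
  have 2: "\<bar>next_gap_avg m - truncated_model m K\<bar> \<le> \<theta> * ((\<theta> * real m) ^ Suc K / fact (Suc K))"
    by (rule truncated_model_error)
  have mM: "Suc m \<le> M" using assms by auto
  have "\<bar>main_term m K u - truncated_model m K\<bar> \<le> real (Suc K) ^ 2 / real w * avg (\<lambda>T. (1 + \<theta>) ^ card T) {0..<Suc m}"
    using mM assms by (intro main_term_truncated_model) auto
  also have "\<dots> \<le> real (Suc K) ^ 2 / real w * exp (2 * (real M / u) + 1)"
  proof (intro mult_left_mono)
    have "2 * (real (Suc m) / u) \<le> 2 * (real M / u)" using mM u by (intro mult_left_mono divide_right_mono) auto
    moreover have "2 * brun_error r (Suc m) / u \<le> 2 * brun_error r M / u"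
      using brun_error_mono[OF mM, of r] u by (intro divide_right_mono) auto
    moreover have "0 \<le> real M / u * \<kappa>" using \<kappa>0 u by simp
    ultimately have "2 * (real (Suc m) / u) + 2 * brun_error r (Suc m) / u \<le> 2 * (real M / u) + 1"
      using d1 assms(5) by linarith
    moreover have "avg (\<lambda>T. (1 + \<theta>) ^ card T) {0..<Suc m} \<le> exp (2 * (real (Suc m) / u) + 2 * brun_error r (Suc m) / u)"
      using \<kappa>n[OF mM] assms(2) by (intro avg_power_le) auto
    ultimately show "avg (\<lambda>T. (1 + \<theta>) ^ card T) {0..<Suc m} \<le> exp (2 * (real M / u) + 1)"
      by (meson exp_le_cancel_iff order_trans)
  qed auto
  finally show ?thesis using 1 2 by linarith
qed

end

text \<open>In terms of \<open>y = log\<^sub>2 x\<close>, \<open>exp (log_lambda y)\<close> is \<open>\<lambda>'(x)\<close>.\<close>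

definition log_lambda :: "real \<Rightarrow> real" where
  "log_lambda y = sqrt (y * ln y / 7)"

text \<open>0.378 slightly exceeds \<open>1 / sqrt 7\<close>, and is still small enough for the
  strict inequalities between exponents that follow.\<close>

lemma log_lambda_le: "y \<ge> 1 \<Longrightarrow> log_lambda y \<le> 378/1000 * sqrt (y * ln y)"
proof -
  assume "y \<ge> 1"
  then have G0: "sqrt (y * ln y) \<ge> 0" by simp
  have "1 / (378/1000 :: real) \<le> sqrt 7" by (rule real_le_rsqrt) (simp add: power2_eq_square)
  then have "1 / sqrt 7 \<le> (378/1000 :: real)" by (simp add: field_simps)
  then have "1 / sqrt 7 * sqrt (y * ln y) \<le> 378/1000 * sqrt (y * ln y)" using G0 by (intro mult_right_mono)
  then show ?thesis by (simp add: log_lambda_def real_sqrt_divide)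
qed

text \<open>The truncation level \<open>\<lambda>' powr (5/2)\<close>. The exponent must exceed
  2.06, that of \<open>\<theta> * m\<close>, and stay below \<open>sqrt 7\<close>, that of
  \<open>\<psi>\<close>.\<close>

definition max_tuple :: "real \<Rightarrow> nat" where
  "max_tuple y = nat \<lceil>exp (5 / 2 * log_lambda y)\<rceil>"

text \<open>A multiple of \<open>sqrt (y / ln y)\<close>. The factor 0.82 lies between
  \<open>2 * 1.01 * 0.378 = 0.764\<close>, needed to make the factorial term small, and
  \<open>1 / (3.1 * 0.378) = 0.853\<close>, needed to keep \<open>w1 ^ r\<close> below
  \<open>log x\<close>.\<close>

definition brun_level :: "real \<Rightarrow> real" where
  "brun_level y = 82 / 100 * y / sqrt (y * ln y)"

text \<open>The constant \<open>1 / \<surd>7\<close> enters here: Brun's sieve with all primes up to \<open>\<lambda>' powr 3.1\<close> has relative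
  error less than \<open>\<lambda>' powr (-1.01)\<close> on intervals of length about \<open>log x\<close>, because
  \<open>0.378 \<ge> 1 / \<surd>7\<close> satisfies \<open>3.1 * 0.378 * 0.82 < 1\<close> and \<open>1.01 * 0.378 < 0.82 / 2\<close>.\<close>

lemma eventually_parameters:
  fixes C1 C2 :: real
  shows "\<forall>\<^sub>F y in at_top.
    C1 * (10 * exp (log_lambda y) + 1) powr (20/19) \<le> exp (106/100 * log_lambda y) \<and>
    C1 * (31/10 * log_lambda y) powr (20/19) \<le> exp (1/100 * log_lambda y) \<and>
    C2 + 20/19 * ln (31/10 * log_lambda y) \<le> ln y \<and>
    256 * exp (- 4/100 * log_lambda y) + 64 * exp (312/100 * log_lambda y) * exp (- y) \<le> 1/4 * (1 / y ^ 20) \<and>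
    ln 16 + 101/100 * (378/1000 * sqrt (y * ln y)) + brun_level y * (1 + ln (ln y) - ln (brun_level y)) \<le> - ln 4 - 20 * ln y \<and>
    ln 4 + 1/100 * sqrt (y * ln y) - y + (31/10 * (378/1000 * sqrt (y * ln y)) + ln 2) * (brun_level y + 1) \<le> - ln 4 - 20 * ln y \<and>
    exp (- exp (5/2 * log_lambda y)) \<le> 1 / y ^ 10 * (exp (- 2 * exp (log_lambda y)) * exp (- y)) \<and>
    (exp (5/2 * log_lambda y) + 2)\<^sup>2 * exp (9 - 6 * exp (log_lambda y)) \<le> 1 / y ^ 10 * (exp (- 2 * exp (log_lambda y)) * exp (- y)) \<and>
    exp (log_lambda y) \<ge> 100 \<and> y \<ge> 100 \<and> 2 * y ^ 10 \<le> exp y \<and>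
    exp (106/100 * log_lambda y) * 4 \<le> exp y \<and>
    16 * exp (206/100 * log_lambda y - y) \<le> 1 / y ^ 20 \<and>
    2 * exp 1 * exp (206/100 * log_lambda y) \<le> exp (5/2 * log_lambda y - 1) \<and>
    2 * exp (log_lambda y + y) < exp (10 * exp (log_lambda y)) \<and>
    exp (5/2 * log_lambda y) + 3 \<le> exp (10 * exp (log_lambda y)) \<and>
    exp 1 * ln y \<le> brun_level y"
  unfolding log_lambda_def brun_level_def eventually_conj_iff
  by (intro conjI; real_asymp)

text \<open>The range of \<open>u\<close> is that of \<open>ln t\<close> for \<open>t\<close>
  between the square root of \<open>x\<close> and \<open>x\<close>, where
  \<open>x = exp (exp y)\<close>. The constant is \<open>15 = (2 * 3 + 7) + 1 + 1\<close>:
  differences, truncation, primes beyond \<open>w\<close>.\<close>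

lemma main_term_asymptotics:
  "\<forall>\<^sub>F y in at_top. \<forall>u m. exp y / 2 \<le> u \<longrightarrow> u \<le> exp y \<longrightarrow> real m \<le> exp (log_lambda y) * exp y \<longrightarrow>
     \<bar>main_term m (max_tuple y) u - exp (- (real m / u)) / u\<bar> \<le> 15 / y ^ 10 * (exp (- (real m / u)) / u)"
proof -
  obtain C1 where C1: "C1 > 0" "\<And>N. N \<ge> 2 \<Longrightarrow> 1 / mertens_prod N \<le> C1 * ln (real N) powr (20 / 19)"
    using inverse_mertens_prod_le by blast
  obtain C2 where C2: "\<And>N. N \<ge> 2 \<Longrightarrow> (\<Sum>p\<in>primes_upto N. 1 / real p) \<le> C2 + 20 / 19 * ln (ln (real N))"
    using sum_inverse_primes_le by blast
  from eventually_parameters[of C1 C2] show ?thesis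
  proof eventually_elim
  case (elim y)
  show ?case
  proof (intro allI impI)
    fix u :: real and m :: nat
    assume u: "exp y / 2 \<le> u" "u \<le> exp y" and m: "real m \<le> exp (log_lambda y) * exp y"
    define g where "g = log_lambda y"
    define \<Lambda> where "\<Lambda> = exp g"
    define L where "L = exp y"
    define \<rho> where "\<rho> = brun_level y"
    note p = elim[folded g_def \<rho>_def, folded \<Lambda>_def L_def]
    have p1: "C1 * (10 * \<Lambda> + 1) powr (20/19) \<le> exp (106/100 * g)"
      and p2: "C1 * (31/10 * g) powr (20/19) \<le> exp (1/100 * g)"
      and p3: "C2 + 20/19 * ln (31/10 * g) \<le> ln y"
      and p4: "256 * exp (- 4/100 * g) + 64 * exp (312/100 * g) * exp (- y) \<le> 1/4 * (1 / y ^ 20)"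
      and p5: "ln 16 + 101/100 * (378/1000 * sqrt (y * ln y)) + \<rho> * (1 + ln (ln y) - ln \<rho>) \<le> - ln 4 - 20 * ln y"
      and p6: "ln 4 + 1/100 * sqrt (y * ln y) - y + (31/10 * (378/1000 * sqrt (y * ln y)) + ln 2) * (\<rho> + 1) \<le> - ln 4 - 20 * ln y"
      and p7: "exp (- exp (5/2 * g)) \<le> 1 / y ^ 10 * (exp (- 2 * \<Lambda>) * exp (- y))"
      and p8: "(exp (5/2 * g) + 2)\<^sup>2 * exp (9 - 6 * \<Lambda>) \<le> 1 / y ^ 10 * (exp (- 2 * \<Lambda>) * exp (- y))"
      and p9: "\<Lambda> \<ge> 100" and p10: "y \<ge> 100" and p11: "2 * y ^ 10 \<le> L"
      and p12: "exp (106/100 * g) * 4 \<le> L"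
      and p13: "16 * exp (206/100 * g - y) \<le> 1 / y ^ 20"
      and p14: "2 * exp 1 * exp (206/100 * g) \<le> exp (5/2 * g - 1)"
      and p15: "2 * exp (g + y) < exp (10 * \<Lambda>)"
      and p16: "exp (5/2 * g) + 3 \<le> exp (10 * \<Lambda>)"
      and p17: "exp 1 * ln y \<le> \<rho>"
      using p by blast+
    have L: "L > 0" "exp (- y) = 1 / L" by (simp_all add: L_def exp_minus inverse_eq_divide)
    have u': "L / 2 \<le> u" "u \<le> L" "u > 0" using u L(1) unfolding L_def[symmetric] by linarith+
    have m': "real m \<le> \<Lambda> * L" using m by (simp add: \<Lambda>_def g_def L_def)
    have lny: "ln y \<ge> 1" using p10 exp_le by (subst ln_ge_iff) auto
    have y20: "1 / y ^ 20 \<le> 1" using p10 by (simp add: one_le_power)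
    have y10: "1 / y ^ 10 \<le> 1 / 100"
    proof -
      have "y ^ 1 \<le> y ^ 10" using p10 by (intro power_increasing) auto
      then show ?thesis using p10 by (intro frac_le) auto
    qed
    have L2: "L \<ge> 100"
    proof -
      have "y ^ 1 \<le> y ^ 10" using p10 by (intro power_increasing) auto
      then show ?thesis using p10 p11 by simp
    qed
    have g1: "g \<ge> 1"
    proof -
      have "exp (1::real) \<le> exp g" using p9 exp_le unfolding \<Lambda>_def by linarith
      then show ?thesis by simp
    qed
    define G where "G = sqrt (y * ln y)"
    have G0: "G \<ge> 0" using p10 by (simp add: G_def)
    have gG: "g \<le> 378/1000 * G"
      unfolding g_def G_def using p10 by (intro log_lambda_le) auto
    \<comment> \<open>The primes beyond \<open>w\<close> cost at most
      \<open>(K + 1) ^ 2 / w * exp (4 * \<Lambda> + 9)\<close>, to be compared with a main term of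
      size at least \<open>exp (- 2 * \<Lambda>) / L\<close>; this works because
      \<open>10 > 4 + 2\<close>.\<close>
    define w where "w = nat \<lceil>exp (10 * \<Lambda>)\<rceil>"
    \<comment> \<open>In \<open>M / u * \<kappa>\<close> a power 1 of \<open>\<Lambda>\<close> comes
      from \<open>M / u\<close>, 1.06 from \<open>\<theta> * L\<close> and 1 from
      \<open>M / L\<close>; so \<open>w1\<close> needs an exponent above 3.06.\<close>
    define w1 where "w1 = nat \<lfloor>exp (31/10 * g)\<rfloor>"
    define r where "r = nat \<lfloor>\<rho>\<rfloor>"
    \<comment> \<open>\<open>D / u\<close> has the order of \<open>1 / y ^ 10\<close>, the square
      root of \<open>\<delta> = 1 / y ^ 20\<close>, which balances the errors \<open>d\<close> and
      \<open>\<delta> / d\<close> of \<open>difference_asymptotics\<close>.\<close>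
    define D where "D = nat \<lceil>L / y ^ 10\<rceil>"
    define M where "M = nat \<lceil>(\<Lambda> + 1) * L\<rceil>"
    define K where "K = max_tuple y"
    define \<delta> where "\<delta> = 1 / y ^ 20"
    define v where "v = 1 / mertens_prod w"
    define v1 where "v1 = 1 / mertens_prod w1"
    have w: "exp (10 * \<Lambda>) \<le> real w" "real w \<le> exp (10 * \<Lambda>) + 1"
    proof -
      have "exp (10 * \<Lambda>) \<ge> 0" by simp
      then show "exp (10 * \<Lambda>) \<le> real w" "real w \<le> exp (10 * \<Lambda>) + 1" unfolding w_def by linarith+
    qed
    have w1b: "exp (31/10 * g) - 1 \<le> real w1" "real w1 \<le> exp (31/10 * g)"
    proof -
      have "exp (31/10 * g) \<ge> 0" by simp
      then show "exp (31/10 * g) - 1 \<le> real w1" "real w1 \<le> exp (31/10 * g)" unfolding w1_def by linarith+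
    qed
    have r: "\<rho> \<le> real (Suc r)" "real (Suc r) \<le> \<rho> + 1"
    proof -
      have "\<rho> \<ge> 0" using p17 lny by (meson exp_ge_zero mult_nonneg_nonneg order_trans zero_le_one)
      then show "\<rho> \<le> real (Suc r)" "real (Suc r) \<le> \<rho> + 1" unfolding r_def by linarith+
    qed
    have D: "L / y ^ 10 \<le> real D" "real D \<le> L / y ^ 10 + 1"
    proof -
      have "L / y ^ 10 \<ge> 0" using L p10 by simp
      then show "L / y ^ 10 \<le> real D" "real D \<le> L / y ^ 10 + 1" unfolding D_def by linarith+
    qed
    have M: "(\<Lambda> + 1) * L \<le> real M" "real M \<le> (\<Lambda> + 1) * L + 1"
    proof -
      have "(\<Lambda> + 1) * L \<ge> 0" using L p9 by simp
      then show "(\<Lambda> + 1) * L \<le> real M" "real M \<le> (\<Lambda> + 1) * L + 1" unfolding M_def by linarith+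
    qed
    have K: "exp (5/2 * g) \<le> real K" "real K \<le> exp (5/2 * g) + 1"
    proof -
      have "exp (5/2 * g) \<ge> 0" by simp
      then show "exp (5/2 * g) \<le> real K" "real K \<le> exp (5/2 * g) + 1"
        unfolding K_def max_tuple_def g_def[symmetric] by linarith+
    qed
    have e31: "exp (31/10 * g) \<ge> 4"
    proof -
      have "exp (31/10 * g) \<ge> 1 + 31/10 * g" by (rule exp_ge_add_one_self)
      then show ?thesis using g1 by linarith
    qed
    have w12: "w1 \<ge> 2" "real w1 \<ge> exp (31/10 * g) / 2" using w1b e31 by linarith+
    have w1w: "w1 \<le> w"
    proof -
      have "1 + g \<le> \<Lambda>" unfolding \<Lambda>_def by (rule exp_ge_add_one_self)
      then have "31/10 * g \<le> 10 * \<Lambda>" using g1 by linarith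
      then have "exp (31/10 * g) \<le> exp (10 * \<Lambda>)" by simp
      then have "real w1 \<le> real w" using w w1b by linarith
      then show ?thesis by simp
    qed
    have v: "v \<le> exp (106/100 * g)" "v \<ge> 1"
    proof -
      have "real w \<le> exp (10 * \<Lambda>) * exp 1"
      proof -
        have "exp (10 * \<Lambda>) * 2 \<le> exp (10 * \<Lambda>) * exp 1"
          using exp_ge_add_one_self[of 1] by (intro mult_left_mono) auto
        moreover have "1 + 10 * \<Lambda> \<le> exp (10 * \<Lambda>)" by (rule exp_ge_add_one_self)
        ultimately show ?thesis using w p9 by linarith
      qed
      then have "ln (real w) \<le> ln (exp (10 * \<Lambda> + 1))" using w12 w1w by (subst ln_le_cancel_iff) (auto simp: exp_add)
      then have "ln (real w) powr (20/19) \<le> (10 * \<Lambda> + 1) powr (20/19)"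
        using w12 w1w by (intro powr_mono2) auto
      then have "C1 * ln (real w) powr (20/19) \<le> C1 * (10 * \<Lambda> + 1) powr (20/19)"
        using C1 by (intro mult_left_mono) auto
      then show "v \<le> exp (106/100 * g)" using C1(2)[of w] w12 w1w p1 by (simp add: v_def)
      show "v \<ge> 1" using mertens_prod_pos[of w] mertens_prod_le_1[of w] by (simp add: v_def)
    qed
    have lnw1: "ln (real w1) \<le> 31/10 * g"
    proof -
      have "ln (real w1) \<le> ln (exp (31/10 * g))" using w12 w1b by (subst ln_le_cancel_iff) auto
      then show ?thesis by simp
    qed
    have v1: "v1 \<le> exp (1/100 * g)" "v1 \<ge> 0"
    proof -
      have "ln (real w1) powr (20/19) \<le> (31/10 * g) powr (20/19)"
        using w12 lnw1 by (intro powr_mono2) auto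
      then have "C1 * ln (real w1) powr (20/19) \<le> C1 * (31/10 * g) powr (20/19)"
        using C1 by (intro mult_left_mono) auto
      then show "v1 \<le> exp (1/100 * g)" using C1(2)[of w1] w12 p2 by (simp add: v1_def)
      show "v1 \<ge> 0" using mertens_prod_pos[of w1] by (simp add: v1_def)
    qed
    define B where "B = (\<Sum>p\<in>primes_upto w1. 1 / real p)"
    have B: "0 \<le> B" "B \<le> ln y"
    proof -
      show "0 \<le> B" unfolding B_def by (intro sum_nonneg) auto
      have "ln (real w1) > 0" using w12 by simp
      then have "ln (ln (real w1)) \<le> ln (31/10 * g)" using lnw1 by (subst ln_le_cancel_iff) auto
      then show "B \<le> ln y" using C2[of w1] w12 p3 by (simp add: B_def)
    qed
    have half: "1 / (mertens_prod w * u) \<le> 1/2" and th: "1 / (mertens_prod w * u) \<le> 2 * exp (106/100 * g) / L"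
    proof -
      have eq: "1 / (mertens_prod w * u) = v / u" by (simp add: v_def)
      have "v / u \<le> exp (106/100 * g) / (L / 2)"
        using v u' L by (intro frac_le) auto
      then show "1 / (mertens_prod w * u) \<le> 2 * exp (106/100 * g) / L" using eq by (simp add: field_simps)
      also have "\<dots> \<le> 1/2" using p12 L by (simp add: field_simps)
      finally show "1 / (mertens_prod w * u) \<le> 1/2" .
    qed
    interpret sieve_model w1 w u
      by unfold_locales (use w12 w1w u' half in auto)
    have \<theta>': "\<theta> \<le> 2 * exp (106/100 * g) / L" using th by (simp add: \<theta>_def)
    have MuL: "real M \<le> 2 * \<Lambda> * L" "real M / u \<le> 2 * \<Lambda> + 4" "1 \<le> real M / u"
    proof -
      have Mle: "real M \<le> (\<Lambda> + 2) * L" using M L2 by (simp add: algebra_simps)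
      have "(\<Lambda> + 2) * L \<le> 2 * \<Lambda> * L" using p9 L by (intro mult_right_mono) auto
      with Mle show "real M \<le> 2 * \<Lambda> * L" by simp
      have "real M / u \<le> ((\<Lambda> + 2) * L) / (L / 2)" using Mle u' L p9 by (intro frac_le) auto
      also have "\<dots> = 2 * \<Lambda> + 4" using L by (simp add: field_simps)
      finally show "real M / u \<le> 2 * \<Lambda> + 4" .
      have "1 * L \<le> (\<Lambda> + 1) * L" using p9 L by (intro mult_right_mono) auto
      then have "u \<le> real M" using M u' by linarith
      then show "1 \<le> real M / u" using u' by simp
    qed
    have Mu4: "real M / u \<le> 4 * \<Lambda>" using MuL p9 by linarith

    \<comment> \<open>Second-order loss of the exponential moments\<close>
    define \<kappa> where "\<kappa> = 8 * \<theta> * (real M / real w1 + 1 / mertens_prod w)"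
    have \<kappa>: "real M / u * \<kappa> \<le> 1/4 * \<delta>"
    proof -
      have "real M / real w1 \<le> (2 * \<Lambda> * L) / (exp (31/10 * g) / 2)"
        using MuL w12 p9 L by (intro frac_le) auto
      then have "real M / real w1 + 1 / mertens_prod w \<le> 4 * \<Lambda> * L / exp (31/10 * g) + exp (106/100 * g)"
        using v by (simp add: v_def)
      then have "\<kappa> \<le> 8 * (2 * exp (106/100 * g) / L) * (4 * \<Lambda> * L / exp (31/10 * g) + exp (106/100 * g))"
        unfolding \<kappa>_def using \<theta> \<theta>' mertens_prod_pos[of w] L by (intro mult_mono) auto
      then have "real M / u * \<kappa> \<le> 4 * \<Lambda> * (8 * (2 * exp (106/100 * g) / L) * (4 * \<Lambda> * L / exp (31/10 * g) + exp (106/100 * g)))"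
        using Mu4 p9 \<theta> mertens_prod_pos[of w] by (intro mult_mono) (auto simp: \<kappa>_def)
      also have "\<dots> = 256 * (exp (106/100 * g) * \<Lambda> * \<Lambda> / exp (31/10 * g)) + 64 * (\<Lambda> * exp (106/100 * g) * exp (106/100 * g)) * (1 / L)"
        using L by (simp add: field_simps)
      also have "exp (106/100 * g) * \<Lambda> * \<Lambda> / exp (31/10 * g) = exp (- 4/100 * g)"
        by (simp add: \<Lambda>_def flip: exp_add exp_diff)
      also have "\<Lambda> * exp (106/100 * g) * exp (106/100 * g) = exp (312/100 * g)"
        by (simp add: \<Lambda>_def flip: exp_add)
      finally show ?thesis using p4 by (simp add: L \<delta>_def)
    qed
    have \<kappa>0: "\<kappa> \<ge> 0" using \<theta> mertens_prod_pos[of w] by (simp add: \<kappa>_def)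
    have \<kappa>1: "\<kappa> \<le> 1"
    proof -
      have "1 * \<kappa> \<le> real M / u * \<kappa>" using MuL \<kappa>0 by (intro mult_right_mono) auto
      then show ?thesis using \<kappa> y20 by (simp add: \<delta>_def)
    qed

    \<comment> \<open>Error of Brun's sieve\<close>
    have e20: "exp (- ln 4 - 20 * ln y) = 1/4 * (1 / y ^ 20)"
    proof -
      have "exp (20 * ln y) = y ^ 20" using p10 exp_of_nat_mult[of 20 "ln y"] by simp
      then show ?thesis by (simp add: exp_diff exp_minus)
    qed
    have \<rho>0: "\<rho> > 0" using p17 lny by (meson exp_gt_zero less_le_trans mult_pos_pos zero_less_one)
    have Br: "16 * exp (101/100 * g) * (B ^ Suc r / fact (Suc r)) \<le> 1/4 * \<delta>"
    proof -
      \<comment> \<open>By \<open>p17\<close> this is at most 1, so the exponent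
        \<open>Suc r\<close> may be lowered to the real number \<open>\<rho>\<close>.\<close>
      define b where "b = exp 1 * ln y / \<rho>"
      have b: "0 < b" "b \<le> 1" using p17 lny \<rho>0 by (auto simp: b_def)
      have "B ^ Suc r / fact (Suc r) \<le> (exp 1 * B / real (Suc r)) ^ Suc r"
        using B by (intro power_div_fact_le) auto
      also have "\<dots> \<le> b ^ Suc r"
        unfolding b_def using B r \<rho>0 by (intro power_mono frac_le mult_left_mono) auto
      also have "\<dots> = b powr real (Suc r)" using b by (simp add: powr_realpow del: power_Suc of_nat_Suc)
      also have "\<dots> \<le> b powr \<rho>" using b r by (intro powr_mono') auto
      also have "\<dots> = exp (\<rho> * (1 + ln (ln y) - ln \<rho>))"
        using b \<rho>0 lny by (simp add: powr_def b_def ln_div ln_mult)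
      finally have "16 * exp (101/100 * g) * (B ^ Suc r / fact (Suc r)) \<le> 16 * exp (101/100 * g) * exp (\<rho> * (1 + ln (ln y) - ln \<rho>))"
        by (intro mult_left_mono) auto
      also have "\<dots> = exp (ln 16 + 101/100 * g + \<rho> * (1 + ln (ln y) - ln \<rho>))"
        by (simp add: exp_add)
      also have "\<dots> \<le> exp (- ln 4 - 20 * ln y)"
        using p5 gG unfolding exp_le_cancel_iff G_def by linarith
      also have "\<dots> = 1/4 * (1 / y ^ 20)" by (rule e20)
      finally show ?thesis by (simp add: \<delta>_def)
    qed
    have Wr: "4 * exp (1/100 * g) * (1 / L) * (1 + real w1) ^ Suc r \<le> 1/4 * \<delta>"
    proof -
      have "1 + real w1 \<le> exp (31/10 * g + ln 2)" using w1b e31 by (simp add: exp_add)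
      then have "(1 + real w1) ^ Suc r \<le> exp (31/10 * g + ln 2) ^ Suc r" by (intro power_mono) auto
      also have "\<dots> = exp (real (Suc r) * (31/10 * g + ln 2))" by (rule exp_of_nat_mult[symmetric])
      also have "\<dots> \<le> exp ((\<rho> + 1) * (31/10 * (378/1000 * G) + ln 2))"
        unfolding exp_le_cancel_iff using r gG g1 \<rho>0 by (intro mult_mono add_mono) auto
      finally have "4 * exp (1/100 * g) * (1 / L) * (1 + real w1) ^ Suc r \<le> 4 * exp (1/100 * g) * (1 / L) * exp ((\<rho> + 1) * (31/10 * (378/1000 * G) + ln 2))"
        using L by (intro mult_left_mono) auto
      also have "\<dots> = exp (ln 4 + 1/100 * g - y + (31/10 * (378/1000 * G) + ln 2) * (\<rho> + 1))"
        by (simp add: exp_add exp_diff L_def mult.commute)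
      also have "\<dots> \<le> exp (- ln 4 - 20 * ln y)"
        using p6 gG G0 unfolding exp_le_cancel_iff G_def[symmetric] by linarith
      also have "\<dots> = 1/4 * (1 / y ^ 20)" by (rule e20)
      finally show ?thesis by (simp add: \<delta>_def)
    qed
    have brun: "2 * brun_error r M / u \<le> 1/2 * \<delta>"
    proof -
      define X where "X = B ^ Suc r / fact (Suc r)"
      define W where "W = (1 + real w1) ^ Suc r"
      have XW: "0 \<le> X" "0 \<le> W" using B by (auto simp: X_def W_def simp del: power_Suc)
      have "brun_error r M = (2 * real M * X + W) * v1"
        by (simp add: brun_error_def X_def W_def B_def v1_def del: power_Suc fact_Suc)
      also have "\<dots> \<le> (2 * (2 * \<Lambda> * L) * X + W) * exp (1/100 * g)"
        using MuL v1 XW p9 L by (intro mult_mono add_mono mult_right_mono mult_left_mono) auto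
      finally have "2 * brun_error r M / u \<le> 2 * ((2 * (2 * \<Lambda> * L) * X + W) * exp (1/100 * g)) / (L / 2)"
        using u' L p9 XW by (intro frac_le mult_left_mono mult_nonneg_nonneg add_nonneg_nonneg) auto
      also have "\<dots> = 16 * (\<Lambda> * exp (1/100 * g)) * X + 4 * exp (1/100 * g) * (1 / L) * W"
        using L by (simp add: field_simps)
      also have "\<Lambda> * exp (1/100 * g) = exp (101/100 * g)" by (simp add: \<Lambda>_def flip: exp_add)
      finally show ?thesis using Br Wr by (simp add: X_def W_def)
    qed
    have \<delta>0: "\<delta> > 0" "\<delta> \<le> 1" using y20 p10 by (auto simp: \<delta>_def)
    have d2: "real M / u * (2 * \<theta>) \<le> \<delta>"
    proof -
      have "real M / u * (2 * \<theta>) \<le> 4 * \<Lambda> * (2 * (2 * exp (106/100 * g) / L))"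
        using Mu4 \<theta> \<theta>' p9 by (intro mult_mono) auto
      also have "\<dots> = 16 * (\<Lambda> * exp (106/100 * g) / L)" by simp
      also have "\<Lambda> * exp (106/100 * g) / L = exp (206/100 * g - y)"
        by (simp add: \<Lambda>_def L_def exp_diff flip: exp_add)
      finally show ?thesis using p13 by (simp add: \<delta>_def)
    qed
    have d: "1 / y ^ 10 \<le> real D / u" "real D / u \<le> 3 / y ^ 10"
    proof -
      have y0: "y ^ 10 > 0" using p10 by simp
      have "1 / y ^ 10 = (L / y ^ 10) / L" using L by simp
      also have "\<dots> \<le> real D / u" using D L u' y0 by (intro frac_le) auto
      finally show "1 / y ^ 10 \<le> real D / u" .
      have "real D / u \<le> (L / y ^ 10 + 1) / (L / 2)" using D L u' y0 by (intro frac_le) auto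
      also have "\<dots> = 2 / y ^ 10 + 2 / L" using L by (simp add: field_simps)
      also have "2 / L \<le> 1 / y ^ 10" using p11 y0 L by (simp add: field_simps)
      finally show "real D / u \<le> 3 / y ^ 10" by simp
    qed

    \<comment> \<open>Comparison of all errors with the size of the main term\<close>
    define h where "h = exp (- (real m / u)) / u"
    have h0: "h > 0" using u' by (simp add: h_def)
    \<comment> \<open>The smallest possible main term: \<open>m / u\<close> can reach
      \<open>2 * \<Lambda>\<close> because \<open>u\<close> may be as small as
      \<open>L / 2\<close>.\<close>
    have h: "exp (- 2 * \<Lambda>) * exp (- y) \<le> h"
    proof -
      have "real m / u \<le> (\<Lambda> * L) / (L / 2)" using m' u' L p9 by (intro frac_le) auto
      also have "\<dots> = 2 * \<Lambda>" using L by simp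
      finally have "exp (- 2 * \<Lambda>) \<le> exp (- (real m / u))" by simp
      then have "exp (- 2 * \<Lambda>) / L \<le> h" unfolding h_def using u' L by (intro frac_le) auto
      then show ?thesis using L by simp
    qed
    have mDM: "m + D \<le> M"
    proof -
      have "L / y ^ 10 + 1 \<le> L"
      proof -
        have "L * (1 / y ^ 10) \<le> L * (1 / 100)" using y10 L by (intro mult_left_mono) auto
        moreover have "L * (1 / y ^ 10) = L / y ^ 10" by simp
        ultimately show ?thesis using L2 by linarith
      qed
      then have "real (m + D) \<le> real M" using m' D M by (simp add: algebra_simps)
      then show ?thesis by simp
    qed
    have D1: "1 \<le> D"
    proof -
      have "0 < L / y ^ 10" using L p10 by simp
      then have "0 < real D" using D by linarith
      then show ?thesis by simp
    qed
    have Mw: "M < w"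
    proof -
      have "real M < real w" using MuL p15 w by (simp add: \<Lambda>_def L_def exp_add)
      then show ?thesis by simp
    qed
    have Kw: "Suc K \<le> w"
    proof -
      have "real (Suc K) \<le> real w" using K p16 w by simp
      then show ?thesis by (simp only: of_nat_le_iff)
    qed
    have Du1: "real D / u \<le> 1"
    proof -
      have "3 / y ^ 10 = 3 * (1 / y ^ 10)" by simp
      then show ?thesis using d y10 by linarith
    qed
    have "\<bar>main_term m K u - h\<bar> \<le> h * (2 * (real D / u) + 7 * \<delta> / (real D / u))
      + \<theta> * ((\<theta> * real m) ^ Suc K / fact (Suc K)) + real (Suc K) ^ 2 / real w * exp (2 * (real M / u) + 1)"
      unfolding h_def
    proof (rule main_term_close[where r = r])
      show "8 * \<theta> * (real M / real w1 + 1 / mertens_prod w) \<le> 1" using \<kappa>1 by (simp add: \<kappa>_def)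
      show "real M / u * (8 * \<theta> * (real M / real w1 + 1 / mertens_prod w)) + 2 * brun_error r M / u \<le> \<delta>"
        using \<kappa> brun \<delta>0 unfolding \<kappa>_def[symmetric] by linarith
    qed (use d2 \<delta>0 D1 mDM Du1 Mw Kw in auto)
    also have "h * (2 * (real D / u) + 7 * \<delta> / (real D / u)) \<le> h * (13 / y ^ 10)"
    proof (intro mult_left_mono)
      have y0: "y ^ 10 > 0" using p10 by simp
      have "7 * \<delta> / (real D / u) \<le> 7 * \<delta> / (1 / y ^ 10)"
      proof -
        have "7 * \<delta> / e \<le> 7 * \<delta> / (1 / y ^ 10)" if "1 / y ^ 10 \<le> e" for e
          by (rule frac_le) (use that \<delta>0 y0 in auto)
        then show ?thesis using d(1) by blast
      qed
      also have "\<dots> = 7 / y ^ 10"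
        using y0 by (simp add: \<delta>_def field_simps flip: power_add)
      finally show "2 * (real D / u) + 7 * \<delta> / (real D / u) \<le> 13 / y ^ 10"
        using d(2) by simp
    qed (use h0 in auto)
    also have "\<theta> * ((\<theta> * real m) ^ Suc K / fact (Suc K)) \<le> h * (1 / y ^ 10)"
    proof -
      have tm: "\<theta> * real m \<le> 2 * exp (206/100 * g)"
      proof -
        have "\<theta> * real m \<le> (2 * exp (106/100 * g) / L) * (\<Lambda> * L)"
          using \<theta> \<theta>' m' L by (intro mult_mono) auto
        also have "\<dots> = 2 * (exp (106/100 * g) * \<Lambda>)" using L by simp
        also have "exp (106/100 * g) * \<Lambda> = exp (206/100 * g)" by (simp add: \<Lambda>_def flip: exp_add)
        finally show ?thesis .
      qed
      have "(\<theta> * real m) ^ Suc K / fact (Suc K) \<le> (exp 1 * (\<theta> * real m) / real (Suc K)) ^ Suc K"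
        using \<theta> by (intro power_div_fact_le) auto
      also have "\<dots> \<le> exp (- 1) ^ Suc K"
      proof (intro power_mono)
        have "exp 1 * (\<theta> * real m) / real (Suc K) \<le> (2 * exp 1 * exp (206/100 * g)) / exp (5/2 * g)"
          using tm K \<theta> by (intro frac_le) (auto simp: mult.commute)
        also have "\<dots> \<le> exp (5/2 * g - 1) / exp (5/2 * g)" using p14 by (intro divide_right_mono) auto
        also have "\<dots> = exp (- 1)" by (simp flip: exp_diff)
        finally show "exp 1 * (\<theta> * real m) / real (Suc K) \<le> exp (- 1)" .
      qed (use \<theta> in auto)
      also have "\<dots> = exp (- real (Suc K))" using exp_of_nat_mult[of "Suc K" "- 1 :: real"] by simp
      also have "\<dots> \<le> exp (- exp (5/2 * g))" using K by simp
      also have "\<dots> \<le> 1 / y ^ 10 * (exp (- 2 * \<Lambda>) * exp (- y))" by (rule p7)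
      also have "\<dots> \<le> 1 / y ^ 10 * h" using h p10 by (intro mult_left_mono) auto
      finally have "(\<theta> * real m) ^ Suc K / fact (Suc K) \<le> 1 / y ^ 10 * h" .
      moreover have "\<theta> * ((\<theta> * real m) ^ Suc K / fact (Suc K)) \<le> 1 * ((\<theta> * real m) ^ Suc K / fact (Suc K))"
        using \<theta> by (intro mult_right_mono) auto
      ultimately show ?thesis by (simp add: mult.commute)
    qed
    also have "real (Suc K) ^ 2 / real w * exp (2 * (real M / u) + 1) \<le> h * (1 / y ^ 10)"
    proof -
      have "real (Suc K) ^ 2 / real w \<le> (exp (5/2 * g) + 2)\<^sup>2 / exp (10 * \<Lambda>)"
        using K w by (intro frac_le power_mono) auto
      then have "real (Suc K) ^ 2 / real w * exp (2 * (real M / u) + 1) \<le> (exp (5/2 * g) + 2)\<^sup>2 / exp (10 * \<Lambda>) * exp (4 * \<Lambda> + 9)"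
        using MuL(2) by (intro mult_mono) auto
      also have "\<dots> = (exp (5/2 * g) + 2)\<^sup>2 * (exp (4 * \<Lambda> + 9) / exp (10 * \<Lambda>))" by simp
      also have "exp (4 * \<Lambda> + 9) / exp (10 * \<Lambda>) = exp (9 - 6 * \<Lambda>)" by (simp flip: exp_diff)
      also have "(exp (5/2 * g) + 2)\<^sup>2 * exp (9 - 6 * \<Lambda>) \<le> 1 / y ^ 10 * (exp (- 2 * \<Lambda>) * exp (- y))" by (rule p8)
      also have "\<dots> \<le> 1 / y ^ 10 * h" using h p10 by (intro mult_left_mono) auto
      finally show ?thesis by (simp add: mult.commute)
    qed
    finally show "\<bar>main_term m (max_tuple y) u - exp (- (real m / u)) / u\<bar> \<le> 15 / y ^ 10 * (exp (- (real m / u)) / u)"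
      by (simp add: h_def K_def mult.commute)
  qed
  qed
qed

section \<open>The gap count\<close>

definition positive_upto :: "real \<Rightarrow> nat set" where
  "positive_upto x = {n. 1 \<le> n \<and> real n \<le> x}"

lemma finite_positive_upto [simp]: "finite (positive_upto x)"
proof (rule finite_subset)
  show "positive_upto x \<subseteq> {..nat \<lfloor>x\<rfloor>}" unfolding positive_upto_def by (auto simp: le_nat_floor)
qed simp

lemma gap_count_eq:
  assumes "A \<subseteq> {1..}" "0 \<le> Y"
  shows "real (gap_count A x Y) =
    (\<Sum>n\<in>positive_upto x. of_bool (n \<in> A) * (\<Prod>h\<in>{1..nat \<lfloor>Y\<rfloor>}. 1 - of_bool (n + h \<in> A)))"
proof -
  define m where "m = nat \<lfloor>Y\<rfloor>"
  have iff: "{k \<in> A. real n + 1 \<le> real k \<and> real k \<le> real n + Y} = {} \<longleftrightarrow> (\<forall>h\<in>{1..m}. n + h \<notin> A)" for n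
  proof
    assume L: "{k \<in> A. real n + 1 \<le> real k \<and> real k \<le> real n + Y} = {}"
    show "\<forall>h\<in>{1..m}. n + h \<notin> A"
    proof
      fix h assume "h \<in> {1..m}"
      then have "1 \<le> h" "real h \<le> Y" using assms by (auto simp: m_def le_nat_floor le_nat_iff le_floor_iff)
      then have "real n + 1 \<le> real (n + h)" "real (n + h) \<le> real n + Y" by auto
      then show "n + h \<notin> A" using L by blast
    qed
  next
    assume R: "\<forall>h\<in>{1..m}. n + h \<notin> A"
    have False if "k \<in> A" "real n + 1 \<le> real k" "real k \<le> real n + Y" for k
    proof -
      define h where "h = k - n"
      have k: "k = n + h" "1 \<le> h" using that by (auto simp: h_def)
      then have "real h \<le> Y" using that by simp
      then have "h \<le> m" unfolding m_def by (rule le_nat_floor)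
      then show False using R k that by auto
    qed
    then show "{k \<in> A. real n + 1 \<le> real k \<and> real k \<le> real n + Y} = {}" by blast
  qed
  have "{n. real n \<le> x \<and> n \<in> A \<and> {k \<in> A. real n + 1 \<le> real k \<and> real k \<le> real n + Y} = {}} =
    {n \<in> positive_upto x. n \<in> A \<and> (\<forall>h\<in>{1..m}. n + h \<notin> A)}"
    unfolding iff using assms by (auto simp: positive_upto_def)
  then have "real (gap_count A x Y) = real (card {n \<in> positive_upto x. n \<in> A \<and> (\<forall>h\<in>{1..m}. n + h \<notin> A)})"
    by (simp add: gap_count_def)
  also have "\<dots> = (\<Sum>n\<in>positive_upto x. of_bool (n \<in> A \<and> (\<forall>h\<in>{1..m}. n + h \<notin> A)))"
    by (simp add: sum_of_bool_eq Int_def)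
  also have "\<dots> = (\<Sum>n\<in>positive_upto x. of_bool (n \<in> A) * (\<Prod>h\<in>{1..m}. 1 - of_bool (n + h \<in> A)))"
  proof (intro sum.cong refl)
    fix n
    have "(\<Prod>h\<in>{1..m}. 1 - of_bool (n + h \<in> A)) = (of_bool (\<forall>h\<in>{1..m}. n + h \<notin> A) :: real)"
    proof (cases "\<forall>h\<in>{1..m}. n + h \<notin> A")
      case True
      then have "(\<Prod>h\<in>{1..m}. 1 - of_bool (n + h \<in> A)) = (1::real)" by (intro prod.neutral) auto
      with True show ?thesis by simp
    next
      case False
      then obtain h where "h \<in> {1..m}" "n + h \<in> A" by blast
      then have "(\<Prod>h\<in>{1..m}. 1 - of_bool (n + h \<in> A)) = (0::real)" by (intro prod_zero) auto
      with False show ?thesis by simp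
    qed
    then show "of_bool (n \<in> A \<and> (\<forall>h\<in>{1..m}. n + h \<notin> A)) = of_bool (n \<in> A) * (\<Prod>h\<in>{1..m}. 1 - of_bool (n + h \<in> A) :: real)"
      by simp
  qed
  finally show ?thesis by (simp only: m_def)
qed

lemma tuple_count_eq:
  assumes "finite H"
  shows "real (tuple_count A (int ` insert 0 H) x) =
    (\<Sum>n\<in>positive_upto x. of_bool (n \<in> A) * (\<Prod>h\<in>H. of_bool (n + h \<in> A)))"
proof -
  have "int n + int h \<in> int ` A \<longleftrightarrow> n + h \<in> A" for n h
    by (simp flip: of_nat_add add: inj_image_mem_iff)
  then have "(\<forall>h\<in>int ` insert 0 H. int n + h \<in> int ` A) \<longleftrightarrow> n \<in> A \<and> (\<forall>h\<in>H. n + h \<in> A)" for n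
    by (auto simp: inj_image_mem_iff)
  then have "real (tuple_count A (int ` insert 0 H) x) = real (card {n \<in> positive_upto x. n \<in> A \<and> (\<forall>h\<in>H. n + h \<in> A)})"
    unfolding tuple_count_def positive_upto_def by (intro arg_cong[of _ _ "\<lambda>S. real (card S)"]) auto
  also have "\<dots> = (\<Sum>n\<in>positive_upto x. of_bool (n \<in> A \<and> (\<forall>h\<in>H. n + h \<in> A)))"
    by (simp add: sum_of_bool_eq Int_def)
  also have "\<dots> = (\<Sum>n\<in>positive_upto x. of_bool (n \<in> A) * (\<Prod>h\<in>H. of_bool (n + h \<in> A)))"
    using assms by (intro sum.cong refl) (auto intro!: prod.neutral)
  finally show ?thesis .
qed

text \<open>Bonferroni at every \<open>n\<close>. The error term is again a sum of tuple counts, so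
  the hypothesis is also applied to sets \<open>H\<close> with \<open>K + 1\<close> elements, hence
  to tuples with \<open>K + 2\<close>.\<close>

lemma gap_count_bonferroni:
  assumes "A \<subseteq> {1..}" "0 \<le> Y"
  defines "m \<equiv> nat \<lfloor>Y\<rfloor>"
  shows "\<bar>real (gap_count A x Y) - (\<Sum>H\<in>tuples m K. (-1) ^ card H * real (tuple_count A (int ` insert 0 H) x))\<bar>
    \<le> (\<Sum>H | H \<subseteq> {1..m} \<and> card H = Suc K. real (tuple_count A (int ` insert 0 H) x))"
proof -
  define q :: "nat \<Rightarrow> nat \<Rightarrow> real" where "q n h = of_bool (n + h \<in> A)" for n h
  define a :: "nat \<Rightarrow> real" where "a n = of_bool (n \<in> A)" for n
  have fin: "finite H" if "H \<subseteq> {1..m}" for H using that finite_subset by blast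
  have tc: "(\<Sum>H | H \<subseteq> {1..m} \<and> card H = k. real (tuple_count A (int ` insert 0 H) x)) =
     (\<Sum>n\<in>positive_upto x. a n * esym (q n) {1..m} k)" for k
  proof -
    have "(\<Sum>H | H \<subseteq> {1..m} \<and> card H = k. real (tuple_count A (int ` insert 0 H) x)) =
      (\<Sum>H | H \<subseteq> {1..m} \<and> card H = k. \<Sum>n\<in>positive_upto x. a n * (\<Prod>h\<in>H. q n h))"
      by (intro sum.cong refl) (use fin tuple_count_eq in \<open>auto simp: a_def q_def\<close>)
    then show ?thesis
      by (simp add: esym_def sum_distrib_left sum.swap[of _ "positive_upto x"])
  qed
  have "(\<Sum>H\<in>tuples m K. (-1) ^ card H * real (tuple_count A (int ` insert 0 H) x)) =
    (\<Sum>k\<le>K. (-1) ^ k * (\<Sum>H | H \<subseteq> {1..m} \<and> card H = k. real (tuple_count A (int ` insert 0 H) x)))"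
    unfolding sum_tuples sum_distrib_left by (intro sum.cong refl) auto
  also have "\<dots> = (\<Sum>n\<in>positive_upto x. a n * (\<Sum>k\<le>K. (-1) ^ k * esym (q n) {1..m} k))"
    unfolding tc by (simp add: sum_distrib_left sum.swap[of _ "positive_upto x"] mult.left_commute)
  finally have eq: "(\<Sum>H\<in>tuples m K. (-1) ^ card H * real (tuple_count A (int ` insert 0 H) x)) =
    (\<Sum>n\<in>positive_upto x. a n * (\<Sum>k\<le>K. (-1) ^ k * esym (q n) {1..m} k))" .
  have "real (gap_count A x Y) = (\<Sum>n\<in>positive_upto x. a n * (\<Prod>h\<in>{1..m}. 1 - q n h))"
    using gap_count_eq[OF assms(1,2)] by (simp add: m_def a_def q_def)
  then have "\<bar>real (gap_count A x Y) - (\<Sum>H\<in>tuples m K. (-1) ^ card H * real (tuple_count A (int ` insert 0 H) x))\<bar>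
    = \<bar>\<Sum>n\<in>positive_upto x. a n * ((\<Prod>h\<in>{1..m}. 1 - q n h) - (\<Sum>k\<le>K. (-1) ^ k * esym (q n) {1..m} k))\<bar>"
    unfolding eq by (simp add: sum_subtractf right_diff_distrib)
  also have "\<dots> \<le> (\<Sum>n\<in>positive_upto x. a n * esym (q n) {1..m} (Suc K))"
  proof (intro sum_abs[THEN order_trans] sum_mono)
    fix n
    have "\<bar>(\<Prod>h\<in>{1..m}. 1 - q n h) - (\<Sum>k\<le>K. (-1) ^ k * esym (q n) {1..m} k)\<bar> \<le> esym (q n) {1..m} (Suc K)"
      by (intro bonferroni_abs) (auto simp: q_def)
    then show "\<bar>a n * ((\<Prod>h\<in>{1..m}. 1 - q n h) - (\<Sum>k\<le>K. (-1) ^ k * esym (q n) {1..m} k))\<bar> \<le> a n * esym (q n) {1..m} (Suc K)"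
      unfolding abs_mult by (simp add: a_def)
  qed
  finally show ?thesis unfolding tc .
qed

lemma card_tuples_le: "real (card (tuples m K)) \<le> (1 + real m) ^ K"
proof -
  have "real (card (tuples m K)) = (\<Sum>H\<in>tuples m K. 1)" by simp
  also have "\<dots> = (\<Sum>k\<le>K. real (m choose k))"
    unfolding sum_tuples using n_subsets[of "{1..m}"] by simp
  finally show ?thesis using sum_binomial_le_power by simp
qed

lemma continuous_inverse_ln_power:
  fixes a b :: real
  shows "1 < a \<Longrightarrow> continuous_on {a..b} (\<lambda>t. 1 / ln t ^ k)"
  by (intro continuous_intros) auto

lemma integrable_inverse_ln_power:
  fixes a b :: real
  shows "1 < a \<Longrightarrow> (\<lambda>t. 1 / ln t ^ k) integrable_on {a..b}"
  by (intro integrable_continuous_interval continuous_inverse_ln_power)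

lemma main_term_eq:
  "main_term m K u = (\<Sum>H\<in>tuples m K. ((-1) ^ card H * singular_series (int ` insert 0 H)) * (1 / u ^ Suc (card H)))"
  by (simp add: main_term_def)

lemma continuous_main_term:
  assumes "1 < a" shows "continuous_on {a..b} (\<lambda>t. main_term m K (ln t))"
  unfolding main_term_eq
  by (intro continuous_on_sum continuous_on_mult continuous_on_const continuous_inverse_ln_power assms)

lemma integrable_main_term:
  "1 < a \<Longrightarrow> (\<lambda>t. main_term m K (ln t)) integrable_on {a..b}"
  by (intro integrable_continuous_interval continuous_main_term)

lemma integral_main_term:
  assumes "1 < a"
  shows "integral {a..b} (\<lambda>t. main_term m K (ln t)) =
    (\<Sum>H\<in>tuples m K. (-1) ^ card H * (singular_series (int ` insert 0 H) * integral {a..b} (\<lambda>t. 1 / ln t ^ Suc (card H))))"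
proof -
  have "integral {a..b} (\<lambda>t. main_term m K (ln t)) =
    (\<Sum>H\<in>tuples m K. integral {a..b} (\<lambda>t. ((-1) ^ card H * singular_series (int ` insert 0 H)) * (1 / ln t ^ Suc (card H))))"
    unfolding main_term_eq
    by (intro integral_sum finite_tuples integrable_on_mult_right integrable_inverse_ln_power assms)
  also have "\<dots> = (\<Sum>H\<in>tuples m K. ((-1) ^ card H * singular_series (int ` insert 0 H)) * integral {a..b} (\<lambda>t. 1 / ln t ^ Suc (card H)))"
    by (simp only: integral_mult_right)
  finally show ?thesis by (simp only: mult.assoc)
qed

text \<open>Crude bounds, used where only orders of magnitude matter: the tail of the
  inclusion-exclusion and small \<open>t\<close>.\<close>

lemma singular_series_insert_bounds:
  assumes "H \<subseteq> {1..m}" "1 / mertens_prod (m + 2) \<le> c"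
  shows "0 \<le> singular_series (int ` insert 0 H)" "singular_series (int ` insert 0 H) \<le> c ^ Suc (card H)"
proof -
  have fin: "finite H" using assms finite_subset by blast
  have z: "0 \<notin> H" using assms by auto
  have c: "card (insert 0 H) = Suc (card H)" using fin z by simp
  have sub: "insert 0 H \<subseteq> {0..m}" using assms by auto
  have cm: "card H \<le> m" using card_mono[OF _ assms(1)] by simp
  let ?V = "mertens_prod (m + 2)"
  have V: "?V > 0" by (rule mertens_prod_pos)
  note b = singular_series_bounds[OF sub, of "m + 2", unfolded c]
  show "singular_series (int ` insert 0 H) \<le> c ^ Suc (card H)"
  proof -
    have "singular_series (int ` insert 0 H) \<le> sieve_density (m + 2) (insert 0 H) / ?V ^ Suc (card H)"
      using cm by (intro b) auto
    also have "\<dots> \<le> 1 / ?V ^ Suc (card H)"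
      using V by (intro divide_right_mono sieve_density_bounds) (auto simp del: power_Suc)
    also have "\<dots> = (1 / ?V) ^ Suc (card H)" by (simp add: power_one_over del: power_Suc)
    also have "\<dots> \<le> c ^ Suc (card H)" using V assms by (intro power_mono) auto
    finally show ?thesis .
  qed
  show "0 \<le> singular_series (int ` insert 0 H)"
  proof -
    \<comment> \<open>At \<open>w = m + 2\<close> the factor \<open>1 - k ^ 2 / w\<close> could be
      negative; the square makes it nonnegative.\<close>
    define w where "w = (m + 2)\<^sup>2"
    have k: "Suc (card H) \<le> m + 2" using cm by simp
    then have k2: "(Suc (card H))\<^sup>2 \<le> w" unfolding w_def by (intro power_mono) auto
    have mw: "m + 2 \<le> w" by (simp add: w_def power2_eq_square)
    have "real (Suc (card H)) ^ 2 \<le> real w" using k2 by (metis of_nat_le_iff of_nat_power)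
    then have f: "0 \<le> 1 - real (Suc (card H)) ^ 2 / real w" using mw by simp
    have "0 \<le> sieve_density w (insert 0 H) / mertens_prod w ^ Suc (card H) * (1 - real (Suc (card H)) ^ 2 / real w)"
      using f mertens_prod_pos[of w] sieve_density_bounds[of w] by (intro mult_nonneg_nonneg divide_nonneg_nonneg) (auto simp del: power_Suc)
    also have "\<dots> \<le> singular_series (int ` insert 0 H)"
      using singular_series_bounds(1)[OF sub, of w] mw k by (simp add: c)
    finally show ?thesis .
  qed
qed

text \<open>Below \<open>s\<close> only \<open>ln t \<ge> ln 2 \<ge> 1/2\<close> is used, beyond
  \<open>s\<close> the bound \<open>b\<close>.\<close>

lemma integral_inverse_ln_power_le:
  fixes s x b :: real
  assumes "2 \<le> s" "s \<le> x" "0 < b" "b \<le> ln s"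
  shows "integral {2..x} (\<lambda>t. 1 / ln t ^ k) \<le> s * 2 ^ k + x * (1 / b) ^ k"
proof -
  have ln2: "1/2 \<le> ln (2::real)" using ln_le_minus_one[of "1/2 :: real"] by (simp add: ln_div)
  have "integral {2..x} (\<lambda>t. 1 / ln t ^ k) = integral {2..s} (\<lambda>t. 1 / ln t ^ k) + integral {s..x} (\<lambda>t. 1 / ln t ^ k)"
    using assms by (intro Henstock_Kurzweil_Integration.integral_combine[symmetric] integrable_inverse_ln_power) auto
  also have "integral {2..s} (\<lambda>t. 1 / ln t ^ k) \<le> integral {2..s} (\<lambda>t. 2 ^ k)"
  proof (intro integral_le integrable_inverse_ln_power)
    fix t assume "t \<in> {2..s}"
    then have "1/2 \<le> ln t" using ln2 by (smt (verit) atLeastAtMost_iff ln_le_cancel_iff)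
    then have "1 / ln t \<le> 2" "0 \<le> 1 / ln t" by (auto simp: field_simps)
    then show "1 / ln t ^ k \<le> 2 ^ k" using power_mono[of "1 / ln t" 2 k] by (simp add: power_one_over)
  qed auto
  also have "integral {2..s} (\<lambda>t. 2 ^ k) = (s - 2) * 2 ^ k" using assms by simp
  also have "\<dots> \<le> s * 2 ^ k" by (intro mult_right_mono) auto
  also have "integral {s..x} (\<lambda>t. 1 / ln t ^ k) \<le> integral {s..x} (\<lambda>t. (1 / b) ^ k)"
  proof (intro integral_le integrable_inverse_ln_power)
    fix t assume t: "t \<in> {s..x}"
    then have "b \<le> ln t" using assms by (smt (verit) atLeastAtMost_iff ln_le_cancel_iff)
    then have "1 / ln t \<le> 1 / b" "0 \<le> 1 / ln t" using assms by (auto intro!: divide_left_mono)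
    then show "1 / ln t ^ k \<le> (1 / b) ^ k" using power_mono[of "1 / ln t" "1 / b" k] by (simp add: power_one_over)
  qed (use assms in auto)
  also have "integral {s..x} (\<lambda>t. (1 / b) ^ k) = (x - s) * (1 / b) ^ k" using assms by simp
  also have "\<dots> \<le> x * (1 / b) ^ k" using assms by (intro mult_right_mono) auto
  finally show ?thesis by simp
qed

text \<open>The derivative of \<open>t * h t\<close> is \<open>h t * (1 + a / (ln t)\<^sup>2 - 1 / ln t)\<close>, which is close to \<open>h t\<close>.\<close>

lemma integral_gap_density:
  fixes a b s x \<kappa> :: real
  defines "h \<equiv> \<lambda>t. exp (- (a / ln t)) / ln t"
  assumes "1 < s" "s \<le> x" "0 < b" "b \<le> ln s" "0 \<le> a" "a / b\<^sup>2 + 1 / b \<le> \<kappa>"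
  shows "\<bar>(x * h x - s * h s) - integral {s..x} h\<bar> \<le> \<kappa> * integral {s..x} h" "h integrable_on {s..x}" "0 \<le> integral {s..x} h"
proof -
  define q where "q t = h t * (1 + a / (ln t)\<^sup>2 - 1 / ln t)" for t
  have lnt: "b \<le> ln t" if "t \<in> {s..x}" for t using that assms by (smt (verit) atLeastAtMost_iff ln_le_cancel_iff)
  have cont: "continuous_on {s..x} h" unfolding h_def using assms lnt by (intro continuous_intros) force+
  then show int: "h integrable_on {s..x}" by (rule integrable_continuous_interval)
  have pos: "0 \<le> h t" if "t \<in> {s..x}" for t unfolding h_def using lnt[OF that] assms by simp
  then show "0 \<le> integral {s..x} h" by (intro integral_nonneg int)
  have "(q has_integral (x * h x - s * h s)) {s..x}"
  proof (rule fundamental_theorem_of_calculus)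
    fix t assume t: "t \<in> {s..x}"
    then have t0: "t > 0" "ln t > 0" using assms lnt[OF t] by auto
    have "((\<lambda>t. t * h t) has_real_derivative q t) (at t)"
      unfolding h_def q_def using t0
      by (auto intro!: derivative_eq_intros simp: field_simps power2_eq_square)
    then show "((\<lambda>t. t * h t) has_vector_derivative q t) (at t within {s..x})"
      by (simp add: has_real_derivative_iff_has_vector_derivative has_vector_derivative_at_within)
  qed (use assms in auto)
  then have qi: "q integrable_on {s..x}" "integral {s..x} q = x * h x - s * h s"
    by (auto simp: integrable_on_def intro: integral_unique)
  have "\<bar>integral {s..x} (\<lambda>t. q t - h t)\<bar> \<le> integral {s..x} (\<lambda>t. \<kappa> * h t)"
    unfolding real_norm_def[symmetric]
  proof (intro integral_norm_bound_integral integrable_diff qi int integrable_on_mult_right)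
    fix t assume t: "t \<in> {s..x}"
    have "a / (ln t)\<^sup>2 \<le> a / b\<^sup>2" "1 / ln t \<le> 1 / b" "0 \<le> a / (ln t)\<^sup>2" "0 \<le> 1 / ln t"
      using lnt[OF t] assms by (auto intro!: divide_left_mono power_mono)
    then have "\<bar>a / (ln t)\<^sup>2 - 1 / ln t\<bar> \<le> \<kappa>" using assms(7) by linarith
    then have "h t * \<bar>a / (ln t)\<^sup>2 - 1 / ln t\<bar> \<le> h t * \<kappa>" using pos[OF t] by (intro mult_left_mono)
    moreover have "q t - h t = h t * (a / (ln t)\<^sup>2 - 1 / ln t)" by (simp add: q_def algebra_simps)
    ultimately show "norm (q t - h t) \<le> \<kappa> * h t" using pos[OF t] by (simp add: abs_mult mult.commute)
  qed
  then show "\<bar>(x * h x - s * h s) - integral {s..x} h\<bar> \<le> \<kappa> * integral {s..x} h"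
    using qi int by (simp add: integral_diff)
qed

text \<open>The fourth condition lets the error of the hypothesis absorb the number of tuples, at
  most \<open>exp (2 * y) ^ Suc K\<close>. It rests on
  \<open>5/2 * 0.378 = 0.945 < 1\<close>.\<close>

lemma eventually_error_bounds:
  fixes C :: real
  shows "\<forall>\<^sub>F y in at_top.
    exp (log_lambda y + y) + 2 \<le> exp (2 * y) \<and>
    C * (2 * y) powr (20/19) \<le> y\<^sup>2 \<and>
    2 * y\<^sup>2 \<le> exp y \<and>
    exp (2 * y * (exp (945/1000 * sqrt (y * ln y)) + 2) - exp (sqrt (y * ln y)) * y)
      \<le> 1 / y ^ 10 * (exp (- 2 * exp (378/1000 * sqrt (y * ln y))) * exp (- y)) \<and>
    exp (3 * y * (exp (5/2 * log_lambda y) + 3))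
      \<le> 1 / y ^ 10 * (exp (- 2 * exp (log_lambda y)) * exp (- y)) * exp (exp y / 2) \<and>
    2 * y\<^sup>2 * exp 1 * exp (log_lambda y) \<le> exp (5/2 * log_lambda y - 1) \<and>
    exp (- exp (5/2 * log_lambda y)) \<le> 1 / y ^ 10 * (exp (- 2 * exp (log_lambda y)) * exp (- y)) \<and>
    4 * exp (log_lambda y - y) + 2 * exp (- y) \<le> 1/2 * (1 / y ^ 10) \<and>
    exp (945/1000 * sqrt (y * ln y)) + 3 \<le> exp (sqrt (y * ln y)) \<and>
    y \<ge> 100"
  unfolding log_lambda_def eventually_conj_iff
  by (intro conjI; real_asymp)

lemma binomial_le_power_div_fact: "real (n choose k) \<le> real n ^ k / fact k"
proof -
  have "real ((n choose k) * fact k) \<le> real (n ^ k)" using binomial_fact_pow[of n k] by (simp only: of_nat_le_iff)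
  then show ?thesis by (simp add: field_simps)
qed

text \<open>The hypothesis at the single point \<open>x = exp (exp y)\<close>, with
  \<open>\<phi>\<close> and \<open>\<psi>\<close> rewritten in \<open>y\<close>. Separating it from
  its threshold makes the estimate below uniform in \<open>A\<close>.\<close>

definition tuple_asymptotics :: "nat set \<Rightarrow> real \<Rightarrow> bool" where
  "tuple_asymptotics A y \<longleftrightarrow>
    (\<forall>H. finite H \<and> (\<forall>h\<in>H. 0 \<le> h \<and> real_of_int h \<le> exp (log_lambda y) * exp y) \<and> real (card H) \<le> exp (sqrt (y * ln y)) \<longrightarrow>
      \<bar>real (tuple_count A H (exp (exp y))) - singular_series H * integral {2..exp (exp y)} (\<lambda>t. 1 / ln t ^ card H)\<bar>
        \<le> exp (exp y) * exp (- exp (sqrt (y * ln y)) * y))"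

lemma gap_count_estimate:
  "\<forall>\<^sub>F y in at_top. \<forall>A l. A \<subseteq> {1..} \<longrightarrow>
    tuple_asymptotics A y \<longrightarrow>
    0 < l \<longrightarrow> l \<le> exp (log_lambda y) \<longrightarrow>
    \<bar>real (gap_count A (exp (exp y)) (l * exp y)) - exp (exp y) * exp (- l) / exp y\<bar>
      \<le> 100 / y ^ 10 * (exp (exp y) * exp (- l) / exp y)"
proof -
  obtain C where C: "C > 0" "\<And>N. N \<ge> 2 \<Longrightarrow> 1 / mertens_prod N \<le> C * ln (real N) powr (20 / 19)"
    using inverse_mertens_prod_le by blast
  from main_term_asymptotics eventually_error_bounds[of C] show ?thesis
  proof eventually_elim
  case (elim y)
  note y1 = elim(1) and y2 = elim(2)
  show ?case
  proof (intro allI impI)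
    fix A :: "nat set" and l :: real
    assume A: "A \<subseteq> {1..}" and hl: "tuple_asymptotics A y"
      and l: "0 < l" "l \<le> exp (log_lambda y)"
    define g where "g = log_lambda y"
    define G where "G = sqrt (y * ln y)"
    define \<Lambda> where "\<Lambda> = exp g"
    define L where "L = exp y"
    define x where "x = exp L"
    \<comment> \<open>The square root of \<open>x\<close>. Below it \<open>ln t\<close> is too small
      for the model, but trivial bounds, of size \<open>exp (3 * y * (K + 2))\<close>, are absorbed
      by the saving \<open>x / s\<close>.\<close>
    define s where "s = exp (L / 2)"
    define \<tau> where "\<tau> = 1 / y ^ 10 * (exp (- 2 * \<Lambda>) * exp (- y))"
    have q1: "exp (g + y) + 2 \<le> exp (2 * y)"
      and q2: "C * (2 * y) powr (20/19) \<le> y\<^sup>2"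
      and q2': "2 * y\<^sup>2 \<le> L"
      and q3': "exp (2 * y * (exp (945/1000 * G) + 2) - exp G * y) \<le> 1 / y ^ 10 * (exp (- 2 * exp (378/1000 * G)) * exp (- y))"
      and q4: "exp (3 * y * (exp (5/2 * g) + 3)) \<le> \<tau> * s"
      and q6: "2 * y\<^sup>2 * exp 1 * \<Lambda> \<le> exp (5/2 * g - 1)"
      and q7: "exp (- exp (5/2 * g)) \<le> \<tau>"
      and q8: "4 * exp (g - y) + 2 * exp (- y) \<le> 1/2 * (1 / y ^ 10)"
      and q9: "exp (945/1000 * G) + 3 \<le> exp G"
      and q10: "y \<ge> 100"
      using y2 by (simp_all add: g_def G_def \<Lambda>_def L_def s_def \<tau>_def)
    have gG: "g \<le> 378/1000 * G" unfolding g_def G_def using q10 by (intro log_lambda_le) auto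
    have q3: "exp (2 * y * (exp (945/1000 * G) + 2) - exp G * y) \<le> \<tau>"
    proof -
      have "exp (- 2 * exp (378/1000 * G)) \<le> exp (- 2 * \<Lambda>)" using gG by (simp add: \<Lambda>_def)
      then have "1 / y ^ 10 * (exp (- 2 * exp (378/1000 * G)) * exp (- y)) \<le> \<tau>"
        unfolding \<tau>_def using q10 by (intro mult_left_mono mult_right_mono) auto
      then show ?thesis using q3' by linarith
    qed
    have L: "L > 0" "exp (- y) = 1 / L" by (simp_all add: L_def exp_minus inverse_eq_divide)
    have y10: "y ^ 10 > 0" "1 / y ^ 10 \<le> 1 / 100"
    proof -
      show "y ^ 10 > 0" using q10 by simp
      have "y ^ 1 \<le> y ^ 10" using q10 by (intro power_increasing) auto
      then show "1 / y ^ 10 \<le> 1 / 100" using q10 by (intro frac_le) auto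
    qed
    have L4: "L \<ge> 100"
    proof -
      have "1 + y \<le> L" unfolding L_def by (rule exp_ge_add_one_self)
      then show ?thesis using q10 by simp
    qed
    have twoL: "2 / L \<le> 1 / y ^ 10"
    proof -
      have "0 \<le> 4 * exp (g - y)" "0 \<le> 1 / y ^ 10" "2 / L = 2 * exp (- y)" using y10 by (simp_all add: L)
      then show ?thesis using q8 by linarith
    qed
    have ss: "s * s = x" by (simp add: s_def x_def flip: exp_add)
    have s2: "2 \<le> s" "s \<le> x" "x > 0" "s > 0"
    proof -
      have "1 + L / 2 \<le> s" unfolding s_def by (rule exp_ge_add_one_self)
      then show "2 \<le> s" using L4 by simp
      show "s \<le> x" using L by (simp add: s_def x_def)
    qed (simp_all add: x_def s_def)
    have lns: "ln s = L / 2" "ln x = L" by (simp_all add: s_def x_def)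
    define K where "K = max_tuple y"
    have K: "exp (5/2 * g) \<le> real K" "real K \<le> exp (5/2 * g) + 1"
    proof -
      have "exp (5/2 * g) \<ge> 0" by simp
      then show "exp (5/2 * g) \<le> real K" "real K \<le> exp (5/2 * g) + 1"
        unfolding K_def max_tuple_def g_def[symmetric] by linarith+
    qed
    have KG: "real K \<le> exp (945/1000 * G) + 1"
    proof -
      have "exp (5/2 * g) \<le> exp (945/1000 * G)" using gG by simp
      then show ?thesis using K by linarith
    qed
    define m where "m = nat \<lfloor>l * L\<rfloor>"
    have lL: "0 \<le> l * L" using l L by simp
    have m: "real m \<le> l * L" "l * L - 1 \<le> real m" unfolding m_def using lL by linarith+
    have m\<Lambda>: "real m \<le> \<Lambda> * L"
    proof -
      have "l * L \<le> \<Lambda> * L" using l L by (intro mult_right_mono) (auto simp: \<Lambda>_def g_def)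
      then show ?thesis using m by linarith
    qed
    have m2: "real m + 2 \<le> exp (2 * y)"
    proof -
      have "\<Lambda> * L = exp (g + y)" by (simp add: \<Lambda>_def L_def exp_add)
      then show ?thesis using m\<Lambda> q1 by simp
    qed
    \<comment> \<open>The singular series grows by at most this factor for each element of the
      tuple.\<close>
    define c where "c = y\<^sup>2"
    have c1: "1 \<le> c" unfolding c_def using q10 by (simp add: one_le_power)
    have Vc: "1 / mertens_prod (m + 2) \<le> c"
    proof -
      have "ln (real (m + 2)) \<le> ln (exp (2 * y))" using m2 by (subst ln_le_cancel_iff) auto
      then have "ln (real (m + 2)) powr (20/19) \<le> (2 * y) powr (20/19)"
        by (intro powr_mono2) auto
      then have "C * ln (real (m + 2)) powr (20/19) \<le> C * (2 * y) powr (20/19)" using C by (intro mult_left_mono) auto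
      then show ?thesis using C(2)[of "m + 2"] q2 by (simp add: c_def)
    qed
    have m1: "1 + real m \<le> exp (2 * y)" using m2 by simp
    define hL where "hL = exp (- (real m / L)) / L"
    \<comment> \<open>The unit in which all errors are measured; \<open>\<tau> * x\<close> is a
      lower bound for it that does not depend on \<open>m\<close>.\<close>
    define U where "U = 1 / y ^ 10 * (x * hL)"
    have hL0: "hL > 0" using L by (simp add: hL_def)
    have \<tau>U: "\<tau> * x \<le> U"
    proof -
      have "real m / L \<le> 2 * \<Lambda>" using m\<Lambda> L mult_right_mono[of \<Lambda> "2 * \<Lambda>" L] by (simp add: \<Lambda>_def field_simps)
      then have "exp (- 2 * \<Lambda>) * exp (- y) \<le> hL" unfolding hL_def L using L by (simp add: divide_right_mono)
      then have "1 / y ^ 10 * (exp (- 2 * \<Lambda>) * exp (- y)) * x \<le> 1 / y ^ 10 * hL * x"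
        using s2 y10 by (intro mult_right_mono mult_left_mono) auto
      then show ?thesis by (simp add: \<tau>_def U_def mult_ac)
    qed
    have U0: "0 \<le> U" using s2 hL0 y10 by (simp add: U_def)
    define Err where "Err = x * exp (- exp G * y)"
    define I where "I k = integral {2..x} (\<lambda>t. 1 / ln t ^ k)" for k :: nat
    define S where "S H = singular_series (int ` insert 0 H)" for H :: "nat set"
    define tc where "tc H = real (tuple_count A (int ` insert 0 H) x)" for H :: "nat set"
    have tc: "\<bar>tc H - S H * I (Suc (card H))\<bar> \<le> Err" if H: "H \<in> tuples m (Suc K)" for H
    proof -
      have H': "H \<subseteq> {1..m}" "card H \<le> Suc K" "finite H" "0 \<notin> H"
        using H finite_in_tuples[OF H] unfolding tuples_def by auto
      have card: "card (int ` insert 0 H) = Suc (card H)"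
        using H' by (subst card_image) auto
      have "real (Suc (card H)) \<le> real K + 2" using H' by simp
      then have small: "real (card (int ` insert 0 H)) \<le> exp (sqrt (y * ln y))"
        unfolding card using KG q9 unfolding G_def by linarith
      have range: "\<forall>h\<in>int ` insert 0 H. 0 \<le> h \<and> real_of_int h \<le> exp (log_lambda y) * exp y"
      proof
        fix h assume h: "h \<in> int ` insert 0 H"
        then obtain n where n: "h = int n" "n \<in> insert 0 H" by blast
        then have "n \<le> m" using H' by auto
        then have "real n \<le> \<Lambda> * L" using m\<Lambda> by linarith
        then show "0 \<le> h \<and> real_of_int h \<le> exp (log_lambda y) * exp y" using n by (simp add: \<Lambda>_def L_def g_def)
      qed
      have "finite (int ` insert 0 H)" using H' by simp
      then have "\<bar>real (tuple_count A (int ` insert 0 H) x) - singular_series (int ` insert 0 H) * integral {2..x} (\<lambda>t. 1 / ln t ^ card (int ` insert 0 H))\<bar> \<le> Err"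
        unfolding Err_def x_def L_def G_def
        by (intro hl[unfolded tuple_asymptotics_def, THEN spec, THEN mp] conjI range small)
      then show ?thesis unfolding tc_def S_def I_def card .
    qed
    define T where "T = {H. H \<subseteq> {1..m} \<and> card H = Suc K}"
    have finT: "finite T" unfolding T_def by (rule finite_subsets_card) simp
    have T: "T \<subseteq> tuples m (Suc K)" "tuples m K \<subseteq> tuples m (Suc K)" by (auto simp: T_def tuples_def)
    have cardT: "real (card (tuples m K)) + real (card T) \<le> (1 + real m) ^ Suc K"
    proof -
      have "tuples m (Suc K) = tuples m K \<union> T" "tuples m K \<inter> T = {}" by (auto simp: tuples_def T_def)
      then have "card (tuples m (Suc K)) = card (tuples m K) + card T" using finT by (simp add: card_Un_disjoint)
      then show ?thesis using card_tuples_le[of m "Suc K"] by simp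
    qed
    have cT: "card T = m choose Suc K" unfolding T_def using n_subsets[of "{1..m}" "Suc K"] by simp

    \<comment> \<open>From the gap count to an integral of the main term\<close>
    have s1: "\<bar>real (gap_count A x (l * L)) - (\<Sum>H\<in>tuples m K. (-1) ^ card H * tc H)\<bar> \<le> (\<Sum>H\<in>T. tc H)"
      unfolding tc_def T_def m_def by (rule gap_count_bonferroni[OF A lL])
    have "\<bar>(\<Sum>H\<in>tuples m K. (-1) ^ card H * tc H) - (\<Sum>H\<in>tuples m K. (-1) ^ card H * (S H * I (Suc (card H))))\<bar>
       = \<bar>\<Sum>H\<in>tuples m K. (-1) ^ card H * (tc H - S H * I (Suc (card H)))\<bar>"
      by (simp add: sum_subtractf right_diff_distrib)
    also have "\<dots> \<le> (\<Sum>H\<in>tuples m K. Err)"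
      using tc T by (intro sum_abs[THEN order_trans] sum_mono) (auto simp: abs_mult)
    finally have s2': "\<bar>(\<Sum>H\<in>tuples m K. (-1) ^ card H * tc H) - (\<Sum>H\<in>tuples m K. (-1) ^ card H * (S H * I (Suc (card H))))\<bar> \<le> card (tuples m K) * Err"
      by simp
    have sI: "(\<Sum>H\<in>tuples m K. (-1) ^ card H * (S H * I (Suc (card H)))) = integral {2..x} (\<lambda>t. main_term m K (ln t))"
      by (subst integral_main_term) (simp_all add: S_def I_def)
    have "(\<Sum>H\<in>T. tc H) \<le> (\<Sum>H\<in>T. c ^ Suc (Suc K) * I (Suc (Suc K)) + Err)"
    proof (rule sum_mono)
      fix H assume H: "H \<in> T"
      then have H': "H \<subseteq> {1..m}" "card H = Suc K" by (auto simp: T_def)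
      have "0 \<le> I (Suc (Suc K))"
        unfolding I_def by (intro integral_nonneg integrable_inverse_ln_power) auto
      moreover have "S H \<le> c ^ Suc (Suc K)"
        using singular_series_insert_bounds(2)[OF H'(1) Vc] H' by (simp add: S_def)
      ultimately have "S H * I (Suc (Suc K)) \<le> c ^ Suc (Suc K) * I (Suc (Suc K))" by (intro mult_right_mono)
      then show "tc H \<le> c ^ Suc (Suc K) * I (Suc (Suc K)) + Err"
        using tc[of H] T H H' by (auto simp: abs_le_iff)
    qed
    also have "\<dots> = card T * (c ^ Suc (Suc K) * I (Suc (Suc K))) + card T * Err" by (simp add: distrib_left)
    finally have s3: "(\<Sum>H\<in>T. tc H) \<le> card T * (c ^ Suc (Suc K) * I (Suc (Suc K))) + card T * Err" .
    have s4: "(real (card (tuples m K)) + real (card T)) * Err \<le> U"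
    proof -
      have "(real (card (tuples m K)) + real (card T)) * Err \<le> exp (2 * y) ^ Suc K * Err"
      proof (intro mult_right_mono)
        have "(1 + real m) ^ Suc K \<le> exp (2 * y) ^ Suc K" using m1 by (intro power_mono) auto
        then show "real (card (tuples m K)) + real (card T) \<le> exp (2 * y) ^ Suc K" using cardT by linarith
      qed (use s2 in \<open>simp add: Err_def\<close>)
      also have "exp (2 * y) ^ Suc K = exp (real (Suc K) * (2 * y))" by (rule exp_of_nat_mult[symmetric])
      also have "\<dots> * Err = x * exp (real (Suc K) * (2 * y) - exp G * y)"
        by (simp add: Err_def exp_diff exp_minus divide_inverse)
      also have "\<dots> \<le> x * exp (2 * y * (exp (945/1000 * G) + 2) - exp G * y)"
      proof -
        have "real (Suc K) * (2 * y) \<le> (exp (945/1000 * G) + 2) * (2 * y)"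
          using KG q10 by (intro mult_right_mono) auto
        then show ?thesis using s2 by (intro mult_left_mono) (auto simp: mult.commute)
      qed
      also have "\<dots> \<le> x * \<tau>" using q3 s2 by (intro mult_left_mono) auto
      finally show ?thesis using \<tau>U by (simp add: mult.commute)
    qed
    \<comment> \<open>Serves both the tail terms and the main term on \<open>[2, s]\<close>: number
      of sets, times singular series, times \<open>1 / ln t \<le> 2\<close> for each
      element.\<close>
    have crude: "(1 + real m) ^ Suc K * (2 * c) ^ Suc (Suc K) * s \<le> U"
    proof -
      have "(1 + real m) ^ Suc K * (2 * c) ^ Suc (Suc K) \<le> exp (2 * y) ^ Suc (Suc K) * exp y ^ Suc (Suc K)"
      proof (intro mult_mono)
        have "(1 + real m) ^ Suc K \<le> exp (2 * y) ^ Suc K" using m1 by (intro power_mono) auto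
        also have "\<dots> \<le> exp (2 * y) ^ Suc (Suc K)" using q10 by (intro power_increasing) auto
        finally show "(1 + real m) ^ Suc K \<le> exp (2 * y) ^ Suc (Suc K)" .
        show "(2 * c) ^ Suc (Suc K) \<le> exp y ^ Suc (Suc K)"
          using q2' c1 by (intro power_mono) (auto simp: c_def L_def)
        show "0 \<le> (2 * c) ^ Suc (Suc K)" using c1 by (intro zero_le_power) auto
      qed auto
      also have "\<dots> = exp (real (Suc (Suc K)) * (3 * y))"
        by (simp only: flip: power_mult_distrib exp_add exp_of_nat_mult) simp
      also have "\<dots> \<le> exp (3 * y * (exp (5/2 * g) + 3))"
      proof -
        have "real (Suc (Suc K)) * (3 * y) \<le> (exp (5/2 * g) + 3) * (3 * y)"
          using K q10 by (intro mult_right_mono) auto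
        then show ?thesis by (simp add: mult.commute)
      qed
      also have "\<dots> \<le> \<tau> * s" by (rule q4)
      finally have "(1 + real m) ^ Suc K * (2 * c) ^ Suc (Suc K) * s \<le> \<tau> * s * s" using s2 by (intro mult_right_mono) auto
      then show ?thesis using \<tau>U ss by (simp add: mult.assoc)
    qed
    have sU: "s \<le> U"
    proof -
      have "1 \<le> exp (3 * y * (exp (5/2 * g) + 3))" using q10 by (simp add: add_nonneg_nonneg)
      then have "1 \<le> \<tau> * s" using q4 by linarith
      then have "1 * s \<le> \<tau> * s * s" using s2 by (intro mult_right_mono) auto
      then show ?thesis using \<tau>U ss by (simp add: mult.assoc)
    qed
    have s5: "card T * (c ^ Suc (Suc K) * I (Suc (Suc K))) \<le> 2 * U"
    proof -
      have "I (Suc (Suc K)) \<le> s * 2 ^ Suc (Suc K) + x * (1 / (L / 2)) ^ Suc (Suc K)"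
        unfolding I_def using s2 L by (intro integral_inverse_ln_power_le) (auto simp: lns)
      then have "card T * (c ^ Suc (Suc K) * I (Suc (Suc K))) \<le> card T * (c ^ Suc (Suc K) * (s * 2 ^ Suc (Suc K) + x * (1 / (L / 2)) ^ Suc (Suc K)))"
        using c1 by (intro mult_left_mono) auto
      also have "\<dots> = card T * (2 * c) ^ Suc (Suc K) * s + card T * (2 * c / L) ^ Suc (Suc K) * x"
        by (simp add: power_mult_distrib power_divide distrib_left mult_ac del: power_Suc)
      also have "card T * (2 * c) ^ Suc (Suc K) * s \<le> (1 + real m) ^ Suc K * (2 * c) ^ Suc (Suc K) * s"
        using cardT s2 c1 by (intro mult_right_mono zero_le_power) auto
      also have "\<dots> \<le> U" by (rule crude)
      also have "card T * (2 * c / L) ^ Suc (Suc K) * x \<le> U"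
      proof -
        have cL: "0 \<le> 2 * c / L" "2 * c / L \<le> 1" using q2' c1 L by (auto simp: c_def)
        \<comment> \<open>One of the \<open>K + 2\<close> factors is dropped, so that the rest pairs
          with \<open>m ^ Suc K\<close>.\<close>
        have "card T * (2 * c / L) ^ Suc (Suc K) \<le> (real m ^ Suc K / fact (Suc K)) * (2 * c / L) ^ Suc K"
          unfolding cT using cL by (intro mult_mono binomial_le_power_div_fact power_decreasing zero_le_power cL) auto
        also have "\<dots> = (2 * c * (real m / L)) ^ Suc K / fact (Suc K)"
          by (simp add: power_mult_distrib power_divide mult_ac del: power_Suc fact_Suc)
        also have "\<dots> \<le> (exp 1 * (2 * c * (real m / L)) / real (Suc K)) ^ Suc K"
          using c1 L by (intro power_div_fact_le) auto
        also have "\<dots> \<le> exp (- 1) ^ Suc K"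
        proof (intro power_mono)
          have "real m / L \<le> \<Lambda>" using m\<Lambda> L by (simp add: field_simps)
          then have "exp 1 * (2 * c * (real m / L)) \<le> exp 1 * (2 * c * \<Lambda>)"
            using c1 by (intro mult_left_mono) auto
          also have "\<dots> \<le> exp (5/2 * g - 1)" using q6 by (simp add: c_def mult_ac)
          finally have "exp 1 * (2 * c * (real m / L)) / real (Suc K) \<le> exp (5/2 * g - 1) / exp (5/2 * g)"
            using K c1 L by (intro frac_le) auto
          also have "\<dots> = exp (- 1)" by (simp flip: exp_diff)
          finally show "exp 1 * (2 * c * (real m / L)) / real (Suc K) \<le> exp (- 1)" .
        qed (use c1 L in auto)
        also have "\<dots> = exp (- real (Suc K))" using exp_of_nat_mult[of "Suc K" "- 1 :: real"] by simp
        also have "\<dots> \<le> exp (- exp (5/2 * g))" using K by simp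
        also have "\<dots> \<le> \<tau>" by (rule q7)
        finally have "card T * (2 * c / L) ^ Suc (Suc K) * x \<le> \<tau> * x" using s2 by (intro mult_right_mono) auto
        then show ?thesis using \<tau>U by linarith
      qed
      finally show ?thesis by simp
    qed

    \<comment> \<open>The integral of the main term, cut at the square root of
      \<open>x\<close>\<close>
    have split: "integral {2..x} (\<lambda>t. main_term m K (ln t)) =
      integral {2..s} (\<lambda>t. main_term m K (ln t)) + integral {s..x} (\<lambda>t. main_term m K (ln t))"
      using s2 by (intro Henstock_Kurzweil_Integration.integral_combine[symmetric] integrable_main_term) auto
    have s6: "\<bar>integral {2..s} (\<lambda>t. main_term m K (ln t))\<bar> \<le> U"
    proof -
      define B where "B = (1 + real m) ^ Suc K * (2 * c) ^ Suc (Suc K)"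
      have "\<bar>integral {2..s} (\<lambda>t. main_term m K (ln t))\<bar> \<le> integral {2..s} (\<lambda>t. B)"
        unfolding real_norm_def[symmetric]
      proof (intro integral_norm_bound_integral integrable_main_term)
        fix t assume "t \<in> {2..s}"
        then have t: "2 \<le> t" by simp
        have "1/2 \<le> ln (2::real)" using ln_le_minus_one[of "1/2 :: real"] by (simp add: ln_div)
        also have "\<dots> \<le> ln t" using t by (subst ln_le_cancel_iff) auto
        finally have lnt: "0 < ln t" "1 / ln t \<le> 2" by (auto simp: field_simps)
        have "\<bar>main_term m K (ln t)\<bar> \<le> (\<Sum>H\<in>tuples m K. (2 * c) ^ Suc (Suc K))"
          unfolding main_term_eq
        proof (intro sum_abs[THEN order_trans] sum_mono)
          fix H assume H: "H \<in> tuples m K"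
          then have H': "H \<subseteq> {1..m}" "card H \<le> K" by (auto simp: tuples_def)
          note b = singular_series_insert_bounds[OF H'(1) Vc]
          have "\<bar>(-1) ^ card H * singular_series (int ` insert 0 H) * (1 / ln t ^ Suc (card H))\<bar> =
            singular_series (int ` insert 0 H) * (1 / ln t) ^ Suc (card H)"
            using b(1) lnt by (simp add: abs_mult power_one_over del: power_Suc)
          also have "\<dots> \<le> c ^ Suc (card H) * 2 ^ Suc (card H)"
            using b lnt c1 by (intro mult_mono power_mono) auto
          also have "\<dots> = (2 * c) ^ Suc (card H)" by (simp add: power_mult_distrib del: power_Suc)
          also have "\<dots> \<le> (2 * c) ^ Suc (Suc K)" using H' c1 by (intro power_increasing) auto
          finally show "\<bar>(-1) ^ card H * singular_series (int ` insert 0 H) * (1 / ln t ^ Suc (card H))\<bar> \<le> (2 * c) ^ Suc (Suc K)" .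
        qed
        also have "\<dots> = card (tuples m K) * (2 * c) ^ Suc (Suc K)" by simp
        also have "\<dots> \<le> B" unfolding B_def using cardT c1 by (intro mult_right_mono zero_le_power) auto
        finally show "norm (main_term m K (ln t)) \<le> B" by simp
      qed auto
      also have "\<dots> = (s - 2) * B" using s2 by simp
      also have "\<dots> \<le> s * B" unfolding B_def using c1 by (intro mult_right_mono mult_nonneg_nonneg zero_le_power) auto
      also have "\<dots> \<le> U" using crude by (simp only: B_def mult.commute mult.left_commute)
      finally show ?thesis .
    qed
    define h where "h t = exp (- (real m / ln t)) / ln t" for t
    define J where "J = integral {s..x} h"
    define \<kappa> where "\<kappa> = real m / (L / 2)\<^sup>2 + 1 / (L / 2)"
    have pre: "1 < s" "s \<le> x" "0 < L / 2" "L / 2 \<le> ln s" "0 \<le> real m" "real m / (L / 2)\<^sup>2 + 1 / (L / 2) \<le> \<kappa>"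
      using s2 L by (simp_all add: lns \<kappa>_def)
    \<comment> \<open>The integral is nearly the boundary value at \<open>x\<close>, where
      \<open>ln x = L\<close>; this recovers the claimed asymptotics at \<open>x\<close> from those
      at each \<open>t\<close>.\<close>
    have J: "\<bar>(x * h x - s * h s) - J\<bar> \<le> \<kappa> * J" "h integrable_on {s..x}" "0 \<le> J"
      unfolding J_def h_def by (rule integral_gap_density[OF pre])+
    have \<kappa>: "\<kappa> \<le> 1/2 * (1 / y ^ 10)" "0 \<le> \<kappa>"
    proof -
      have "real m / (L / 2)\<^sup>2 \<le> \<Lambda> * L / (L / 2)\<^sup>2" using m\<Lambda> by (intro divide_right_mono) auto
      also have "\<dots> = 4 * (\<Lambda> / L)" using L by (simp add: power2_eq_square field_simps)
      also have "\<Lambda> / L = exp (g - y)" by (simp add: \<Lambda>_def L_def exp_diff)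
      finally show "\<kappa> \<le> 1/2 * (1 / y ^ 10)" using q8 by (simp add: \<kappa>_def L)
      show "0 \<le> \<kappa>" using L by (simp add: \<kappa>_def)
    qed
    have hx: "h x = hL" by (simp add: h_def hL_def lns)
    have hs: "0 \<le> s * h s" "s * h s \<le> U"
    proof -
      show "0 \<le> s * h s" using s2 L by (simp add: h_def lns)
      have "exp (- (real m / (L / 2))) \<le> 1" using L by simp
      then have "h s \<le> 1 / (L / 2)" unfolding h_def lns using L by (intro divide_right_mono) auto
      also have "\<dots> \<le> 1" using L4 by simp
      finally have "s * h s \<le> s * 1" using s2 by (intro mult_left_mono) auto
      then show "s * h s \<le> U" using sU by simp
    qed
    have J2: "J \<le> 2 * (x * hL)"
    proof -
      have "\<kappa> \<le> 1/2" using \<kappa> y10 by linarith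
      then have "\<kappa> * J \<le> 1/2 * J" using J by (intro mult_right_mono) auto
      then show ?thesis using J(1) hs hx by (simp add: abs_le_iff)
    qed
    have s8: "\<bar>J - x * hL\<bar> \<le> 2 * U"
    proof -
      have "\<kappa> * J \<le> 1/2 * (1 / y ^ 10) * (2 * (x * hL))" using \<kappa> J J2 by (intro mult_mono) auto
      then have "\<kappa> * J \<le> U" by (simp add: U_def)
      then show ?thesis using J(1) hs hx by (simp add: abs_le_iff)
    qed
    have s7: "\<bar>integral {s..x} (\<lambda>t. main_term m K (ln t)) - J\<bar> \<le> 30 * U"
    proof -
      have intG: "(\<lambda>t. main_term m K (ln t)) integrable_on {s..x}" using s2 by (intro integrable_main_term) auto
      have "\<bar>integral {s..x} (\<lambda>t. main_term m K (ln t) - h t)\<bar> \<le> integral {s..x} (\<lambda>t. 15 / y ^ 10 * h t)"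
        unfolding real_norm_def[symmetric]
      proof (intro integral_norm_bound_integral integrable_diff intG J integrable_on_mult_right)
        fix t assume t: "t \<in> {s..x}"
        have "ln s \<le> ln t" "ln t \<le> ln x" using t s2 by auto
        then have "exp y / 2 \<le> ln t" "ln t \<le> exp y" by (simp_all add: lns L_def)
        moreover have "real m \<le> exp (log_lambda y) * exp y" using m\<Lambda> by (simp add: \<Lambda>_def L_def g_def)
        ultimately have "\<bar>main_term m (max_tuple y) (ln t) - exp (- (real m / ln t)) / ln t\<bar> \<le> 15 / y ^ 10 * (exp (- (real m / ln t)) / ln t)"
          by (intro y1[rule_format])
        then show "norm (main_term m K (ln t) - h t) \<le> 15 / y ^ 10 * h t" by (simp add: K_def h_def)
      qed
      also have "\<dots> = 15 / y ^ 10 * J" by (simp add: J_def)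
      also have "\<dots> \<le> 15 / y ^ 10 * (2 * (x * hL))" using J2 y10 by (intro mult_left_mono) auto
      also have "\<dots> = 30 * U" by (simp add: U_def)
      finally show ?thesis using intG J(2) by (simp add: integral_diff J_def)
    qed
    \<comment> \<open>The sum \<open>36 = 1 + 2 + 1 + 30 + 2\<close> comes from \<open>s4\<close>,
      \<open>s5\<close>, \<open>s6\<close>, \<open>s7\<close> and \<open>s8\<close>.\<close>
    have total: "\<bar>real (gap_count A x (l * L)) - x * hL\<bar> \<le> 36 * U"
    proof -
      have "(real (card (tuples m K)) + real (card T)) * Err = card (tuples m K) * Err + card T * Err" by (simp add: distrib_right)
      then show ?thesis using s1 s2' s3 s4 s5 s6 s7 s8 sI split by linarith
    qed

    \<comment> \<open>Undoing the rounding of \<open>l * L\<close> to \<open>m\<close>, at a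
      relative cost of at most \<open>2 / L\<close>\<close>
    define W where "W = x * exp (- l) / L"
    have W0: "0 \<le> W" using s2 L by (simp add: W_def)
    have xW: "W \<le> x * hL" "x * hL \<le> W * (1 + 1 / y ^ 10)"
    proof -
      have "real m / L \<le> l" using m L by (simp add: field_simps)
      then have "exp (- l) \<le> exp (- (real m / L))" by simp
      then have "exp (- l) / L \<le> hL" unfolding hL_def using L by (intro divide_right_mono) auto
      then have "x * (exp (- l) / L) \<le> x * hL" using s2 by (intro mult_left_mono) auto
      then show "W \<le> x * hL" by (simp add: W_def)
      have "(l * L - 1) / L \<le> real m / L" using m L by (intro divide_right_mono) auto
      then have "l - 1 / L \<le> real m / L" using L by (simp add: diff_divide_distrib)
      then have "exp (- (real m / L)) \<le> exp (- l + 1 / L)" by simp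
      also have "\<dots> = exp (- l) * exp (1 / L)" by (rule exp_add)
      also have "\<dots> \<le> exp (- l) * (1 + 2 / L)"
      proof (intro mult_left_mono)
        have "exp (1 / L) \<le> 1 + 1 / L + (1 / L)\<^sup>2" using L4 by (intro exp_le_quadratic) auto
        moreover have "(1 / L)\<^sup>2 \<le> 1 / L" using L4 mult_left_le[of "1 / L" "1 / L"] by (simp add: power2_eq_square)
        ultimately show "exp (1 / L) \<le> 1 + 2 / L" by simp
      qed auto
      also have "\<dots> \<le> exp (- l) * (1 + 1 / y ^ 10)" using twoL by (intro mult_left_mono) auto
      finally have "hL \<le> exp (- l) * (1 + 1 / y ^ 10) / L" unfolding hL_def using L by (intro divide_right_mono) auto
      then have "x * hL \<le> x * (exp (- l) * (1 + 1 / y ^ 10) / L)" using s2 by (intro mult_left_mono) auto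
      then show "x * hL \<le> W * (1 + 1 / y ^ 10)" by (simp add: W_def mult_ac)
    qed
    have "U \<le> 2 * (1 / y ^ 10 * W)"
    proof -
      have "W * (1 + 1 / y ^ 10) \<le> W * 2" using W0 y10 by (intro mult_left_mono) auto
      then have "x * hL \<le> 2 * W" using xW by linarith
      then have "1 / y ^ 10 * (x * hL) \<le> 1 / y ^ 10 * (2 * W)" using y10 by (intro mult_left_mono) auto
      then show ?thesis by (simp add: U_def)
    qed
    moreover have "\<bar>x * hL - W\<bar> \<le> 1 / y ^ 10 * W" using xW by (simp add: distrib_left mult.commute)
    moreover have "0 \<le> 1 / y ^ 10 * W" using W0 y10 by simp
    ultimately have "\<bar>real (gap_count A x (l * L)) - W\<bar> \<le> 100 * (1 / y ^ 10 * W)"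
      using total by linarith
    then show "\<bar>real (gap_count A (exp (exp y)) (l * exp y)) - exp (exp y) * exp (- l) / exp y\<bar>
      \<le> 100 / y ^ 10 * (exp (exp y) * exp (- l) / exp y)"
      by (simp add: W_def x_def L_def)
  qed
  qed
qed

theorem theorem1p4:
  "\<exists>C::real. \<forall>A::nat set.
     A \<subseteq> {1..} \<and>
     HL (\<lambda>x. lambda_max x * ln x) (\<lambda>x. exp (sqrt (iter_log 2 x * iter_log 3 x))) A \<longrightarrow>
     (\<exists>x1::real. \<forall>x\<ge>x1. \<forall>l::real. 0 < l \<and> l \<le> lambda_max x \<longrightarrow>
        (\<exists>E::real. \<bar>E\<bar> \<le> C * (1 / iter_log 2 x ^ 10) \<and>
           real (gap_count A x (l * ln x)) = x * exp (- l) / ln x * (1 + E)))"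
proof -
  \<comment> \<open>Neither \<open>y0\<close> nor the constant 100 depends on \<open>A\<close>; only
    the threshold \<open>x0\<close> of the hypothesis does.\<close>
  obtain y0 where y0: "\<forall>y\<ge>y0. \<forall>A l. A \<subseteq> {1..} \<longrightarrow>
    tuple_asymptotics A y \<longrightarrow>
    0 < l \<longrightarrow> l \<le> exp (log_lambda y) \<longrightarrow>
    \<bar>real (gap_count A (exp (exp y)) (l * exp y)) - exp (exp y) * exp (- l) / exp y\<bar>
      \<le> 100 / y ^ 10 * (exp (exp y) * exp (- l) / exp y)"
    using gap_count_estimate unfolding eventually_at_top_linorder ..
  show ?thesis
  proof (rule exI[of _ 100], intro allI impI)
    fix A :: "nat set"
    assume as: "A \<subseteq> {1..} \<and> HL (\<lambda>x. lambda_max x * ln x) (\<lambda>x. exp (sqrt (iter_log 2 x * iter_log 3 x))) A"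
    obtain x0 where x0: "\<forall>x\<ge>x0. \<forall>H::int set.
       finite H \<and> (\<forall>h\<in>H. 0 \<le> h \<and> real_of_int h \<le> lambda_max x * ln x) \<and> real (card H) \<le> exp (sqrt (iter_log 2 x * iter_log 3 x)) \<longrightarrow>
        \<bar>real (tuple_count A H x) - singular_series H * integral {2..x} (\<lambda>t. 1 / ln t ^ card H)\<bar>
          \<le> x * exp (- exp (sqrt (iter_log 2 x * iter_log 3 x)) * iter_log 2 x)"
      using conjunct2[OF as] unfolding HL_def ..
    show "\<exists>x1::real. \<forall>x\<ge>x1. \<forall>l::real. 0 < l \<and> l \<le> lambda_max x \<longrightarrow>
        (\<exists>E::real. \<bar>E\<bar> \<le> 100 * (1 / iter_log 2 x ^ 10) \<and>
           real (gap_count A x (l * ln x)) = x * exp (- l) / ln x * (1 + E))"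
    \<comment> \<open>Requiring \<open>y \<ge> 1\<close> makes the truncations at 0 in
      \<open>iter_log\<close> inactive up to the third logarithm.\<close>
    proof (rule exI[of _ "max x0 (exp (exp (max y0 1)))"], intro allI impI)
      fix x l :: real
      assume x: "max x0 (exp (exp (max y0 1))) \<le> x" and l: "0 < l \<and> l \<le> lambda_max x"
      define y where "y = ln (ln x)"
      have x': "exp (exp (max y0 1)) \<le> x" using x by simp
      then have x00: "0 < x" by (meson exp_gt_zero less_le_trans)
      have lnx: "exp (max y0 1) \<le> ln x" using x' x00 by (simp add: ln_ge_iff)
      then have lnx0: "0 < ln x" by (meson exp_gt_zero less_le_trans)
      have yy: "max y0 1 \<le> y" unfolding y_def by (rule iffD2[OF ln_ge_iff[OF lnx0] lnx])
      have ey: "exp y = ln x" "exp (ln x) = x" using x00 lnx0 by (simp_all add: y_def)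
      have yge1: "1 \<le> y" using yy by simp
      have i2: "iter_log 2 x = y"
      proof -
        have "1 \<le> exp (max y0 1)" by simp
        then have "1 \<le> ln x" using lnx by (rule order_trans)
        then show ?thesis using yge1 by (simp add: numeral_2_eq_2 y_def max_def)
      qed
      have "iter_log 3 x = max 0 (ln (iter_log 2 x))" by (simp only: numeral_3_eq_3 numeral_2_eq_2 iter_log.simps)
      then have i3: "iter_log 3 x = ln y" using i2 yge1 by simp
      have lam: "lambda_max x = exp (log_lambda y)"
        unfolding lambda_max_def i2 i3 log_lambda_def by (simp add: real_sqrt_divide)
      have hl: "tuple_asymptotics A y"
        unfolding tuple_asymptotics_def ey
      proof (intro allI impI)
        fix H :: "int set"
        assume H: "finite H \<and> (\<forall>h\<in>H. 0 \<le> h \<and> real_of_int h \<le> exp (log_lambda y) * ln x) \<and> real (card H) \<le> exp (sqrt (y * ln y))"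
        have "x0 \<le> x" using x by simp
        from x0[THEN spec[of _ x], THEN mp, OF this, THEN spec[of _ H], unfolded lam i2 i3, THEN mp, OF H]
        show "\<bar>real (tuple_count A H x) - singular_series H * integral {2..x} (\<lambda>t. 1 / ln t ^ card H)\<bar>
          \<le> x * exp (- exp (sqrt (y * ln y)) * y)" .
      qed
      define W where "W = x * exp (- l) / ln x"
      have W: "W > 0" using x00 lnx0 by (simp add: W_def)
      have "y0 \<le> y" "A \<subseteq> {1..}" "0 < l" "l \<le> exp (log_lambda y)" using yy as l lam by simp_all
      from y0[THEN spec[of _ y], THEN mp, OF this(1), THEN spec[of _ A], THEN spec[of _ l], THEN mp, OF this(2),
          THEN mp, OF hl, THEN mp, OF this(3), THEN mp, OF this(4)]
      have "\<bar>real (gap_count A x (l * ln x)) - W\<bar> \<le> 100 / y ^ 10 * W"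
        unfolding ey W_def .
      then have "\<bar>real (gap_count A x (l * ln x)) / W - 1\<bar> \<le> 100 * (1 / iter_log 2 x ^ 10)"
        using W by (simp add: i2 abs_le_iff field_simps)
      then show "\<exists>E::real. \<bar>E\<bar> \<le> 100 * (1 / iter_log 2 x ^ 10) \<and>
           real (gap_count A x (l * ln x)) = x * exp (- l) / ln x * (1 + E)"
        using W by (intro exI[of _ "real (gap_count A x (l * ln x)) / W - 1"]) (simp add: W_def[symmetric])
    qed
  qed
qed

end
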